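(* Let $m$ be a positive integer and $\lambda=(m-1)/2$. (a)(i) If $f\in\Lambda_{m+1}$ and $m\ge 1$, then $\mathcal I^\lambda_+ f\in\Lambda_m$ and $\mathcal I^\lambda_- f\in\Lambda_m$. (a)(ii) If $f\in\Lambda^+_{m+1}$ and $m\ge 2$, then $\mathcal I^\lambda_+ f\in\Lambda^+_m$ and $\mathcal I^\lambda_- f\in\Lambda^+_m$. (b) Let $m\ge 1$ and let $f\in\Lambda^+_{m+1}$ be nonnegative on $[-1,1]$, with Gegenbauer expansion $f\sim\sum_{n=0}^\infty a_n C^{\lambda+1/2}_n$ in which every coefficient $a_n$ is strictly positive. Then $\mathcal I^\lambda_+ f$ is nonnegative on $[-1,1]$, $\mathcal I^\lambda_+ f\in\Lambda^+_m$, and all coefficients $b_n$ in the expansion $\mathcal I^\lambda_+ f\sim\sum_{n=0}^\infty b_n C^\lambda_n$ are strictly positive (for $\lambda=0$ the system $\{C^0_n\}$ is understood as $C^0_0=1$, $C^0_n=\frac2n T_n$ for $n\ge1$, with $T_n$ the Chebyshev polynomials).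
   Context: For an integer $k\ge1$, $\mathbb S^k\subset\mathbb R^{k+1}$ is the unit sphere and $\theta(x,y)=\arccos(x^Ty)$ the geodesic distance. A continuous $g:[0,\pi]\to\mathbb R$ is positive definite on $\mathbb S^k$ if $\sum_{i,j=1}^n c_ic_j g(\theta(x_i,x_j))\ge0$ for all $n$, all distinct $x_1,\dots,x_n\in\mathbb S^k$ and all real $c_i$; strictly positive definite if the inequality is strict whenever the $c_i$ are not all zero. $\Lambda_k$ denotes the set of $f\in C[-1,1]$ such that $f(\cos\cdot)$ is positive definite on $\mathbb S^k$, and $\Lambda_k^+\subset\Lambda_k$ the subset for which $f(\cos\cdot)$ is strictly positive definite on $\mathbb S^k$. $C^\mu_n$ are the Gegenbauer (ultraspherical) polynomials with the standard normalization $\sum_n C^\mu_n(x)r^n=(1-2xr+r^2)^{-\mu}$; a Gegenbauer expansion $f\sim\sum a_nC^\mu_n$ means the formal Fourier series with respect to the weight $(1-t^2)^{\mu-1/2}$ on $[-1,1]$. For $f\in L^1[-1,1]$ and $\lambda\ge0$ define $I^\lambda_+f(x)=(1+x)^{-\lambda+1/2}\int_{-1}^x(x-\tau)^{-1/2}(1+\tau)^\lambda f(\tau)\,d\tau$, $I^\lambda_-f(x)=(1-x)^{-\lambda+1/2}\int_x^1(\tau-x)^{-1/2}(1-\tau)^\lambda f(\tau)\,d\tau$, and $\mathcal I^\lambda_+=I^\lambda_++I^\lambda_-$, $\mathcal I^\lambda_-=I^\lambda_+-I^\lambda_-$. *)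

theory Defs
  imports "HOL-Analysis.Analysis"
begin

text \<open>Points of the unit sphere S^k in R^(k+1), represented as functions nat => real
  supported on the indices 0..k.\<close>
definition sphere_pts :: "nat \<Rightarrow> (nat \<Rightarrow> real) set" where
  "sphere_pts k = {x. (\<forall>i>k. x i = 0) \<and> (\<Sum>i\<le>k. (x i)^2) = 1}"

definition sph_inner :: "nat \<Rightarrow> (nat \<Rightarrow> real) \<Rightarrow> (nat \<Rightarrow> real) \<Rightarrow> real" where
  "sph_inner k x y = (\<Sum>i\<le>k. x i * y i)"

definition geo_dist :: "nat \<Rightarrow> (nat \<Rightarrow> real) \<Rightarrow> (nat \<Rightarrow> real) \<Rightarrow> real" where
  "geo_dist k x y = arccos (sph_inner k x y)"

text \<open>Positive definiteness on S^k; a finite set of points encodes distinct points.\<close>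
definition pos_def_sphere :: "nat \<Rightarrow> (real \<Rightarrow> real) \<Rightarrow> bool" where
  "pos_def_sphere k g \<longleftrightarrow> continuous_on {0..pi} g \<and>
     (\<forall>X c. finite X \<and> X \<subseteq> sphere_pts k \<longrightarrow>
        (\<Sum>x\<in>X. \<Sum>y\<in>X. c x * c y * g (geo_dist k x y)) \<ge> 0)"

definition strict_pos_def_sphere :: "nat \<Rightarrow> (real \<Rightarrow> real) \<Rightarrow> bool" where
  "strict_pos_def_sphere k g \<longleftrightarrow> continuous_on {0..pi} g \<and>
     (\<forall>X c. finite X \<and> X \<subseteq> sphere_pts k \<and> (\<exists>x\<in>X. c x \<noteq> 0) \<longrightarrow>
        (\<Sum>x\<in>X. \<Sum>y\<in>X. c x * c y * g (geo_dist k x y)) > 0)"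

definition Lambda :: "nat \<Rightarrow> (real \<Rightarrow> real) set" where
  "Lambda k = {f. continuous_on {-1..1} f \<and> pos_def_sphere k (\<lambda>t. f (cos t))}"

definition Lambda_plus :: "nat \<Rightarrow> (real \<Rightarrow> real) set" where
  "Lambda_plus k = {f. f \<in> Lambda k \<and> strict_pos_def_sphere k (\<lambda>t. f (cos t))}"

text \<open>Gegenbauer polynomials with the normalization given by the generating function
  (1 - 2xr + r^2)^(-mu), via the three-term recurrence.\<close>
fun gegenbauer :: "real \<Rightarrow> nat \<Rightarrow> real \<Rightarrow> real" where
  "gegenbauer mu 0 x = 1"
| "gegenbauer mu (Suc 0) x = 2 * mu * x"
| "gegenbauer mu (Suc (Suc n)) x =
     (2 * x * (real (Suc n) + mu) * gegenbauer mu (Suc n) x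
      - (real n + 2 * mu) * gegenbauer mu n x) / real (Suc (Suc n))"

fun chebyshev_T :: "nat \<Rightarrow> real \<Rightarrow> real" where
  "chebyshev_T 0 x = 1"
| "chebyshev_T (Suc 0) x = x"
| "chebyshev_T (Suc (Suc n)) x = 2 * x * chebyshev_T (Suc n) x - chebyshev_T n x"

definition gegen_sys :: "real \<Rightarrow> nat \<Rightarrow> real \<Rightarrow> real" where
  "gegen_sys mu n x =
     (if mu = 0 then (if n = 0 then 1 else 2 / real n * chebyshev_T n x)
      else gegenbauer mu n x)"

definition gegen_weight :: "real \<Rightarrow> real \<Rightarrow> real" where
  "gegen_weight mu t = (1 - t^2) powr (mu - 1/2)"

definition gegen_coeff :: "real \<Rightarrow> (real \<Rightarrow> real) \<Rightarrow> nat \<Rightarrow> real" where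
  "gegen_coeff mu f n =
     (LINT t:{-1..1}|lborel. f t * gegen_sys mu n t * gegen_weight mu t) /
     (LINT t:{-1..1}|lborel. (gegen_sys mu n t)^2 * gegen_weight mu t)"

definition I_plus :: "real \<Rightarrow> (real \<Rightarrow> real) \<Rightarrow> real \<Rightarrow> real" where
  "I_plus lam f x = (1 + x) powr (- lam + 1/2) *
     (LINT \<tau>:{-1..x}|lborel. (x - \<tau>) powr (-1/2) * (1 + \<tau>) powr lam * f \<tau>)"

definition I_minus :: "real \<Rightarrow> (real \<Rightarrow> real) \<Rightarrow> real \<Rightarrow> real" where
  "I_minus lam f x = (1 - x) powr (- lam + 1/2) *
     (LINT \<tau>:{x..1}|lborel. (\<tau> - x) powr (-1/2) * (1 - \<tau>) powr lam * f \<tau>)"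

definition cI_plus :: "real \<Rightarrow> (real \<Rightarrow> real) \<Rightarrow> real \<Rightarrow> real" where
  "cI_plus lam f x = I_plus lam f x + I_minus lam f x"

definition cI_minus :: "real \<Rightarrow> (real \<Rightarrow> real) \<Rightarrow> real \<Rightarrow> real" where
  "cI_minus lam f x = I_plus lam f x - I_minus lam f x"

end

theory Submission
  imports Defs
begin

text \<open>Write \<open>R\<^sup>d\<^sub>n\<close> for the Gegenbauer polynomial of index \<open>d / 2\<close> normalised by \<open>R\<^sup>d\<^sub>n(1) = 1\<close>
  (\<open>ultra d n\<close> below). By Schoenberg's theorem the members of \<open>\<Lambda>\<^sub>d\<^sub>+\<^sub>1\<close> are the series
  \<open>\<Sum> a\<^sub>n R\<^sup>d\<^sub>n\<close> with summable coefficients \<open>a\<^sub>n \<ge> 0\<close>. For \<open>\<lambda> = d / 2\<close> comparing coefficients in powers of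
  \<open>(1 - x) / 2\<close> gives \<open>I\<^sub>\<plusminus> R\<^sup>d\<^sup>+\<^sup>1\<^sub>n = \<alpha>\<^sub>n (R\<^sup>d\<^sub>n \<plusminus> R\<^sup>d\<^sub>n\<^sub>+\<^sub>1)\<close> with \<open>\<alpha>\<^sub>n > 0\<close>, so the sum of the two operators
  maps \<open>R\<^sup>d\<^sup>+\<^sup>1\<^sub>n\<close> to \<open>2 \<alpha>\<^sub>n R\<^sup>d\<^sub>n\<close> and the difference maps it to \<open>2 \<alpha>\<^sub>n R\<^sup>d\<^sub>n\<^sub>+\<^sub>1\<close>. Strictness means, for \<open>d \<ge> 1\<close>, that infinitely
  many even and infinitely many odd coefficients are positive, a property that both maps preserve;
  when all coefficients are positive, strictness holds for \<open>d = 0\<close> as well.\<close>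

section \<open>Normalised ultraspherical polynomials\<close>

text \<open>Neither Schoenberg's theorem nor the criterion for strictness is taken as given.
  Spherical harmonics and rotations are avoided: the surface measure is built recursively in polar
  coordinates, and the invariance it has enters only as the fact that the integral of (u . v)^n
  depends on v through its norm alone. From this comes the Funk--Hecke identity for
  \<open>ultra d n\<close>, and from that the key closure property: multiplying a positive definite
  kernel by \<open>ultra d n\<close> keeps it positive definite. Each coefficient is therefore, up
  to a positive factor, the mean of a positive definite kernel, hence nonnegative.

  The restriction to m \<ge> 2 in (a)(ii) comes from the circle. For d = 0 the values cos (n \<phi>)
  do not tend to 0, and the multiples of 3 contain infinitely many indices of each parity without
  separating the vertices of a regular triangle. With all coefficients positive, kernels
  concentrating at t = 1 replace the missing decay. Necessity of the parity condition is used on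
  S^(m+1), its sufficiency on S^m.\<close>

text \<open>The normalised polynomial is the hypergeometric sum \<open>F(-n, n + d; (d + 1) / 2; (1 - x) / 2)\<close>.\<close>
definition ucoeff :: "nat \<Rightarrow> nat \<Rightarrow> nat \<Rightarrow> real" where
  "ucoeff d n j = pochhammer (- real n) j * pochhammer (real n + real d) j /
     (pochhammer ((real d + 1) / 2) j * fact j)"

definition upoly :: "nat \<Rightarrow> nat \<Rightarrow> real poly" where
  "upoly d n = (\<Sum>j\<le>n. monom (ucoeff d n j) j)"

definition ultra :: "nat \<Rightarrow> nat \<Rightarrow> real \<Rightarrow> real" where
  "ultra d n x = poly (upoly d n) ((1 - x) / 2)"

lemma ucoeff_eq_0: "n < j \<Longrightarrow> ucoeff d n j = 0"
  unfolding ucoeff_def by (simp add: pochhammer_of_nat_eq_0_iff)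

lemma ucoeff_0 [simp]: "ucoeff d n 0 = 1"
  by (simp add: ucoeff_def)

lemma coeff_upoly: "coeff (upoly d n) j = ucoeff d n j"
proof -
  have "coeff (upoly d n) j = (\<Sum>i\<le>n. if i = j then ucoeff d n i else 0)"
    by (simp add: upoly_def coeff_sum)
  then show ?thesis
    by (cases "j \<le> n") (auto simp: ucoeff_eq_0)
qed

lemma upoly_0 [simp]: "upoly d 0 = 1"
  by (simp add: upoly_def monom_0 one_pCons)

lemma ultra_0 [simp]: "ultra d 0 x = 1"
  by (simp add: ultra_def)

lemma ultra_at_1 [simp]: "ultra d n 1 = 1"
  by (simp add: ultra_def poly_0_coeff_0 coeff_upoly)

lemma degree_upoly: "degree (upoly d n) = n"
proof (rule order_antisym)
  show "degree (upoly d n) \<le> n"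
    by (rule degree_le) (simp add: coeff_upoly ucoeff_eq_0)
  have "ucoeff d n n \<noteq> 0"
  proof (cases n)
    case (Suc k)
    have "pochhammer (- real n) n \<noteq> 0"
      by (simp add: pochhammer_of_nat_eq_0_iff)
    moreover have "pochhammer (real n + real d) n > 0" "pochhammer ((real d + 1) / 2) n > 0"
      using Suc by (auto intro!: pochhammer_pos)
    ultimately show ?thesis by (simp add: ucoeff_def)
  qed simp
  then show "n \<le> degree (upoly d n)"
    by (intro le_degree) (simp add: coeff_upoly)
qed

lemma ultra_1 [simp]: "ultra d (Suc 0) x = x"
  by (simp add: ultra_def upoly_def ucoeff_def monom_Suc poly_monom field_simps
           del: of_nat_Suc)

text \<open>As x = 1 - 2 z for z = (1 - x) / 2, multiplication by x replaces a coefficient c_j by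
  c_j - 2 c_(j-1); this is the three-term recurrence read off in powers of z.\<close>

lemma ucoeff_rec:
  "(real n + 1 + real d) * ucoeff d (n + 2) (Suc j) =
   (2 * real n + 2 + real d) * (ucoeff d (n + 1) (Suc j) - 2 * ucoeff d (n + 1) j)
     - (real n + 1) * ucoeff d n (Suc j)"
proof -
  define D where "D = real d"
  define N where "N = real n"
  define q where "q = (D + 1) / 2"
  have q: "q > 0" by (simp add: q_def D_def)
  show ?thesis
  proof (cases j)
    case 0
    then show ?thesis
      using q unfolding ucoeff_def D_def[symmetric] N_def[symmetric] q_def[symmetric]
      by (simp add: N_def[symmetric] field_simps) (simp add: q_def field_simps)
  next
    case (Suc i)
    define A where "A = pochhammer (- N) i"
    define P where "P = pochhammer (N + D + 2) i"
    define Q where "Q = pochhammer q i"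
    define r where "r = real i"
    have Q: "Q > 0" using q by (auto simp: Q_def intro: pochhammer_pos)
    have r: "r \<ge> 0" by (simp add: r_def)
    have a1: "pochhammer (- (N + 2)) (Suc (Suc i)) = (N + 2) * (N + 1) * A"
    proof -
      have "pochhammer (- (N + 2)) (Suc (Suc i)) = - (N + 2) * (- (N + 1) * pochhammer (- N) i)"
        by (simp only: pochhammer_rec) (simp add: algebra_simps)
      then show ?thesis by (simp add: A_def algebra_simps)
    qed
    have a2: "pochhammer (- (N + 1)) (Suc i) = - (N + 1) * A"
      using pochhammer_rec[of "-(N+1)" i] by (simp add: A_def algebra_simps)
    have a3: "pochhammer (- (N + 1)) (Suc (Suc i)) = - (N + 1) * A * (r - N)"
      unfolding pochhammer_Suc[of _ "Suc i"] a2 by (simp add: r_def algebra_simps)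
    have a4: "pochhammer (- N) (Suc (Suc i)) = A * (r - N) * (r - N + 1)"
      unfolding pochhammer_Suc A_def by (simp add: r_def algebra_simps)
    have p1: "pochhammer (N + 2 + D) (Suc (Suc i)) = P * (N + D + 2 + r) * (N + D + 3 + r)"
      unfolding pochhammer_Suc P_def by (simp add: r_def algebra_simps)
    have p2: "pochhammer (N + 1 + D) (Suc i) = (N + 1 + D) * P"
      unfolding pochhammer_rec P_def by (simp add: algebra_simps)
    have p3: "pochhammer (N + 1 + D) (Suc (Suc i)) = (N + 1 + D) * P * (N + D + 2 + r)"
      unfolding pochhammer_Suc[of _ "Suc i"] p2 by (simp add: r_def algebra_simps)
    have p4: "pochhammer (N + D) (Suc (Suc i)) = (N + D) * (N + D + 1) * P"
      unfolding pochhammer_rec P_def by (simp add: algebra_simps)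
    have q1: "pochhammer q (Suc i) = Q * (q + r)"
      by (simp add: pochhammer_Suc Q_def r_def)
    have q2: "pochhammer q (Suc (Suc i)) = Q * (q + r) * (q + r + 1)"
      by (simp add: pochhammer_Suc Q_def r_def algebra_simps)
    have f1: "(fact (Suc i) :: real) = (r + 1) * fact i"
      by (simp add: r_def)
    have f2: "(fact (Suc (Suc i)) :: real) = (r + 2) * (r + 1) * fact i"
      by (simp add: r_def algebra_simps)
    \<comment> \<open>All four coefficients are polynomial multiples of this one factor, so the
      claim becomes a polynomial identity once D is replaced by 2 q - 1.\<close>
    define K where "K = A * P / (Q * (q + r) * (q + r + 1) * ((r + 2) * (r + 1) * fact i))"
    have c1: "ucoeff d (n + 2) (Suc j) = K * ((N + 2) * (N + 1) * ((N + D + 2 + r) * (N + D + 3 + r)))"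
      unfolding ucoeff_def Suc D_def[symmetric] of_nat_add N_def[symmetric] q_def[symmetric]
        of_nat_numeral a1 p1 q2 f2 K_def by simp
    have c2: "ucoeff d (n + 1) (Suc j) = K * (- (N + 1) * (r - N) * ((N + 1 + D) * (N + D + 2 + r)))"
      unfolding ucoeff_def Suc D_def[symmetric] of_nat_add N_def[symmetric] q_def[symmetric]
        of_nat_1 a3 p3 q2 f2 K_def by simp
    have c3: "ucoeff d (n + 1) j = K * (- (N + 1) * (N + 1 + D) * ((q + r + 1) * (r + 2)))"
    proof -
      have "q + r + 1 \<noteq> 0" "r + 2 \<noteq> 0" using q r by linarith+
      then show ?thesis
      unfolding ucoeff_def Suc D_def[symmetric] of_nat_add N_def[symmetric] q_def[symmetric]
        of_nat_1 a2 p2 q1 f1 K_def by (simp add: mult_ac)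
    qed
    have c4: "ucoeff d n (Suc j) = K * ((r - N) * (r - N + 1) * ((N + D) * (N + D + 1)))"
      unfolding ucoeff_def Suc D_def[symmetric] N_def[symmetric] q_def[symmetric]
        a4 p4 q2 f2 K_def by simp
    have D: "D = 2 * q - 1" by (simp add: q_def add_divide_distrib)
    show ?thesis
      unfolding c1 c2 c3 c4 D_def[symmetric] N_def[symmetric] D by algebra
  qed
qed

lemma upoly_rec:
  "smult (real n + 1 + real d) (upoly d (n + 2)) =
   smult (2 * real n + 2 + real d) ([:1, -2:] * upoly d (n + 1)) - smult (real n + 1) (upoly d n)"
proof (rule poly_eqI)
  fix j
  show "coeff (smult (real n + 1 + real d) (upoly d (n + 2))) j =
    coeff (smult (2 * real n + 2 + real d) ([:1, -2:] * upoly d (n + 1))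
      - smult (real n + 1) (upoly d n)) j"
  proof (cases j)
    case 0
    then show ?thesis by (simp add: coeff_upoly mult_pCons_left)
  next
    case (Suc i)
    then show ?thesis
      using ucoeff_rec[of n d i] by (simp add: coeff_upoly mult_pCons_left coeff_pCons algebra_simps)
  qed
qed

lemma ultra_rec:
  "(real n + 1 + real d) * ultra d (n + 2) x =
   (2 * real n + 2 + real d) * x * ultra d (n + 1) x - (real n + 1) * ultra d n x"
proof -
  define z where "z = (1 - x) / 2"
  have x: "x = 1 - 2 * z" by (simp add: z_def field_simps)
  have u: "ultra d i x = poly (upoly d i) z" for i by (simp add: ultra_def z_def)
  show ?thesis
    using arg_cong[OF upoly_rec[of n d], of "\<lambda>p. poly p z"] unfolding u
    by (simp add: x algebra_simps)
qed

lemma ultra_minus: "ultra d n (- x) = (-1) ^ n * ultra d n x"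
proof (induction n rule: induct_nat_012)
  case (ge2 n)
  have "(real n + 1 + real d) * ultra d (n + 2) (- x) =
        (-1) ^ n * ((2 * real n + 2 + real d) * x * ultra d (n + 1) x - (real n + 1) * ultra d n x)"
    unfolding ultra_rec[of n d "-x"] using ge2 by (simp add: algebra_simps)
  also have "\<dots> = (real n + 1 + real d) * ((-1) ^ n * ultra d (n + 2) x)"
    unfolding ultra_rec[of n d x, symmetric] by simp
  finally have "(real n + 1 + real d) * ultra d (n + 2) (- x) =
        (real n + 1 + real d) * ((-1) ^ n * ultra d (n + 2) x)" .
  moreover have "real n + 1 + real d \<noteq> 0" by linarith
  ultimately show ?case by simp
qed simp_all

lemma chebyshev_T_eq_ultra: "chebyshev_T n x = ultra 0 n x"
proof (induction n rule: induct_nat_012)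
  case (ge2 n)
  have "(real n + 1) * ultra 0 (n + 2) x = (real n + 1) * (2 * x * ultra 0 (n + 1) x - ultra 0 n x)"
    using ultra_rec[of n 0 x] by (simp add: algebra_simps)
  moreover have "real n + 1 \<noteq> 0" by linarith
  ultimately have "ultra 0 (n + 2) x = 2 * x * ultra 0 (n + 1) x - ultra 0 n x"
    using mult_left_cancel by blast
  with ge2 show ?case by simp
qed simp_all

text \<open>The factor is the value of the Gegenbauer polynomial at 1. For d = 0 it vanishes when n
  \<ge> 1, which is why \<open>gegen_sys\<close> treats that index separately.\<close>

lemma gegenbauer_eq_ultra:
  "gegenbauer (real d / 2) n x = pochhammer (real d) n / fact n * ultra d n x"
proof (induction n rule: induct_nat_012)
  case (ge2 n)
  define D where "D = real d"
  define N where "N = real n"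
  define P where "P = pochhammer D n / fact n"
  have N: "N \<ge> 0" by (simp add: N_def)
  have D: "D \<ge> 0" by (simp add: D_def)
  have g1: "pochhammer D (Suc n) / fact (Suc n) = P * (D + N) / (N + 1)"
    by (simp add: P_def N_def pochhammer_Suc)
  have g2: "pochhammer D (Suc (Suc n)) / fact (Suc (Suc n)) = P * (D + N) * (D + N + 1) / ((N + 1) * (N + 2))"
    using N by (simp add: P_def N_def pochhammer_Suc algebra_simps)
  have r: "(N + 1 + D) * ultra d (Suc (Suc n)) x =
   (2 * N + 2 + D) * x * ultra d (Suc n) x - (N + 1) * ultra d n x"
    using ultra_rec[of n d x] by (simp add: D_def N_def)
  have g: "gegenbauer (real d / 2) (Suc n) x = P * (D + N) / (N + 1) * ultra d (Suc n) x"
    "gegenbauer (real d / 2) n x = P * ultra d n x"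
    unfolding g1[symmetric] unfolding D_def P_def using ge2 by simp_all
  have "gegenbauer (real d / 2) (Suc (Suc n)) x =
      (x * (2 * N + 2 + D) * (P * (D + N) / (N + 1) * ultra d (Suc n) x)
        - (N + D) * (P * ultra d n x)) / (N + 2)"
    unfolding gegenbauer.simps g D_def N_def by (simp add: algebra_simps)
  also have "\<dots> = P * (D + N) / ((N + 1) * (N + 2)) *
       ((2 * N + 2 + D) * x * ultra d (Suc n) x - (N + 1) * ultra d n x)"
    using N by (simp add: divide_simps) (simp add: algebra_simps)
  also have "\<dots> = pochhammer D (Suc (Suc n)) / fact (Suc (Suc n)) * ultra d (Suc (Suc n)) x"
    unfolding r[symmetric] g2 by (simp add: ac_simps)
  finally show ?case by (simp add: D_def)
qed simp_all

text \<open>Part (b) asks only for signs of coefficients, so the value of the positive factor need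
  not be tracked.\<close>

lemma gegen_sys_eq_ultra: "\<exists>c>0. gegen_sys (real d / 2) n = (\<lambda>x. c * ultra d n x)"
proof (cases "d = 0")
  case True
  then show ?thesis
    by (intro exI[of _ "if n = 0 then 1 else 2 / real n"])
      (auto simp: gegen_sys_def fun_eq_iff chebyshev_T_eq_ultra)
next
  case False
  then show ?thesis
    by (intro exI[of _ "pochhammer (real d) n / fact n"])
      (auto simp: gegen_sys_def fun_eq_iff gegenbauer_eq_ultra intro!: pochhammer_pos divide_pos_pos)
qed

lemma poly_in_span_upoly:
  "degree p \<le> n \<Longrightarrow> \<exists>b. p = (\<Sum>j\<le>n. smult (b j) (upoly d j))"
proof (induction n arbitrary: p)
  case 0
  then show ?case
    by (intro exI[of _ "\<lambda>_. coeff p 0"]) (auto simp: degree_eq_zeroE elim: degree_eq_zeroE)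
next
  case (Suc n)
  define c where "c = coeff p (Suc n) / coeff (upoly d (Suc n)) (Suc n)"
  have nz: "coeff (upoly d (Suc n)) (Suc n) \<noteq> 0"
    using degree_upoly[of d "Suc n"] by (metis leading_coeff_0_iff degree_0 nat.distinct(1))
  have "degree (p - smult c (upoly d (Suc n))) \<le> n"
  proof (rule degree_le, intro allI impI)
    fix i assume "n < i"
    then consider "i = Suc n" | "i > Suc n" by linarith
    then show "coeff (p - smult c (upoly d (Suc n))) i = 0"
    proof cases
      case 1 then show ?thesis using nz by (simp add: c_def)
    next
      case 2 then show ?thesis
        using Suc.prems by (simp add: coeff_eq_0 degree_upoly)
    qed
  qed
  then obtain b where b: "p - smult c (upoly d (Suc n)) = (\<Sum>j\<le>n. smult (b j) (upoly d j))"
    using Suc.IH by blast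
  have "p = (\<Sum>j\<le>n. smult (b j) (upoly d j)) + smult c (upoly d (Suc n))"
    by (simp add: b[symmetric])
  also have "\<dots> = (\<Sum>j\<le>Suc n. smult ((b(Suc n := c)) j) (upoly d j))"
    by simp
  finally show ?case by blast
qed

lemma polynomial_in_span_ultra:
  assumes "degree p \<le> n"
  shows "\<exists>b. \<forall>t. poly p t = (\<Sum>j\<le>n. b j * ultra d j t)"
proof -
  have "degree (pcompose p [:1, -2:]) \<le> n"
    using assms by (simp add: degree_pcompose)
  then obtain b where b: "pcompose p [:1, -2:] = (\<Sum>j\<le>n. smult (b j) (upoly d j))"
    using poly_in_span_upoly by blast
  have "poly p t = (\<Sum>j\<le>n. b j * ultra d j t)" for t
    using arg_cong[OF b, of "\<lambda>q. poly q ((1 - t) / 2)"]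
    by (simp add: poly_pcompose poly_sum ultra_def diff_divide_distrib)
  then show ?thesis by blast
qed

lemma ultra_is_polynomial: "\<exists>p. degree p = n \<and> ultra d n = poly p"
proof (intro exI conjI)
  show "degree (pcompose (upoly d n) [:1/2, -1/2:]) = n"
    by (simp add: degree_pcompose degree_upoly)
  show "ultra d n = poly (pcompose (upoly d n) [:1/2, -1/2:])"
    by (auto simp: ultra_def poly_pcompose fun_eq_iff diff_divide_distrib)
qed

section \<open>The zonal integral\<close>

text \<open>Up to a constant the mean of h (u . x) over u in S^(d+1), and equally the integral of h
  against (1 - t^2)^((d-1)/2). In the angle the integrand stays continuous even for d = 0, where the
  weight in t is singular.\<close>

definition zonal :: "nat \<Rightarrow> (real \<Rightarrow> real) \<Rightarrow> real" where
  "zonal d h = integral {0..pi} (\<lambda>\<phi>. sin \<phi> ^ d * h (cos \<phi>))"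

lemma zonal_integrand_continuous:
  "continuous_on {-1..1} h \<Longrightarrow> continuous_on {0..pi} (\<lambda>\<phi>. sin \<phi> ^ d * h (cos \<phi>))"
  by (intro continuous_intros continuous_on_compose2[of "{-1..1}" h "{0..pi}" cos]) auto

lemma zonal_integrable:
  "continuous_on {-1..1} h \<Longrightarrow> (\<lambda>\<phi>. sin \<phi> ^ d * h (cos \<phi>)) integrable_on {0..pi}"
  by (intro integrable_continuous_real zonal_integrand_continuous)

lemma zonal_cong: "(\<And>t. t \<in> {-1..1} \<Longrightarrow> f t = g t) \<Longrightarrow> zonal d f = zonal d g"
  unfolding zonal_def by (intro integral_cong) auto

lemma zonal_0 [simp]: "zonal d (\<lambda>t. 0) = 0"
  by (simp add: zonal_def)

lemma zonal_add:
  assumes "continuous_on {-1..1} f" "continuous_on {-1..1} g"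
  shows "zonal d (\<lambda>t. f t + g t) = zonal d f + zonal d g"
  unfolding zonal_def using assms
  by (simp add: distrib_left integral_add zonal_integrable)

lemma zonal_cmult: "zonal d (\<lambda>t. c * f t) = c * zonal d f"
proof -
  have "zonal d (\<lambda>t. c * f t) = integral {0..pi} (\<lambda>\<phi>. c * (sin \<phi> ^ d * f (cos \<phi>)))"
    unfolding zonal_def by (intro integral_cong) auto
  then show ?thesis by (simp add: zonal_def)
qed

lemma zonal_diff:
  assumes "continuous_on {-1..1} f" "continuous_on {-1..1} g"
  shows "zonal d (\<lambda>t. f t - g t) = zonal d f - zonal d g"
  using zonal_add[OF assms(1), of "\<lambda>t. -1 * g t" d] zonal_cmult[of d "-1" g] assms(2)
  by (auto intro!: continuous_intros)

lemma zonal_sum: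
  assumes "finite A" "\<And>i. i \<in> A \<Longrightarrow> continuous_on {-1..1} (f i)"
  shows "zonal d (\<lambda>t. \<Sum>i\<in>A. f i t) = (\<Sum>i\<in>A. zonal d (f i))"
  using assms
proof (induction A rule: finite_induct)
  case (insert x F)
  then show ?case
    by (simp add: zonal_add continuous_on_sum)
qed simp

lemma zonal_mono:
  assumes "continuous_on {-1..1} f" "continuous_on {-1..1} g" "\<And>t. t \<in> {-1..1} \<Longrightarrow> f t \<le> g t"
  shows "zonal d f \<le> zonal d g"
  unfolding zonal_def using assms
  by (intro integral_le zonal_integrable mult_left_mono zero_le_power sin_ge_zero) auto

lemma zonal_nonneg:
  assumes "continuous_on {-1..1} f" "\<And>t. t \<in> {-1..1} \<Longrightarrow> 0 \<le> f t"
  shows "0 \<le> zonal d f"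
  using zonal_mono[of "\<lambda>_. 0" f d] assms by simp

lemma zonal_eq_0_imp:
  assumes f: "continuous_on {-1..1} f" and nn: "\<And>t. t \<in> {-1..1} \<Longrightarrow> 0 \<le> f t"
    and z: "zonal d f = 0" and t: "t \<in> {-1..1}"
  shows "f t = 0"
proof -
  have 0: "\<forall>\<phi>\<in>{0..pi}. sin \<phi> ^ d * f (cos \<phi>) = 0"
    using z integral_eq_0_iff[OF zonal_integrand_continuous[OF f, of d]] nn
    by (auto simp: zonal_def sin_ge_zero)
  have i: "f s = 0" if "s \<in> {-1<..<1}" for s
  proof -
    have "arccos s \<in> {0<..<pi}" "cos (arccos s) = s"
      using that by (auto simp: arccos_lt_bounded)
    then show ?thesis
      using 0 sin_gt_zero[of "arccos s"] by (auto dest!: bspec[of _ _ "arccos s"])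
  qed
  \<comment> \<open>For d > 0 the weight vanishes at both ends of the interval, so t = 1 and t = -1
    are reached by continuity.\<close>
  show ?thesis
    using continuous_constant_on_closure[of "{-1<..<1}" f 0 t] f t i by auto
qed

lemma zonal_pos:
  assumes "continuous_on {-1..1} f" "\<And>t. t \<in> {-1..1} \<Longrightarrow> 0 \<le> f t" "f s \<noteq> 0" "s \<in> {-1..1}"
  shows "0 < zonal d f"
  using zonal_nonneg[OF assms(1,2), of d] zonal_eq_0_imp[OF assms(1,2), of d s] assms(3,4)
  by force

lemma zonal_1_pos: "zonal d (\<lambda>t. 1) > 0"
  by (rule zonal_pos[of _ 0]) auto

section \<open>Orthogonality and completeness of the ultraspherical polynomials\<close>

lemma continuous_on_ultra [continuous_intros]:
  "continuous_on S g \<Longrightarrow> continuous_on S (\<lambda>x. ultra d n (g x))"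
  unfolding ultra_def by (intro continuous_intros) auto

text \<open>With z = (1 - cos \<phi>) / 2 the integrand is the derivative of sin^(d+1) \<phi> * w(z)
  / 2, which vanishes at 0 and pi. Choosing w as a Wronskian gives orthogonality, and w = (1 - z)^N
  gives the concentration of the peaks.\<close>

lemma zonal_divergence:
  "zonal d (\<lambda>t. poly ([:0,1,-1:] * pderiv w + smult ((real d + 1) / 2) ([:1,-2:] * w)) ((1 - t) / 2)) = 0"
proof -
  let ?z = "\<lambda>\<phi>. (1 - cos \<phi>) / 2"
  let ?F = "\<lambda>\<phi>. sin \<phi> ^ Suc d * poly w (?z \<phi>) / 2"
  let ?G = "\<lambda>\<phi>. sin \<phi> ^ d * poly ([:0,1,-1:] * pderiv w + smult ((real d + 1) / 2) ([:1,-2:] * w)) (?z \<phi>)"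
  have "(?F has_real_derivative ?G \<phi>) (at \<phi>)" for \<phi>
  proof -
    have s: "sin \<phi> * sin \<phi> = (1 - cos \<phi>) * (1 + cos \<phi>)"
      using sin_squared_eq[of \<phi>] by (simp add: power2_eq_square algebra_simps)
    have "(?F has_real_derivative
        (real (Suc d) * sin \<phi> ^ d * cos \<phi> * poly w (?z \<phi>)
          + sin \<phi> ^ Suc d * (poly (pderiv w) (?z \<phi>) * (sin \<phi> / 2))) / 2) (at \<phi>)"
      by (rule derivative_eq_intros DERIV_power_Suc poly_DERIV[THEN DERIV_chain2] refl | simp)+
    also have "sin \<phi> ^ Suc d * (poly (pderiv w) (?z \<phi>) * (sin \<phi> / 2))
       = sin \<phi> ^ d * (sin \<phi> * sin \<phi>) * poly (pderiv w) (?z \<phi>) / 2" by simp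
    also have "(real (Suc d) * sin \<phi> ^ d * cos \<phi> * poly w (?z \<phi>)
          + sin \<phi> ^ d * (sin \<phi> * sin \<phi>) * poly (pderiv w) (?z \<phi>) / 2) / 2 = ?G \<phi>"
      unfolding s by (simp add: field_simps)
    finally show ?thesis .
  qed
  then have "(?G has_integral (?F pi - ?F 0)) {0..pi}"
    by (intro fundamental_theorem_of_calculus)
      (auto simp: has_real_derivative_iff_has_vector_derivative[symmetric]
            intro: has_field_derivative_at_within)
  then show ?thesis by (simp add: zonal_def integral_unique)
qed

text \<open>Hypergeometric equation in z with eigenvalue - n (n + d); on coefficients it is just the
  ratio of consecutive terms, recorded in \<open>step\<close>.\<close>

lemma upoly_ode:
  "[:0,1,-1:] * pderiv (pderiv (upoly d n)) + smult ((real d + 1) / 2) ([:1,-2:] * pderiv (upoly d n))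
     = smult (- (real n * (real n + real d))) (upoly d n)"
proof (rule poly_eqI)
  fix j
  define q where "q = (real d + 1) / 2"
  have q: "q > 0" by (simp add: q_def)
  have step: "(real i + 1) * (q + real i) * ucoeff d n (Suc i) =
      (real i - real n) * (real n + real d + real i) * ucoeff d n i" for i
  proof -
    have "pochhammer q i > 0" "q + real i > 0" using q by (auto intro: pochhammer_pos add_pos_nonneg)
    then show ?thesis
      unfolding ucoeff_def q_def[symmetric]
      by (simp add: pochhammer_Suc divide_simps)
  qed
  show "coeff ([:0,1,-1:] * pderiv (pderiv (upoly d n)) + smult ((real d + 1) / 2) ([:1,-2:] * pderiv (upoly d n))) j
     = coeff (smult (- (real n * (real n + real d))) (upoly d n)) j"
  proof (cases j)
    case 0
    then show ?thesis
      using step[of 0] by (simp add: coeff_upoly mult_pCons_left coeff_pderiv q_def algebra_simps)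
  next
    case (Suc i)
    then show ?thesis
      using step[of "Suc i"]
      by (cases i) (simp_all add: coeff_upoly mult_pCons_left coeff_pderiv coeff_pCons q_def algebra_simps add_divide_distrib)
  qed
qed

text \<open>Sturm--Liouville argument: the divergence identity for the Wronskian \<open>w\<close>
  leaves the difference of the eigenvalues times the product of the polynomials, and that difference
  is nonzero for distinct indices.\<close>

lemma zonal_ultra_orthogonal:
  assumes "n \<noteq> j"
  shows "zonal d (\<lambda>t. ultra d n t * ultra d j t) = 0"
proof -
  let ?P = "upoly d n" and ?Q = "upoly d j"
  define w where "w = pderiv ?P * ?Q - ?P * pderiv ?Q"
  have sm: "smult c p = [:c:] * p" for c and p :: "real poly" by simp
  have "[:0,1,-1:] * pderiv w + smult ((real d + 1) / 2) ([:1,-2:] * w) =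
     ([:0,1,-1:] * pderiv (pderiv ?P) + smult ((real d + 1) / 2) ([:1,-2:] * pderiv ?P)) * ?Q
     - ?P * ([:0,1,-1:] * pderiv (pderiv ?Q) + smult ((real d + 1) / 2) ([:1,-2:] * pderiv ?Q))"
    by (simp only: w_def pderiv_diff pderiv_mult sm) algebra
  also have "\<dots> = smult (real j * (real j + real d) - real n * (real n + real d)) (?P * ?Q)"
    unfolding upoly_ode by (simp add: smult_diff_left)
  finally have "(real j * (real j + real d) - real n * (real n + real d)) *
      zonal d (\<lambda>t. ultra d n t * ultra d j t) = 0"
    using zonal_divergence[of d w] by (simp add: zonal_cmult ultra_def)
  moreover have "real j * (real j + real d) - real n * (real n + real d) =
      (real j - real n) * (real j + real n + real d)"
    by (simp add: algebra_simps)
  moreover have "real j - real n \<noteq> 0" "real j + real n + real d > 0"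
    using assms by linarith+
  ultimately show ?thesis by simp
qed

lemma zonal_ultra_lower_degree:
  assumes "degree p < n"
  shows "zonal d (\<lambda>t. ultra d n t * poly p t) = 0"
proof -
  obtain b where b: "\<And>t. poly p t = (\<Sum>j\<le>degree p. b j * ultra d j t)"
    using polynomial_in_span_ultra by blast
  have "zonal d (\<lambda>t. ultra d n t * poly p t) =
      zonal d (\<lambda>t. \<Sum>j\<le>degree p. b j * (ultra d n t * ultra d j t))"
    by (simp add: b sum_distrib_left algebra_simps)
  also have "\<dots> = (\<Sum>j\<le>degree p. b j * zonal d (\<lambda>t. ultra d n t * ultra d j t))"
    by (subst zonal_sum) (auto intro!: continuous_intros simp: zonal_cmult)
  also have "\<dots> = 0"
    using assms by (intro sum.neutral) (auto simp: zonal_ultra_orthogonal)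
  finally show ?thesis .
qed

lemma zonal_ultra_sq_pos: "zonal d (\<lambda>t. ultra d n t * ultra d n t) > 0"
  by (rule zonal_pos[of _ 1]) (auto intro!: continuous_intros)

lemma Weierstrass_poly:
  assumes "continuous_on {-1..1::real} f" "e > 0"
  obtains p :: "real poly" where "\<And>t. t \<in> {-1..1} \<Longrightarrow> \<bar>f t - poly p t\<bar> < e"
proof -
  obtain g where g: "real_polynomial_function g" "\<And>t. t \<in> {-1..1} \<Longrightarrow> \<bar>f t - g t\<bar> < e"
    using Stone_Weierstrass_real_polynomial_function[of "{-1..1::real}" f e] assms by auto
  obtain a n where "g = (\<lambda>x. \<Sum>i\<le>n. a i * x ^ i)"
    using g(1) by (auto simp: real_polynomial_function_iff_sum)
  then have "g t = poly (\<Sum>i\<le>n. monom (a i) i) t" for t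
    by (simp add: poly_sum poly_monom)
  then show ?thesis using g(2) that by metis
qed

text \<open>Orthogonality passes to all polynomials, and a uniform e-approximation p of f then
  bounds the integral of f^2, which equals that of f (f - p), by e times the integral of the
  absolute value of f.\<close>

lemma zonal_complete:
  assumes f: "continuous_on {-1..1} f" and o: "\<And>n. zonal d (\<lambda>t. f t * ultra d n t) = 0"
    and t: "t \<in> {-1..1}"
  shows "f t = 0"
proof -
  have ortho: "zonal d (\<lambda>t. f t * poly p t) = 0" for p
  proof -
    obtain b where b: "\<And>t. poly p t = (\<Sum>j\<le>degree p. b j * ultra d j t)"
      using polynomial_in_span_ultra by blast
    have "zonal d (\<lambda>t. f t * poly p t) = zonal d (\<lambda>t. \<Sum>j\<le>degree p. b j * (f t * ultra d j t))"
      by (simp add: b sum_distrib_left algebra_simps)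
    also have "\<dots> = (\<Sum>j\<le>degree p. b j * zonal d (\<lambda>t. f t * ultra d j t))"
      using f by (subst zonal_sum) (auto intro!: continuous_intros simp: zonal_cmult)
    finally show ?thesis by (simp add: o)
  qed
  have cf: "continuous_on {-1..1} (\<lambda>t. f t * f t)" "continuous_on {-1..1} (\<lambda>t. \<bar>f t\<bar>)"
    using f by (auto intro!: continuous_intros)
  have "zonal d (\<lambda>t. f t * f t) \<le> e * zonal d (\<lambda>t. \<bar>f t\<bar>)" if e: "e > 0" for e
  proof -
    obtain p where p: "\<And>t. t \<in> {-1..1} \<Longrightarrow> \<bar>f t - poly p t\<bar> < e"
      using Weierstrass_poly[OF f e] by blast
    have "zonal d (\<lambda>t. f t * f t) = zonal d (\<lambda>t. f t * f t - f t * poly p t)"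
      using f by (subst zonal_diff) (auto intro!: continuous_intros simp: ortho)
    also have "\<dots> \<le> zonal d (\<lambda>t. e * \<bar>f t\<bar>)"
    proof (rule zonal_mono)
      fix t assume "t \<in> {-1..1::real}"
      have "f t * f t - f t * poly p t \<le> \<bar>f t\<bar> * \<bar>f t - poly p t\<bar>"
        by (metis abs_ge_self abs_mult right_diff_distrib)
      also have "\<dots> \<le> \<bar>f t\<bar> * e"
        using p[OF \<open>t \<in> _\<close>] by (intro mult_left_mono) auto
      finally show "f t * f t - f t * poly p t \<le> e * \<bar>f t\<bar>" by (simp add: mult.commute)
    qed (use f in \<open>auto intro!: continuous_intros\<close>)
    finally show ?thesis by (simp add: zonal_cmult)
  qed
  then have "zonal d (\<lambda>t. f t * f t) \<le> e" if "e > 0" for e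
  proof -
    define Z where "Z = zonal d (\<lambda>t. \<bar>f t\<bar>)"
    have Z: "Z \<ge> 0" unfolding Z_def by (rule zonal_nonneg) (use cf in auto)
    have "zonal d (\<lambda>t. f t * f t) \<le> (e / (Z + 1)) * Z"
      unfolding Z_def by (rule \<open>\<And>e. _ \<Longrightarrow> _\<close>) (use that Z in \<open>simp add: Z_def\<close>)
    also have "\<dots> \<le> e" using Z that by (simp add: divide_simps)
    finally show ?thesis .
  qed
  then have "zonal d (\<lambda>t. f t * f t) \<le> 0"
    using field_le_epsilon[of "zonal d (\<lambda>t. f t * f t)" 0] by simp
  moreover have "zonal d (\<lambda>t. f t * f t) \<ge> 0"
    by (rule zonal_nonneg) (use cf in auto)
  ultimately have "f t * f t = 0"
    using zonal_eq_0_imp[of "\<lambda>t. f t * f t" d t] cf t by simp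
  then show ?thesis by simp
qed

text \<open>A polynomial substitute for a point mass at t = 1. It is nonnegative on [-1, 1] and also
  a positive definite kernel, because (1 + t) / 2 is one.\<close>

definition peak :: "nat \<Rightarrow> real \<Rightarrow> real" where
  "peak N t = ((1 + t) / 2) ^ N"

lemma continuous_on_peak [continuous_intros]:
  "continuous_on S g \<Longrightarrow> continuous_on S (\<lambda>x. peak N (g x))"
  unfolding peak_def by (intro continuous_intros) auto

lemma zonal_peak_pos: "zonal d (peak N) > 0"
  by (rule zonal_pos[of _ 1]) (auto intro!: continuous_intros simp: peak_def)

text \<open>This is \<open>zonal_divergence\<close> for w = (1 - z)^N, which is
  \<open>peak N\<close> in the variable z, followed by t \<le> 1. Under the normalised peak the mean
  of 1 - t is thus at most (d + 1) / N.\<close>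

lemma zonal_peak_concentration:
  "real N * zonal d (\<lambda>t. peak N t * (1 - t)) \<le> (real d + 1) * zonal d (peak N)"
proof -
  let ?w = "[:1, -1:] ^ N :: real poly"
  have pd: "poly (pderiv ?w) ((1 - t) / 2) * (1 + t) = - 2 * real N * peak N t" for t
  proof (cases N)
    case (Suc k)
    have "poly (pderiv ?w) ((1 - t) / 2) = - (real N * ((1 + t) / 2) ^ k)"
      unfolding Suc pderiv_power_Suc by (simp add: pderiv_pCons field_simps)
    then show ?thesis by (simp only:) (simp add: peak_def Suc field_simps)
  qed (simp add: pderiv_1)
  have c: "continuous_on {-1..1} (\<lambda>t. (real d + 1) * (peak N t * t))"
    "continuous_on {-1..1} (\<lambda>t. real N * (peak N t * (1 - t)))"
    by (auto intro!: continuous_intros)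
  have "0 = zonal d (\<lambda>t. 2 * poly ([:0,1,-1:] * pderiv ?w + smult ((real d + 1) / 2) ([:1,-2:] * ?w)) ((1 - t) / 2))"
    unfolding zonal_cmult zonal_divergence by simp
  also have "\<dots> = zonal d (\<lambda>t. (real d + 1) * (peak N t * t) - real N * (peak N t * (1 - t)))"
  proof (rule zonal_cong)
    fix t :: real
    have "2 * poly ([:0,1,-1:] * pderiv ?w + smult ((real d + 1) / 2) ([:1,-2:] * ?w)) ((1 - t) / 2)
      = (1 - t) * (poly (pderiv ?w) ((1 - t) / 2) * (1 + t)) / 2 + (real d + 1) * (peak N t * t)"
      by (simp add: peak_def field_simps)
    then show "2 * poly ([:0,1,-1:] * pderiv ?w + smult ((real d + 1) / 2) ([:1,-2:] * ?w)) ((1 - t) / 2)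
      = (real d + 1) * (peak N t * t) - real N * (peak N t * (1 - t))"
      unfolding pd by (simp add: field_simps)
  qed
  finally have "real N * zonal d (\<lambda>t. peak N t * (1 - t)) = zonal d (\<lambda>t. (real d + 1) * (peak N t * t))"
    by (simp add: zonal_diff[OF c] zonal_cmult)
  also have "\<dots> \<le> zonal d (\<lambda>t. (real d + 1) * peak N t)"
    by (rule zonal_mono) (auto intro!: continuous_intros mult_left_mono mult_left_le simp: peak_def)
  finally show ?thesis by (simp add: zonal_cmult)
qed

section \<open>Measures on spheres\<close>

lemma sph_inner_commute: "sph_inner k x y = sph_inner k y x"
  by (simp add: sph_inner_def mult.commute)

lemma sph_inner_self: "x \<in> sphere_pts k \<Longrightarrow> sph_inner k x x = 1"
  by (simp add: sph_inner_def sphere_pts_def power2_eq_square)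

lemma sph_inner_dist:
  assumes "x \<in> sphere_pts k" "y \<in> sphere_pts k"
  shows "(\<Sum>i\<le>k. (x i - y i)^2) = 2 - 2 * sph_inner k x y"
  using sph_inner_self[OF assms(1)] sph_inner_self[OF assms(2)]
  by (simp add: power2_diff power2_eq_square sum.distrib sum_subtractf sph_inner_def sum_distrib_left algebra_simps)

lemma sphere_pts_uminus: "x \<in> sphere_pts k \<Longrightarrow> (\<lambda>i. - x i) \<in> sphere_pts k"
  by (simp add: sphere_pts_def)

lemma sph_inner_uminus: "sph_inner k x (\<lambda>i. - y i) = - sph_inner k x y"
  by (simp add: sph_inner_def sum_negf)

lemma sph_inner_le_1:
  assumes "x \<in> sphere_pts k" "y \<in> sphere_pts k"
  shows "sph_inner k x y \<le> 1"
proof -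
  have "0 \<le> (\<Sum>i\<le>k. (x i - y i)^2)" by (intro sum_nonneg) auto
  then show ?thesis using sph_inner_dist[OF assms] by simp
qed

lemma sph_inner_bounds:
  assumes "x \<in> sphere_pts k" "y \<in> sphere_pts k"
  shows "sph_inner k x y \<in> {-1..1}"
  using sph_inner_le_1[OF assms] sph_inner_le_1[OF assms(1) sphere_pts_uminus[OF assms(2)]]
  by (simp add: sph_inner_uminus)

lemma sph_inner_eq_1_imp:
  assumes "x \<in> sphere_pts k" "y \<in> sphere_pts k" "sph_inner k x y = 1"
  shows "x = y"
proof
  fix i
  have "\<forall>i\<in>{..k}. (x i - y i)^2 = 0"
    using sph_inner_dist[OF assms(1,2)] assms(3)
      sum_nonneg_eq_0_iff[of "{..k}" "\<lambda>i. (x i - y i)^2"] by simp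
  then show "x i = y i"
    using assms(1,2) by (cases "i \<le> k") (auto simp: sphere_pts_def)
qed

section \<open>Polar coordinates and the surface measure\<close>

definition polar :: "nat \<Rightarrow> real \<Rightarrow> (nat \<Rightarrow> real) \<Rightarrow> nat \<Rightarrow> real" where
  "polar k \<phi> w = (\<lambda>i. if i = Suc k then cos \<phi> else sin \<phi> * w i)"

lemma sph_inner_polar:
  "sph_inner (Suc k) (polar k \<phi> w) v = sin \<phi> * sph_inner k w v + cos \<phi> * v (Suc k)"
  by (simp add: sph_inner_def polar_def sum_distrib_left algebra_simps)

lemma polar_in_sphere_pts: "w \<in> sphere_pts k \<Longrightarrow> polar k \<phi> w \<in> sphere_pts (Suc k)"
  by (auto simp: sphere_pts_def polar_def power_mult_distrib sum_distrib_left[symmetric])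

definition polar_weight :: "nat \<Rightarrow> real \<Rightarrow> real" where
  "polar_weight k \<phi> = indicator {0..pi} \<phi> * sin \<phi> ^ k"

text \<open>Unnormalised surface measure: two unit masses on S^0, then the product with sin^k \<phi>
  d\<phi> along the polar angle. Rotation invariance is not apparent in this form;
  \<open>sph_inner_moments\<close> recovers what is needed of it.\<close>

primrec sph_measure :: "nat \<Rightarrow> (nat \<Rightarrow> real) measure" where
  "sph_measure 0 = distr (count_space {-1, 1}) (restrict_space borel (sphere_pts 0))
     (\<lambda>s i. if i = 0 then s else 0)"
| "sph_measure (Suc k) = distr (density lborel (\<lambda>\<phi>. ennreal (polar_weight k \<phi>)) \<Otimes>\<^sub>M sph_measure k)
     (restrict_space borel (sphere_pts (Suc k))) (\<lambda>p. polar k (fst p) (snd p))"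

lemma polar_weight_nonneg [simp]: "0 \<le> polar_weight k \<phi>"
  by (auto simp: polar_weight_def indicator_def sin_ge_zero)

lemma polar_weight_measurable [measurable]: "polar_weight k \<in> borel_measurable borel"
  unfolding polar_weight_def by measurable

lemma space_sph_measure [simp]: "space (sph_measure k) = sphere_pts k"
  by (cases k) (auto simp: space_restrict_space)

lemma sets_sph_measure [measurable_cong]:
  "sets (sph_measure k) = sets (restrict_space borel (sphere_pts k))"
  by (cases k) auto

lemma coord_measurable: "(\<lambda>u. u i) \<in> borel_measurable (sph_measure k)"
  by (subst measurable_cong_sets[OF sets_sph_measure refl])
    (intro measurable_restrict_space1 measurable_product_coordinates)

lemma sph_inner_measurable [measurable]: "(\<lambda>u. sph_inner k u v) \<in> borel_measurable (sph_measure n)"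
  unfolding sph_inner_def using coord_measurable by measurable

lemma sph_inner_measurable' [measurable]: "(\<lambda>u. sph_inner k v u) \<in> borel_measurable (sph_measure n)"
  unfolding sph_inner_def using coord_measurable by measurable

lemma polar_measurable:
  "(\<lambda>p. polar k (fst p) (snd p)) \<in> measurable (density lborel (\<lambda>\<phi>. ennreal (polar_weight k \<phi>)) \<Otimes>\<^sub>M sph_measure k)
     (restrict_space borel (sphere_pts (Suc k)))"
proof (rule measurable_restrict_space2)
  show "(\<lambda>p. polar k (fst p) (snd p)) \<in> borel_measurable (density lborel (\<lambda>\<phi>. ennreal (polar_weight k \<phi>)) \<Otimes>\<^sub>M sph_measure k)"
  proof (rule measurable_coordinatewise_then_product)
    fix i
    show "(\<lambda>p. polar k (fst p) (snd p) i) \<in> borel_measurable (density lborel (\<lambda>\<phi>. ennreal (polar_weight k \<phi>)) \<Otimes>\<^sub>M sph_measure k)"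
    proof -
      have [measurable]: "(\<lambda>p. snd p i) \<in> borel_measurable (density lborel (\<lambda>\<phi>. ennreal (polar_weight k \<phi>)) \<Otimes>\<^sub>M sph_measure k)"
        by (rule measurable_compose[OF measurable_snd coord_measurable])
      show ?thesis unfolding polar_def by measurable
    qed
  qed
qed (auto simp: space_pair_measure intro: polar_in_sphere_pts)

lemma finite_measure_polar_weight:
  "finite_measure (density lborel (\<lambda>\<phi>. ennreal (polar_weight k \<phi>)))"
proof (rule finite_measureI)
  have "emeasure (density lborel (\<lambda>\<phi>. ennreal (polar_weight k \<phi>))) UNIV = (\<integral>\<^sup>+\<phi>. ennreal (polar_weight k \<phi>) \<partial>lborel)"
    by (subst emeasure_density) auto
  also have "\<dots> \<le> (\<integral>\<^sup>+\<phi>. indicator {0..pi} \<phi> \<partial>lborel)"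
    by (intro nn_integral_mono) (auto simp: polar_weight_def indicator_def sin_ge_zero power_le_one)
  also have "\<dots> = ennreal pi" by simp
  finally have "emeasure (density lborel (\<lambda>\<phi>. ennreal (polar_weight k \<phi>))) UNIV \<le> ennreal pi" .
  then show "emeasure (density lborel (\<lambda>\<phi>. ennreal (polar_weight k \<phi>))) (space (density lborel (\<lambda>\<phi>. ennreal (polar_weight k \<phi>)))) \<noteq> \<infinity>"
    by (auto simp: top_unique)
qed

lemma finite_measure_sph_measure: "finite_measure (sph_measure k)"
proof (induction k)
  case 0
  have "finite_measure (count_space {-1, 1::real})"
    by (rule finite_measureI) auto
  moreover have "(\<lambda>s i. if i = 0 then s else 0) \<in> measurable (count_space {-1, 1::real}) (restrict_space borel (sphere_pts 0))"
    by (auto simp: sphere_pts_def space_restrict_space)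
  ultimately show ?case by (simp add: finite_measure.finite_measure_distr)
next
  case (Suc k)
  then have "finite_measure (density lborel (\<lambda>\<phi>. ennreal (polar_weight k \<phi>)) \<Otimes>\<^sub>M sph_measure k)"
    by (intro finite_measure_pair_measure finite_measure_polar_weight)
  then show ?case
    using polar_measurable by (simp add: finite_measure.finite_measure_distr)
qed

interpretation sph: finite_measure "sph_measure k" for k
  by (rule finite_measure_sph_measure)

interpretation sph_pair: pair_sigma_finite "sph_measure k" "sph_measure l" for k l
  by unfold_locales

lemma sph_integrable_bounded:
  fixes h :: "(nat \<Rightarrow> real) \<Rightarrow> real"
  assumes "h \<in> borel_measurable (sph_measure k)" "\<And>u. u \<in> sphere_pts k \<Longrightarrow> \<bar>h u\<bar> \<le> B"
  shows "integrable (sph_measure k) h"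
  using assms by (intro sph.integrable_const_bound[where B = B]) auto

lemma integral_sph_measure_0:
  fixes h :: "(nat \<Rightarrow> real) \<Rightarrow> real"
  assumes "h \<in> borel_measurable (sph_measure 0)"
  shows "(\<integral>u. h u \<partial>sph_measure 0) = h (\<lambda>i. if i = 0 then -1 else 0) + h (\<lambda>i. if i = 0 then 1 else 0)"
proof -
  have m: "(\<lambda>s i. if i = 0 then s else 0) \<in> measurable (count_space {-1, 1::real}) (restrict_space borel (sphere_pts 0))"
    by (auto simp: sphere_pts_def space_restrict_space)
  have "h \<in> borel_measurable (restrict_space borel (sphere_pts 0))"
    using assms by (simp cong: measurable_cong_sets add: sets_sph_measure)
  then show ?thesis
    by (simp add: integral_distr[OF m] lebesgue_integral_count_space_finite)
qed

text \<open>Fubini in polar coordinates. The inner integral is passed in as a continuous function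
  \<open>g\<close>, so that the outer Lebesgue integral becomes a gauge integral of the kind that
  defines \<open>zonal\<close>.\<close>

lemma integral_sph_measure_Suc:
  fixes h :: "(nat \<Rightarrow> real) \<Rightarrow> real"
  assumes m: "h \<in> borel_measurable (sph_measure (Suc k))"
    and b: "\<And>u. u \<in> sphere_pts (Suc k) \<Longrightarrow> \<bar>h u\<bar> \<le> B"
    and g: "continuous_on {0..pi} g" "\<And>\<phi>. (\<integral>w. h (polar k \<phi> w) \<partial>sph_measure k) = g \<phi>"
  shows "(\<integral>u. h u \<partial>sph_measure (Suc k)) = integral {0..pi} (\<lambda>\<phi>. sin \<phi> ^ k * g \<phi>)"
proof -
  let ?N = "density lborel (\<lambda>\<phi>. ennreal (polar_weight k \<phi>))"
  interpret N: finite_measure ?N by (rule finite_measure_polar_weight)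
  interpret P: pair_sigma_finite ?N "sph_measure k" by unfold_locales
  interpret PF: finite_measure "?N \<Otimes>\<^sub>M sph_measure k"
    by (intro finite_measure_pair_measure finite_measure_polar_weight finite_measure_sph_measure)
  have hm: "h \<in> borel_measurable (restrict_space borel (sphere_pts (Suc k)))"
    using m by (subst (asm) measurable_cong_sets[OF sets_sph_measure refl])
  have gm: "g = (\<lambda>\<phi>. \<integral>w. h (polar k \<phi> w) \<partial>sph_measure k)" using g(2) by auto
  have hpm: "(\<lambda>p. h (polar k (fst p) (snd p))) \<in> borel_measurable (?N \<Otimes>\<^sub>M sph_measure k)"
    using measurable_compose[OF polar_measurable hm] .
  have int: "integrable (?N \<Otimes>\<^sub>M sph_measure k) (\<lambda>p. h (polar k (fst p) (snd p)))"
    using hpm by (intro PF.integrable_const_bound[where B = B])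
      (auto simp: space_pair_measure polar_in_sphere_pts b)
  have gm': "g \<in> borel_measurable borel"
  proof -
    have "(\<lambda>\<phi>. \<integral>w. h (polar k \<phi> w) \<partial>sph_measure k) \<in> borel_measurable ?N"
      by (rule sph.borel_measurable_lebesgue_integral) (use hpm in \<open>simp add: case_prod_beta'\<close>)
    then show ?thesis by (simp add: gm)
  qed
  have "(\<integral>u. h u \<partial>sph_measure (Suc k)) = (\<integral>p. h (polar k (fst p) (snd p)) \<partial>(?N \<Otimes>\<^sub>M sph_measure k))"
    by (simp add: integral_distr[OF polar_measurable hm])
  also have "\<dots> = (\<integral>\<phi>. g \<phi> \<partial>?N)"
    using P.integral_fst'[OF int] g(2) by simp
  also have "\<dots> = (\<integral>\<phi>. polar_weight k \<phi> * g \<phi> \<partial>lborel)"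
    using gm' by (subst integral_real_density) auto
  also have "\<dots> = (LINT \<phi>:{0..pi}|lborel. sin \<phi> ^ k * g \<phi>)"
    unfolding set_lebesgue_integral_def polar_weight_def by (simp add: mult.assoc)
  also have "\<dots> = integral {0..pi} (\<lambda>\<phi>. sin \<phi> ^ k * g \<phi>)"
    using g(1) by (intro set_borel_integral_eq_integral borel_integrable_atLeastAtMost'
      continuous_intros)
  finally show ?thesis .
qed

section \<open>Moments of the sphere measures\<close>

text \<open>Integration by parts: the derivative of sin^(p+1) \<phi> cos^(q+1) \<phi> has integral 0
  over [0, pi].\<close>

lemma zonal_power_rec:
  "(real p + 1) * zonal p (\<lambda>t. t ^ Suc (Suc q)) = (real q + 1) * zonal (p + 2) (\<lambda>t. t ^ q)"
proof -
  let ?F = "\<lambda>\<phi>. sin \<phi> ^ Suc p * cos \<phi> ^ Suc q"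
  let ?G = "\<lambda>\<phi>. (real p + 1) * (sin \<phi> ^ p * cos \<phi> ^ Suc (Suc q)) - (real q + 1) * (sin \<phi> ^ (p + 2) * cos \<phi> ^ q)"
  have "(?F has_real_derivative ?G \<phi>) (at \<phi>)" for \<phi>
    by (rule derivative_eq_intros DERIV_power_Suc refl | simp)+ (simp add: algebra_simps)
  then have "(?G has_integral (?F pi - ?F 0)) {0..pi}"
    by (intro fundamental_theorem_of_calculus)
      (auto simp: has_real_derivative_iff_has_vector_derivative[symmetric]
            intro: has_field_derivative_at_within)
  then have "integral {0..pi} ?G = 0" by (simp add: integral_unique)
  moreover have "integral {0..pi} ?G = (real p + 1) * zonal p (\<lambda>t. t ^ Suc (Suc q)) - (real q + 1) * zonal (p + 2) (\<lambda>t. t ^ q)"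
    unfolding zonal_def
    by (subst integral_diff) (auto intro!: integrable_continuous_real continuous_intros simp del: power_Suc)
  ultimately show ?thesis by simp
qed

lemma zonal_power_split:
  "zonal p (\<lambda>t. t ^ q) = zonal (p + 2) (\<lambda>t. t ^ q) + zonal p (\<lambda>t. t ^ Suc (Suc q))"
proof -
  have "sin \<phi> ^ p * cos \<phi> ^ q = sin \<phi> ^ (p + 2) * cos \<phi> ^ q + sin \<phi> ^ p * cos \<phi> ^ Suc (Suc q)" for \<phi> :: real
  proof -
    have "sin \<phi> ^ (p + 2) * cos \<phi> ^ q + sin \<phi> ^ p * cos \<phi> ^ Suc (Suc q)
      = sin \<phi> ^ p * cos \<phi> ^ q * ((sin \<phi>)^2 + (cos \<phi>)^2)"
      by (simp only: power_add power_Suc power2_eq_square ring_distribs mult_ac)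
    then show ?thesis by simp
  qed
  then show ?thesis
    unfolding zonal_def
    by (subst integral_add[symmetric]) (auto intro!: integrable_continuous_real continuous_intros)
qed

lemma zonal_odd_power: "zonal p (\<lambda>t. t ^ Suc (2 * N)) = 0"
proof (induction N arbitrary: p)
  case 0
  let ?F = "\<lambda>\<phi>. sin \<phi> ^ Suc p / (real p + 1)"
  have "(?F has_real_derivative (sin \<phi> ^ p * cos \<phi>)) (at \<phi>)" for \<phi>
    by (rule derivative_eq_intros DERIV_power_Suc refl | simp)+ (simp add: field_simps)
  then have "((\<lambda>\<phi>. sin \<phi> ^ p * cos \<phi>) has_integral (?F pi - ?F 0)) {0..pi}"
    by (intro fundamental_theorem_of_calculus)
      (auto simp: has_real_derivative_iff_has_vector_derivative[symmetric]
            intro: has_field_derivative_at_within)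
  then show ?case by (simp add: zonal_def integral_unique)
next
  case (Suc N)
  show ?case
    using zonal_power_split[of p "Suc (2 * N)"] Suc[of p] Suc[of "p + 2"] by simp
qed

text \<open>The integral of (u . v)^(2 N) over S^k for a unit vector v, computed at the pole, where
  only a zonal integral and the mass of the equator enter. \<open>sph_moment k 0\<close> is the
  total mass.\<close>

primrec sph_moment :: "nat \<Rightarrow> nat \<Rightarrow> real" where
  "sph_moment 0 N = 2"
| "sph_moment (Suc k) N = sph_moment k 0 * zonal k (\<lambda>t. t ^ (2 * N))"

lemma sph_moment_pos: "sph_moment k N > 0"
proof (induction k arbitrary: N)
  case (Suc k)
  have "zonal k (\<lambda>t. t ^ (2 * N)) > 0"
    by (rule zonal_pos[of _ 1]) (auto intro!: continuous_intros simp: power_mult)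
  with Suc show ?case by simp
qed simp

lemma sph_moment_rec:
  "(real k + 1 + 2 * real N) * sph_moment k (Suc N) = (2 * real N + 1) * sph_moment k N"
proof (cases k)
  case (Suc j)
  let ?a = "zonal j (\<lambda>t. t ^ (2 * N))" and ?b = "zonal j (\<lambda>t. t ^ (2 * Suc N))"
  have "(real j + 1) * ?b = (2 * real N + 1) * (?a - ?b)"
    using zonal_power_rec[of j "2 * N"] zonal_power_split[of j "2 * N"] by simp
  then have "(real j + 2 + 2 * real N) * ?b = (2 * real N + 1) * ?a"
    by (simp add: algebra_simps)
  then have "sph_moment j 0 * ((real j + 2 + 2 * real N) * ?b) = sph_moment j 0 * ((2 * real N + 1) * ?a)"
    by simp
  then show ?thesis
    unfolding Suc sph_moment.simps by (simp add: algebra_simps)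
qed simp

text \<open>Expanding a moment in polar coordinates produces terms in V^i b^(2 (N - i)), with V the
  squared norm of the equatorial part of v and b the last coordinate. This identity turns their
  coefficients into binomial ones, so that the sum collapses to a multiple of (V + b^2)^N.\<close>

lemma sph_moment_binomial:
  assumes "i \<le> N"
  shows "real ((2 * N) choose (2 * i)) * sph_moment k i * zonal (k + 2 * i) (\<lambda>t. t ^ (2 * N - 2 * i))
    = real (N choose i) * (sph_moment k 0 * zonal k (\<lambda>t. t ^ (2 * N)))"
  using assms
proof (induction i)
  case (Suc i)
  then have iN: "i < N" by simp
  define M where "M = N - Suc i"
  have N: "N = M + Suc i" using iN by (simp add: M_def)
  have pw: "2 * N - 2 * i = Suc (Suc (2 * M))" "2 * N - 2 * Suc i = 2 * M"
    by (simp_all add: N)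
  have binom_step: "Suc j * (n choose Suc j) = (n - j) * (n choose j)" for j n
    by (simp only: binomial_absorb_comp binomial_absorption)
  let ?Z = "zonal (k + 2 * Suc i) (\<lambda>t. t ^ (2 * M))"
  let ?Y = "zonal (k + 2 * i) (\<lambda>t. t ^ Suc (Suc (2 * M)))"
  have z: "(2 * real M + 1) * ?Z = (real k + 2 * real i + 1) * ?Y"
    using zonal_power_rec[of "k + 2 * i" "2 * M"] by (simp add: algebra_simps)
  have m: "(real k + 1 + 2 * real i) * sph_moment k (Suc i) = (2 * real i + 1) * sph_moment k i"
    by (rule sph_moment_rec)
  have c1: "real (2 * N choose (2 * Suc i)) * (2 * (real i + 1)) * (2 * real i + 1)
      = real (2 * N choose (2 * i)) * (2 * (real M + 1)) * (2 * real M + 1)"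
  proof -
    have a: "(2 * i + 1) * (2 * N choose (2 * i + 1)) = (2 * N - 2 * i) * (2 * N choose (2 * i))"
      using binom_step[of "2 * i" "2 * N"] by simp
    have b: "(2 * i + 2) * (2 * N choose (2 * i + 2)) = (2 * N - (2 * i + 1)) * (2 * N choose (2 * i + 1))"
      using binom_step[of "2 * i + 1" "2 * N"] by simp
    have d: "2 * N - 2 * i = 2 * M + 2" "2 * N - (2 * i + 1) = 2 * M + 1" by (simp_all add: N)
    have a': "(2 * real i + 1) * real (2 * N choose (2 * i + 1)) = (2 * real M + 2) * real (2 * N choose (2 * i))"
      using arg_cong[OF a[unfolded d], of real] by (simp add: algebra_simps)
    have b': "(2 * real i + 2) * real (2 * N choose (2 * i + 2)) = (2 * real M + 1) * real (2 * N choose (2 * i + 1))"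
      using arg_cong[OF b[unfolded d], of real] by (simp add: algebra_simps)
    have "real (2 * N choose (2 * Suc i)) * (2 * (real i + 1)) * (2 * real i + 1)
      = ((2 * real i + 2) * real (2 * N choose (2 * i + 2))) * (2 * real i + 1)" by simp
    also have "\<dots> = (2 * real M + 1) * ((2 * real i + 1) * real (2 * N choose (2 * i + 1)))"
      unfolding b' by simp
    finally show ?thesis unfolding a' by simp
  qed
  have c2: "real (N choose Suc i) * (real i + 1) = real (N choose i) * (real M + 1)"
  proof -
    have "(i + 1) * (N choose Suc i) = (N - i) * (N choose i)"
      using binom_step[of i N] by simp
    moreover have "N - i = M + 1" by (simp add: N)
    ultimately have "real ((i + 1) * (N choose Suc i)) = real ((M + 1) * (N choose i))" by simp
    then show ?thesis by (simp add: algebra_simps)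
  qed
  \<comment> \<open>The product of all denominators occurring in the ratios of consecutive
    binomials, moments and zonal integrals; multiplying by it makes each ratio applicable without
    division.\<close>
  define K where "K = (2 * (real i + 1)) * (2 * real i + 1) * (real k + 1 + 2 * real i) * (2 * real M + 1)"
  have K: "K > 0" unfolding K_def by (intro mult_pos_pos) (auto intro: add_nonneg_pos add_pos_nonneg)
  have "K * (real (2 * N choose (2 * Suc i)) * sph_moment k (Suc i) * ?Z)
    = (real (2 * N choose (2 * Suc i)) * (2 * (real i + 1)) * (2 * real i + 1)) *
      ((real k + 1 + 2 * real i) * sph_moment k (Suc i)) * ((2 * real M + 1) * ?Z)"
    unfolding K_def by (simp only: mult_ac)
  also have "\<dots> = (2 * (real M + 1)) * (2 * real M + 1) * (2 * real i + 1) * (real k + 2 * real i + 1) *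
      (real (2 * N choose (2 * i)) * sph_moment k i * ?Y)"
    unfolding c1 m z by (simp only: mult_ac)
  also have "\<dots> = (2 * (real M + 1)) * (2 * real M + 1) * (2 * real i + 1) * (real k + 2 * real i + 1) *
     (real (N choose i) * (sph_moment k 0 * zonal k (\<lambda>t. t ^ (2 * N))))"
    using Suc.IH iN unfolding pw by simp
  also have "\<dots> = (2 * (2 * real M + 1) * (2 * real i + 1) * (real k + 2 * real i + 1)) *
     ((real (N choose i) * (real M + 1)) * (sph_moment k 0 * zonal k (\<lambda>t. t ^ (2 * N))))"
    by (simp only: mult_ac)
  also have "\<dots> = K * (real (N choose Suc i) * (sph_moment k 0 * zonal k (\<lambda>t. t ^ (2 * N))))"
    unfolding c2[symmetric] K_def by (simp only: mult_ac add_ac)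
  finally show ?case using K unfolding pw by simp
qed simp

lemma sum_even_only:
  fixes f :: "nat \<Rightarrow> real"
  assumes "\<And>i. f (Suc (2 * i)) = 0"
  shows "(\<Sum>j\<le>2 * N. f j) = (\<Sum>i\<le>N. f (2 * i))"
  using assms by (induction N) auto

lemma abs_sph_inner_le:
  assumes "u \<in> sphere_pts k"
  shows "\<bar>sph_inner k u v\<bar> \<le> (\<Sum>i\<le>k. \<bar>v i\<bar>)"
proof -
  have "\<bar>u i\<bar> \<le> 1" if "i \<le> k" for i
  proof -
    have "(u i)^2 \<le> (\<Sum>i\<le>k. (u i)^2)"
      using that by (intro member_le_sum) auto
    then show ?thesis using assms by (simp add: sphere_pts_def abs_square_le_1)
  qed
  then have "\<bar>u i * v i\<bar> \<le> \<bar>v i\<bar>" if "i \<le> k" for i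
    using that by (simp add: abs_mult mult_left_le_one_le)
  then show ?thesis
    unfolding sph_inner_def by (intro order_trans[OF sum_abs] sum_mono) auto
qed

lemma sph_inner_power_integrable: "integrable (sph_measure k) (\<lambda>u. sph_inner k u v ^ n)"
  by (rule sph_integrable_bounded[where B = "(\<Sum>i\<le>k. \<bar>v i\<bar>) ^ n"])
    (auto simp: power_abs intro!: power_mono abs_sph_inner_le)

text \<open>Binomial expansion of (sin \<phi> (w . v) + cos \<phi> v_(k+1))^n; the factor sin^j
  \<phi> raises the index of the zonal integral from k to k + j.\<close>

lemma sph_inner_power_Suc:
  "(\<integral>u. sph_inner (Suc k) u v ^ n \<partial>sph_measure (Suc k)) =
   (\<Sum>j\<le>n. real (n choose j) * (\<integral>w. sph_inner k w v ^ j \<partial>sph_measure k) * v (Suc k) ^ (n - j)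
       * zonal (k + j) (\<lambda>t. t ^ (n - j)))"
proof -
  define I where "I j = (\<integral>w. sph_inner k w v ^ j \<partial>sph_measure k)" for j
  define b where "b = v (Suc k)"
  have "(\<integral>w. sph_inner (Suc k) (polar k \<phi> w) v ^ n \<partial>sph_measure k) =
      (\<Sum>j\<le>n. real (n choose j) * sin \<phi> ^ j * (cos \<phi> * b) ^ (n - j) * I j)" for \<phi>
  proof -
    have "(\<integral>w. sph_inner (Suc k) (polar k \<phi> w) v ^ n \<partial>sph_measure k) =
      (\<integral>w. (\<Sum>j\<le>n. (real (n choose j) * sin \<phi> ^ j * (cos \<phi> * b) ^ (n - j)) * sph_inner k w v ^ j) \<partial>sph_measure k)"
      by (simp add: sph_inner_polar binomial_ring b_def power_mult_distrib mult_ac)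
    then show ?thesis
      using sph_inner_power_integrable by (simp add: Bochner_Integration.integral_sum I_def)
  qed
  then have "(\<integral>u. sph_inner (Suc k) u v ^ n \<partial>sph_measure (Suc k)) =
     integral {0..pi} (\<lambda>\<phi>. sin \<phi> ^ k * (\<Sum>j\<le>n. real (n choose j) * sin \<phi> ^ j * (cos \<phi> * b) ^ (n - j) * I j))"
    by (intro integral_sph_measure_Suc[where B = "(\<Sum>i\<le>Suc k. \<bar>v i\<bar>) ^ n"])
      (auto simp: power_abs simp del: sum.atMost_Suc intro!: power_mono abs_sph_inner_le continuous_intros)
  also have "\<dots> = integral {0..pi} (\<lambda>\<phi>. \<Sum>j\<le>n. (real (n choose j) * I j * b ^ (n - j)) * (sin \<phi> ^ (k + j) * cos \<phi> ^ (n - j)))"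
    by (simp add: sum_distrib_left power_add power_mult_distrib mult_ac)
  also have "\<dots> = (\<Sum>j\<le>n. (real (n choose j) * I j * b ^ (n - j)) * zonal (k + j) (\<lambda>t. t ^ (n - j)))"
    unfolding zonal_def
    by (subst integral_sum) (auto intro!: integrable_continuous_real continuous_intros)
  finally show ?thesis by (simp add: I_def b_def)
qed

text \<open>Dependence on the norm of v alone is the form in which rotation invariance is available.
  Induction on k: in odd total order each binomial term carries an odd moment of the equator or an
  odd power of the cosine, and in even order \<open>sph_moment_binomial\<close> reassembles the
  norm.\<close>

theorem sph_inner_moments:
  "(\<integral>u. sph_inner k u v ^ (2 * N) \<partial>sph_measure k) = sph_moment k N * (\<Sum>i\<le>k. (v i)^2) ^ N"
  "(\<integral>u. sph_inner k u v ^ Suc (2 * N) \<partial>sph_measure k) = 0"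
proof -
  have "(\<forall>N. (\<integral>u. sph_inner k u v ^ (2 * N) \<partial>sph_measure k) = sph_moment k N * (\<Sum>i\<le>k. (v i)^2) ^ N) \<and>
    (\<forall>N. (\<integral>u. sph_inner k u v ^ Suc (2 * N) \<partial>sph_measure k) = 0)"
  proof (induction k)
    case 0
    have "(\<integral>u. sph_inner 0 u v ^ n \<partial>sph_measure 0) = (- v 0) ^ n + v 0 ^ n" for n
      by (subst integral_sph_measure_0, measurable) (simp add: sph_inner_def)
    then show ?case by (simp only:) (simp add: power_mult)
  next
    case (Suc k)
    define V where "V = (\<Sum>i\<le>k. (v i)^2)"
    define b where "b = v (Suc k)"
    have IH: "(\<integral>u. sph_inner k u v ^ (2 * N) \<partial>sph_measure k) = sph_moment k N * V ^ N"
      "(\<integral>u. sph_inner k u v ^ Suc (2 * N) \<partial>sph_measure k) = 0" for N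
      using Suc by (auto simp: V_def)
    have even: "(\<integral>u. sph_inner (Suc k) u v ^ (2 * N) \<partial>sph_measure (Suc k)) =
      sph_moment (Suc k) N * (\<Sum>i\<le>Suc k. (v i)^2) ^ N" for N
    proof -
      have "(\<integral>u. sph_inner (Suc k) u v ^ (2 * N) \<partial>sph_measure (Suc k)) =
        (\<Sum>i\<le>N. real (2 * N choose (2 * i)) * (sph_moment k i * V ^ i) * b ^ (2 * N - 2 * i)
           * zonal (k + 2 * i) (\<lambda>t. t ^ (2 * N - 2 * i)))"
        unfolding sph_inner_power_Suc
        by (subst sum_even_only) (simp_all only: IH b_def mult_zero_right mult_zero_left)
      also have "\<dots> = (\<Sum>i\<le>N. (real (N choose i) * V ^ i * (b^2) ^ (N - i)) * (sph_moment k 0 * zonal k (\<lambda>t. t ^ (2 * N))))"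
      proof (rule sum.cong)
        fix i assume "i \<in> {..N}"
        then have i: "i \<le> N" by simp
        have p: "b ^ (2 * N - 2 * i) = (b^2) ^ (N - i)"
          by (simp add: power_mult[symmetric] diff_mult_distrib2)
        have "real (2 * N choose (2 * i)) * (sph_moment k i * V ^ i) * b ^ (2 * N - 2 * i)
           * zonal (k + 2 * i) (\<lambda>t. t ^ (2 * N - 2 * i)) =
           (real (2 * N choose (2 * i)) * sph_moment k i * zonal (k + 2 * i) (\<lambda>t. t ^ (2 * N - 2 * i))) * V ^ i * (b^2) ^ (N - i)"
          unfolding p by (simp only: mult_ac)
        then show "real (2 * N choose (2 * i)) * (sph_moment k i * V ^ i) * b ^ (2 * N - 2 * i)
           * zonal (k + 2 * i) (\<lambda>t. t ^ (2 * N - 2 * i)) =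
           (real (N choose i) * V ^ i * (b^2) ^ (N - i)) * (sph_moment k 0 * zonal k (\<lambda>t. t ^ (2 * N)))"
          unfolding sph_moment_binomial[OF i] by (simp only: mult_ac)
      qed simp
      also have "\<dots> = (V + b^2) ^ N * (sph_moment k 0 * zonal k (\<lambda>t. t ^ (2 * N)))"
        by (simp add: binomial_ring sum_distrib_right)
      finally show ?thesis by (simp add: V_def b_def mult.commute)
    qed
    have odd: "(\<integral>u. sph_inner (Suc k) u v ^ Suc (2 * N) \<partial>sph_measure (Suc k)) = 0" for N
      unfolding sph_inner_power_Suc
    proof (rule sum.neutral, rule ballI)
      fix j assume j: "j \<in> {..Suc (2 * N)}"
      show "real (Suc (2 * N) choose j) * (\<integral>w. sph_inner k w v ^ j \<partial>sph_measure k) * v (Suc k) ^ (Suc (2 * N) - j)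
         * zonal (k + j) (\<lambda>t. t ^ (Suc (2 * N) - j)) = 0"
      proof (cases "even j")
        case True
        then obtain i where i: "j = 2 * i" by (elim evenE)
        have "Suc (2 * N) - j = Suc (2 * (N - i))" using j i by auto
        then show ?thesis by (simp only: zonal_odd_power mult_zero_right)
      next
        case False
        then obtain i where "j = Suc (2 * i)" by (auto elim: oddE)
        then show ?thesis by (simp only: IH mult_zero_right mult_zero_left)
      qed
    qed
    show ?case using even odd by blast
  qed
  then show "(\<integral>u. sph_inner k u v ^ (2 * N) \<partial>sph_measure k) = sph_moment k N * (\<Sum>i\<le>k. (v i)^2) ^ N"
    "(\<integral>u. sph_inner k u v ^ Suc (2 * N) \<partial>sph_measure k) = 0" by blast+
qed

section \<open>The Funk--Hecke formula for ultraspherical polynomials\<close>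

text \<open>Every factor t in (1 + 2 t s + s^2)^N comes with a factor s, which bounds the degree in
  t by b.\<close>

lemma coeff_quadratic_power:
  "\<exists>q :: real poly. degree q \<le> b \<and> (\<forall>t. coeff ([:1, 2 * t, 1:] ^ N) b = poly q t)"
proof (induction N arbitrary: b rule: nat.induct)
  case zero
  show ?case
    by (cases b) (auto intro!: exI[of _ "if b = 0 then 1 else 0"])
next
  case (Suc N)
  have c: "coeff ([:1, 2 * t, 1:] ^ Suc N) b = coeff ([:1, 2 * t, 1:] ^ N) b
      + (if b \<ge> 1 then 2 * t * coeff ([:1, 2 * t, 1:] ^ N) (b - 1) else 0)
      + (if b \<ge> 2 then coeff ([:1, 2 * t, 1:] ^ N) (b - 2) else 0)" for t :: real
    by (cases b; cases "b - 1") (auto simp: mult_pCons_left coeff_pCons)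
  obtain q where q: "\<And>b. degree (q b) \<le> b" "\<And>b t. coeff ([:1, 2 * t, 1:] ^ N) b = poly (q b :: real poly) t"
    using Suc.IH by metis
  define r where "r = q b + (if b \<ge> 1 then [:0, 2:] * q (b - 1) else 0) + (if b \<ge> 2 then q (b - 2) else 0)"
  have "degree ([:0, 2:] * q (b - 1)) \<le> b" if "b \<ge> 1"
    using degree_mult_le[of "[:0, 2:]" "q (b - 1)"] q(1)[of "b - 1"] that by simp
  then have "degree r \<le> b"
    unfolding r_def using q(1)[of b] q(1)[of "b - 2"]
    by (auto intro!: degree_add_le)
  moreover have "coeff ([:1, 2 * t, 1:] ^ Suc N) b = poly r t" for t
    unfolding c r_def q(2) by simp
  ultimately show ?case by blast
qed

lemma abs_sph_inner_le_1:
  "x \<in> sphere_pts k \<Longrightarrow> y \<in> sphere_pts k \<Longrightarrow> \<bar>sph_inner k x y\<bar> \<le> 1"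
  using sph_inner_bounds[of x k y] by auto

lemma sph_inner_products_integrable:
  assumes "x \<in> sphere_pts k" "y \<in> sphere_pts k"
  shows "integrable (sph_measure k) (\<lambda>u. sph_inner k u x ^ a * sph_inner k u y ^ b)"
  using assms
  by (intro sph_integrable_bounded[where B = 1])
    (auto simp: abs_mult power_abs intro!: mult_le_one power_le_one abs_sph_inner_le_1)

text \<open>Compare the coefficients of \<open>s ^ b\<close> in the moment of order \<open>a + b\<close> at \<open>x + s y\<close>.\<close>
lemma sph_inner_polarization:
  "\<exists>q. degree q \<le> b \<and> (\<forall>x\<in>sphere_pts k. \<forall>y\<in>sphere_pts k.
     (\<integral>u. sph_inner k u x ^ a * sph_inner k u y ^ b \<partial>sph_measure k) = poly q (sph_inner k x y))"
proof -
  define n where "n = a + b"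
  obtain N where N: "n = 2 * N \<or> n = Suc (2 * N)" by (metis oddE evenE Suc_eq_plus1)
  obtain r :: "real poly" where r: "degree r \<le> b" "\<And>t. coeff ([:1, 2 * t, 1:] ^ N) b = poly r t"
    using coeff_quadratic_power by blast
  define q where "q = (if n = 2 * N then smult (sph_moment k N / real (n choose b)) r else 0)"
  have "(\<integral>u. sph_inner k u x ^ a * sph_inner k u y ^ b \<partial>sph_measure k) = poly q (sph_inner k x y)"
    if x: "x \<in> sphere_pts k" and y: "y \<in> sphere_pts k" for x y
  proof -
    define t where "t = sph_inner k x y"
    define J where "J j = (\<integral>u. sph_inner k u x ^ (n - j) * sph_inner k u y ^ j \<partial>sph_measure k)" for j
    define P where "P = (\<Sum>j\<le>n. monom (real (n choose j) * J j) j)"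
    define Q where "Q = (if n = 2 * N then smult (sph_moment k N) ([:1, 2 * t, 1:] ^ N) else 0)"
    have lin: "sph_inner k u (\<lambda>i. x i + s * y i) = s * sph_inner k u y + sph_inner k u x" for u s
      by (simp add: sph_inner_def sum.distrib sum_distrib_left algebra_simps)
    have norm: "(\<Sum>i\<le>k. (x i + s * y i)^2) = 1 + 2 * t * s + s^2" for s
    proof -
      have "(\<Sum>i\<le>k. (x i + s * y i)^2) = (\<Sum>i\<le>k. (x i)^2) + 2 * s * sph_inner k x y + s^2 * (\<Sum>i\<le>k. (y i)^2)"
        by (simp add: sph_inner_def sum.distrib sum_distrib_left power2_eq_square algebra_simps)
      then show ?thesis using x y by (simp add: sphere_pts_def t_def)
    qed
    have "poly P s = poly Q s" for s
    proof -
      have "poly P s = (\<integral>u. (\<Sum>j\<le>n. real (n choose j) * s ^ j * (sph_inner k u x ^ (n - j) * sph_inner k u y ^ j)) \<partial>sph_measure k)"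
      proof -
        have "(\<integral>u. (\<Sum>j\<le>n. real (n choose j) * s ^ j * (sph_inner k u x ^ (n - j) * sph_inner k u y ^ j)) \<partial>sph_measure k)
          = (\<Sum>j\<le>n. real (n choose j) * s ^ j * J j)"
          using sph_inner_products_integrable[OF x y]
          by (simp add: J_def Bochner_Integration.integral_sum)
        then show ?thesis by (simp add: P_def poly_sum poly_monom mult_ac)
      qed
      also have "\<dots> = (\<integral>u. sph_inner k u (\<lambda>i. x i + s * y i) ^ n \<partial>sph_measure k)"
        unfolding lin by (simp add: binomial_ring power_mult_distrib mult_ac)
      also have "\<dots> = poly Q s"
      proof (cases "n = 2 * N")
        case True
        then show ?thesis
          unfolding Q_def by (simp only: sph_inner_moments norm)
            (simp add: poly_power power2_eq_square algebra_simps)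
      next
        case False
        then have "n = Suc (2 * N)" using N by blast
        then show ?thesis
          unfolding Q_def by (simp only: sph_inner_moments) simp
      qed
      finally show ?thesis .
    qed
    then have "coeff P b = coeff Q b" by (metis poly_ext)
    moreover have "coeff P b = real (n choose b) * J b"
    proof -
      have "coeff P b = (\<Sum>j\<le>n. if j = b then real (n choose j) * J j else 0)"
        by (simp add: P_def coeff_sum)
      then show ?thesis by (simp add: n_def)
    qed
    moreover have "real (n choose b) > 0" by (simp add: n_def)
    ultimately have "J b = coeff Q b / real (n choose b)" by (simp add: field_simps)
    moreover have "coeff Q b / real (n choose b) = poly q t"
      by (simp add: Q_def q_def r(2))
    moreover have "n - b = a" by (simp add: n_def)
    ultimately show ?thesis by (simp add: J_def t_def)
  qed
  moreover have "degree q \<le> b"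
    using r(1) by (auto simp: q_def)
  ultimately show ?thesis by blast
qed

section \<open>Integrals of zonal functions and of their products\<close>

lemma sph_north: "(\<lambda>i. if i = k then 1 else 0) \<in> sphere_pts k"
proof -
  have "(\<Sum>i\<le>k. (if i = k then 1 else 0 :: real)^2) = (\<Sum>i\<le>k. if i = k then 1 else 0)"
    by (intro sum.cong) auto
  then show ?thesis by (simp add: sphere_pts_def)
qed

lemma sph_integral_power:
  assumes "x \<in> sphere_pts (Suc d)"
  shows "(\<integral>u. sph_inner (Suc d) u x ^ n \<partial>sph_measure (Suc d)) = sph_moment d 0 * zonal d (\<lambda>t. t ^ n)"
proof -
  obtain N where N: "n = 2 * N \<or> n = Suc (2 * N)" by (metis oddE evenE Suc_eq_plus1)
  have s: "(\<Sum>i\<le>Suc d. (x i)^2) = 1" using assms by (simp add: sphere_pts_def)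
  from N show ?thesis
  proof
    assume n: "n = 2 * N"
    show ?thesis unfolding n sph_inner_moments(1) s by simp
  next
    assume n: "n = Suc (2 * N)"
    show ?thesis unfolding n sph_inner_moments(2) zonal_odd_power by simp
  qed
qed

lemma sph_integral_poly:
  assumes "x \<in> sphere_pts (Suc d)"
  shows "(\<integral>u. poly p (sph_inner (Suc d) u x) \<partial>sph_measure (Suc d)) = sph_moment d 0 * zonal d (poly p)"
proof -
  have i: "integrable (sph_measure (Suc d)) (\<lambda>u. sph_inner (Suc d) u x ^ n)" for n
    by (rule sph_inner_power_integrable)
  have "(\<integral>u. poly p (sph_inner (Suc d) u x) \<partial>sph_measure (Suc d)) =
      (\<Sum>j\<le>degree p. coeff p j * (sph_moment d 0 * zonal d (\<lambda>t. t ^ j)))"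
    unfolding poly_altdef
    by (subst Bochner_Integration.integral_sum)
      (auto simp: sph_integral_power[OF assms] simp del: sph_measure.simps intro!: integrable_mult_right i)
  also have "\<dots> = sph_moment d 0 * (\<Sum>j\<le>degree p. zonal d (\<lambda>t. coeff p j * t ^ j))"
    by (simp add: zonal_cmult sum_distrib_left mult_ac)
  also have "(\<Sum>j\<le>degree p. zonal d (\<lambda>t. coeff p j * t ^ j)) = zonal d (poly p)"
    by (subst zonal_sum[symmetric])
      (auto intro!: continuous_intros arg_cong[where f = "zonal d"] simp: poly_altdef fun_eq_iff)
  finally show ?thesis .
qed

lemma sph_zonal_measurable:
  fixes h :: "real \<Rightarrow> real"
  assumes h: "continuous_on {-1..1} h" and x: "x \<in> sphere_pts k"
  shows "(\<lambda>u. h (sph_inner k u x)) \<in> borel_measurable (sph_measure k)"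
proof -
  \<comment> \<open>Continuity is known on [-1, 1] only; clamping the argument gives a Borel
    function on the whole line that agrees with \<open>h\<close> at all inner products of unit
    vectors.\<close>
  let ?h = "\<lambda>t. h (max (-1) (min 1 t))"
  have "continuous_on UNIV ?h"
    by (rule continuous_on_compose2[OF h]) (auto intro!: continuous_intros)
  then have [measurable]: "?h \<in> borel_measurable borel"
    by (rule borel_measurable_continuous_onI)
  have "(\<lambda>u. ?h (sph_inner k u x)) \<in> borel_measurable (sph_measure k)"
    by measurable
  moreover have "?h (sph_inner k u x) = h (sph_inner k u x)" if "u \<in> space (sph_measure k)" for u
  proof -
    have "max (-1) (min 1 (sph_inner k u x)) = sph_inner k u x"
      using sph_inner_bounds[of u k x] that x by auto
    then show ?thesis by simp
  qed
  ultimately show ?thesis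
    using measurable_cong[of "sph_measure k" "\<lambda>u. ?h (sph_inner k u x)" "\<lambda>u. h (sph_inner k u x)" borel]
    by blast
qed

lemma continuous_on_Icc_bounded:
  fixes h :: "real \<Rightarrow> real"
  assumes "continuous_on {-1..1} h"
  obtains B where "\<And>t. t \<in> {-1..1} \<Longrightarrow> \<bar>h t\<bar> \<le> B"
proof -
  have "bounded (h ` {-1..1})"
    using assms by (intro compact_imp_bounded compact_continuous_image) auto
  then obtain B where "\<forall>t\<in>{-1..1}. \<bar>h t\<bar> \<le> B" by (auto simp: bounded_iff)
  then show ?thesis using that[of B] by blast
qed

lemma sph_zonal_integrable:
  fixes h :: "real \<Rightarrow> real"
  assumes h: "continuous_on {-1..1} h" and x: "x \<in> sphere_pts k"
  shows "integrable (sph_measure k) (\<lambda>u. h (sph_inner k u x))"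
proof -
  obtain B where B: "\<And>t. t \<in> {-1..1} \<Longrightarrow> \<bar>h t\<bar> \<le> B"
    using continuous_on_Icc_bounded[OF h] by blast
  show ?thesis
    using B[OF sph_inner_bounds[OF _ x]]
    by (intro sph_integrable_bounded[where B = B] sph_zonal_measurable h x) auto
qed

lemma sph_mass: "measure (sph_measure (Suc d)) (sphere_pts (Suc d)) = sph_moment (Suc d) 0"
  using sph_integral_power[OF sph_north, of d 0] by (simp del: sph_measure.simps)

text \<open>For polynomials this follows from the moments. Both sides change by at most the total
  mass times e under a uniform perturbation of size e, so Weierstrass approximation extends it to
  continuous functions.\<close>

theorem sph_integral_zonal:
  assumes h: "continuous_on {-1..1} h" and x: "x \<in> sphere_pts (Suc d)"
  shows "(\<integral>u. h (sph_inner (Suc d) u x) \<partial>sph_measure (Suc d)) = sph_moment d 0 * zonal d h"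
proof -
  let ?M = "sph_moment (Suc d) 0" and ?I = "\<lambda>h. \<integral>u. h (sph_inner (Suc d) u x) \<partial>sph_measure (Suc d)"
  have M: "?M = sph_moment d 0 * zonal d (\<lambda>t. 1)" "?M > 0" "sph_moment d 0 > 0"
    using sph_moment_pos[of "Suc d" 0] sph_moment_pos[of d 0] by simp_all
  have approx: "\<bar>?I h - sph_moment d 0 * zonal d h\<bar> \<le> 2 * ?M * e" if "e > 0" for e
  proof -
    obtain p where p: "\<And>t. t \<in> {-1..1} \<Longrightarrow> \<bar>h t - poly p t\<bar> < e"
      using Weierstrass_poly[OF h \<open>e > 0\<close>] by blast
    have cp: "continuous_on {-1..1} (poly p)" by (intro continuous_intros)
    have p': "\<bar>h (sph_inner (Suc d) u x) - poly p (sph_inner (Suc d) u x)\<bar> \<le> e"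
      if "u \<in> sphere_pts (Suc d)" for u
      by (rule less_imp_le[OF p[OF sph_inner_bounds[OF that x]]])
    have "\<bar>?I h - ?I (poly p)\<bar> \<le> ?M * e"
    proof -
      have "?I h - ?I (poly p) = (\<integral>u. h (sph_inner (Suc d) u x) - poly p (sph_inner (Suc d) u x) \<partial>sph_measure (Suc d))"
        by (intro Bochner_Integration.integral_diff[symmetric] sph_zonal_integrable x h cp)
      also have "\<bar>\<dots>\<bar> \<le> (\<integral>u. \<bar>h (sph_inner (Suc d) u x) - poly p (sph_inner (Suc d) u x)\<bar> \<partial>sph_measure (Suc d))"
        by (rule integral_abs_bound)
      also have "\<dots> \<le> (\<integral>u. e \<partial>sph_measure (Suc d))"
        using p' x
        by (intro integral_mono integrable_abs Bochner_Integration.integrable_diff sph_zonal_integrable h cp)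
          (auto simp del: sph_measure.simps)
      also have "\<dots> = ?M * e"
        by (simp del: sph_measure.simps sph_moment.simps add: sph_mass)
      finally show ?thesis .
    qed
    moreover have "\<bar>zonal d h - zonal d (poly p)\<bar> \<le> zonal d (\<lambda>t. e)"
    proof -
      have "zonal d h - zonal d (poly p) = zonal d (\<lambda>t. h t - poly p t)"
        by (rule zonal_diff[OF h cp, symmetric])
      moreover have "zonal d (\<lambda>t. h t - poly p t) \<le> zonal d (\<lambda>t. e)"
        using p h cp by (intro zonal_mono) (auto intro!: continuous_intros simp: abs_less_iff less_imp_le)
      moreover have "zonal d (\<lambda>t. -1 * e) \<le> zonal d (\<lambda>t. h t - poly p t)"
        using p h cp by (intro zonal_mono) (fastforce intro!: continuous_intros simp: abs_less_iff)+
      ultimately show ?thesis unfolding zonal_cmult by simp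
    qed
    then have "sph_moment d 0 * \<bar>zonal d h - zonal d (poly p)\<bar> \<le> sph_moment d 0 * zonal d (\<lambda>t. e)"
      using M(3) by simp
    then have "\<bar>sph_moment d 0 * zonal d h - sph_moment d 0 * zonal d (poly p)\<bar> \<le> ?M * e"
    proof -
      have "\<bar>sph_moment d 0 * zonal d h - sph_moment d 0 * zonal d (poly p)\<bar>
          = sph_moment d 0 * \<bar>zonal d h - zonal d (poly p)\<bar>"
        by (metis abs_mult abs_of_pos right_diff_distrib M(3))
      moreover have "sph_moment d 0 * zonal d (\<lambda>t. e) = ?M * e"
        using zonal_cmult[of d e "\<lambda>_. 1"] M(1) by simp
      ultimately show ?thesis
        using \<open>sph_moment d 0 * \<bar>_\<bar> \<le> _\<close> by linarith
    qed
    ultimately show ?thesis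
      using sph_integral_poly[OF x, of p] by (simp del: sph_measure.simps sph_moment.simps)
  qed
  have "\<bar>?I h - sph_moment d 0 * zonal d h\<bar> \<le> 0"
  proof (rule field_le_epsilon)
    fix e :: real assume "e > 0"
    then show "\<bar>?I h - sph_moment d 0 * zonal d h\<bar> \<le> 0 + e"
      using approx[of "e / (2 * ?M)"] M zonal_1_pos[of d]
      by (simp del: sph_measure.simps sph_moment.simps)
  qed
  then show ?thesis by simp
qed

text \<open>The asymmetric degree bound is the point: averaging against a factor of low degree in u
  . y gives low degree in x . y, however large the degree of \<open>f\<close>. The orthogonality
  argument for Funk--Hecke rests on it.\<close>

lemma sph_integral_poly_product:
  "\<exists>q. degree q \<le> degree g \<and> (\<forall>x\<in>sphere_pts k. \<forall>y\<in>sphere_pts k.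
     (\<integral>u. poly f (sph_inner k u x) * poly g (sph_inner k u y) \<partial>sph_measure k) = poly q (sph_inner k x y))"
proof -
  define P where "P a b q \<longleftrightarrow> degree q \<le> b \<and> (\<forall>x\<in>sphere_pts k. \<forall>y\<in>sphere_pts k.
     (\<integral>u. sph_inner k u x ^ a * sph_inner k u y ^ b \<partial>sph_measure k) = poly q (sph_inner k x y))" for a b q
  define q where "q a b = (SOME q. P a b q)" for a b
  have "P a b (q a b)" for a b
    unfolding q_def P_def by (rule someI_ex) (rule sph_inner_polarization)
  then have q: "\<And>a b. degree (q a b) \<le> b"
    "\<And>a b x y. x \<in> sphere_pts k \<Longrightarrow> y \<in> sphere_pts k \<Longrightarrow>
      (\<integral>u. sph_inner k u x ^ a * sph_inner k u y ^ b \<partial>sph_measure k) = poly (q a b) (sph_inner k x y)"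
    unfolding P_def by blast+
  define r where "r = (\<Sum>a\<le>degree f. \<Sum>b\<le>degree g. smult (coeff f a * coeff g b) (q a b))"
  have "(\<integral>u. poly f (sph_inner k u x) * poly g (sph_inner k u y) \<partial>sph_measure k) = poly r (sph_inner k x y)"
    if xy: "x \<in> sphere_pts k" "y \<in> sphere_pts k" for x y
  proof -
    have "poly f (sph_inner k u x) * poly g (sph_inner k u y) =
      (\<Sum>a\<le>degree f. \<Sum>b\<le>degree g. (coeff f a * coeff g b) * (sph_inner k u x ^ a * sph_inner k u y ^ b))" for u
      by (simp add: poly_altdef sum_product mult_ac)
    then have "(\<integral>u. poly f (sph_inner k u x) * poly g (sph_inner k u y) \<partial>sph_measure k) =
      (\<Sum>a\<le>degree f. \<Sum>b\<le>degree g. (coeff f a * coeff g b) * poly (q a b) (sph_inner k x y))"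
      using sph_inner_products_integrable[OF xy] q(2)[OF xy]
      by (simp add: Bochner_Integration.integral_sum)
    then show ?thesis by (simp add: r_def poly_sum)
  qed
  moreover have "degree r \<le> degree g"
    unfolding r_def using q(1)
    by (intro degree_sum_le) (auto intro!: order_trans[OF degree_smult_le] intro: order_trans)
  ultimately show ?thesis by blast
qed

text \<open>The integral is a polynomial of degree at most \<open>n\<close> in \<open>x \<bullet> y\<close>; by Fubini and the orthogonality of
  \<open>ultra d n\<close> to lower degrees, it is itself orthogonal to all lower degrees.\<close>
theorem Funk_Hecke_ultra:
  obtains \<kappa> where "\<kappa> > 0" "\<And>x y. x \<in> sphere_pts (Suc d) \<Longrightarrow> y \<in> sphere_pts (Suc d) \<Longrightarrow>
    (\<integral>u. ultra d n (sph_inner (Suc d) u x) * ultra d n (sph_inner (Suc d) u y) \<partial>sph_measure (Suc d))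
      = \<kappa> * ultra d n (sph_inner (Suc d) x y)"
proof -
  let ?S = "sphere_pts (Suc d)" and ?\<sigma> = "sph_measure (Suc d)"
  let ?ip = "sph_inner (Suc d)"
  note [simp del] = sph_measure.simps
  obtain U where U: "degree U = n" "ultra d n = poly U"
    using ultra_is_polynomial by blast
  obtain B where B: "degree B \<le> n" "\<And>x y. x \<in> ?S \<Longrightarrow> y \<in> ?S \<Longrightarrow>
      (\<integral>u. poly U (?ip u x) * poly U (?ip u y) \<partial>?\<sigma>) = poly B (?ip x y)"
    using sph_integral_poly_product[of U "Suc d" U] U(1) by auto
  have poly_mult_fun: "poly (f * g) = (\<lambda>t. poly f t * poly g t)" for f g :: "real poly"
    by (simp add: fun_eq_iff)
  have bound: "\<exists>C\<ge>0. \<forall>u\<in>?S. \<forall>x\<in>?S. \<bar>poly p (?ip u x)\<bar> \<le> C" for p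
  proof -
    obtain C where C: "\<And>t. t \<in> {-1..1} \<Longrightarrow> \<bar>poly p t\<bar> \<le> C"
      by (rule continuous_on_Icc_bounded[of "poly p"]) (auto intro: continuous_intros)
    then have "\<forall>u\<in>?S. \<forall>x\<in>?S. \<bar>poly p (?ip u x)\<bar> \<le> C"
      by (auto simp: sph_inner_bounds simp del: atLeastAtMost_iff)
    moreover have "C \<ge> 0" using C[of 0] by auto
    ultimately show ?thesis by blast
  qed
  obtain x0 where x0: "x0 \<in> ?S" using sph_north by blast
  have ortho: "zonal d (\<lambda>t. poly B t * poly p t) = 0" if dp: "degree p < n" for p
  proof -
    obtain q where q: "degree q \<le> degree p" "\<And>x y. x \<in> ?S \<Longrightarrow> y \<in> ?S \<Longrightarrow>
      (\<integral>u. poly U (?ip u x) * poly p (?ip u y) \<partial>?\<sigma>) = poly q (?ip x y)"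
      using sph_integral_poly_product[of p "Suc d" U] by auto
    \<comment> \<open>Integrating this triple product over u first gives B * p at y . x0; over y
      first it gives U * q at u . x0 with degree q < n, which is annihilated.\<close>
    let ?f = "\<lambda>u y. poly U (?ip u x0) * (poly U (?ip u y) * poly p (?ip y x0))"
    have int: "integrable (?\<sigma> \<Otimes>\<^sub>M ?\<sigma>) (\<lambda>(u, y). ?f u y)"
    proof -
      interpret P: finite_measure "?\<sigma> \<Otimes>\<^sub>M ?\<sigma>"
        by (intro finite_measure_pair_measure finite_measure_sph_measure)
      obtain C1 C2 where C: "C1 \<ge> 0" "C2 \<ge> 0" "\<And>u x. u \<in> ?S \<Longrightarrow> x \<in> ?S \<Longrightarrow> \<bar>poly U (?ip u x)\<bar> \<le> C1"
        "\<And>u x. u \<in> ?S \<Longrightarrow> x \<in> ?S \<Longrightarrow> \<bar>poly p (?ip u x)\<bar> \<le> C2"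
        using bound[of U] bound[of p] by blast
      have [measurable]: "(\<lambda>z. fst z i) \<in> borel_measurable (?\<sigma> \<Otimes>\<^sub>M ?\<sigma>)" "(\<lambda>z. snd z i) \<in> borel_measurable (?\<sigma> \<Otimes>\<^sub>M ?\<sigma>)" for i
        by (rule measurable_compose[OF measurable_fst coord_measurable]
            measurable_compose[OF measurable_snd coord_measurable])+
      have [measurable]: "poly p \<in> borel_measurable borel" for p :: "real poly"
        by (intro borel_measurable_continuous_onI continuous_intros)
      have [measurable]: "(\<lambda>z. ?ip (fst z) (snd z)) \<in> borel_measurable (?\<sigma> \<Otimes>\<^sub>M ?\<sigma>)"
        "(\<lambda>z. ?ip (fst z) x0) \<in> borel_measurable (?\<sigma> \<Otimes>\<^sub>M ?\<sigma>)"
        "(\<lambda>z. ?ip (snd z) x0) \<in> borel_measurable (?\<sigma> \<Otimes>\<^sub>M ?\<sigma>)"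
        unfolding sph_inner_def by measurable
      have "(\<lambda>z. ?f (fst z) (snd z)) \<in> borel_measurable (?\<sigma> \<Otimes>\<^sub>M ?\<sigma>)" by measurable
      moreover have "\<bar>?f u y\<bar> \<le> C1 * (C1 * C2)" if "u \<in> ?S" "y \<in> ?S" for u y
        using that x0 C by (simp add: abs_mult mult_mono)
      ultimately show ?thesis
        by (intro P.integrable_const_bound[where B = "C1 * (C1 * C2)"])
          (auto simp: space_pair_measure case_prod_beta')
    qed
    have "sph_moment d 0 * zonal d (\<lambda>t. poly B t * poly p t) = (\<integral>y. poly B (?ip y x0) * poly p (?ip y x0) \<partial>?\<sigma>)"
      using sph_integral_poly[OF x0, of "B * p"] unfolding poly_mult_fun by simp
    also have "\<dots> = (\<integral>y. (\<integral>u. ?f u y \<partial>?\<sigma>) \<partial>?\<sigma>)"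
    proof (rule Bochner_Integration.integral_cong)
      fix y assume "y \<in> space ?\<sigma>"
      then have "y \<in> ?S" by simp
      show "poly B (?ip y x0) * poly p (?ip y x0) = (\<integral>u. ?f u y \<partial>?\<sigma>)"
        using B(2)[OF x0 \<open>y \<in> ?S\<close>] by (simp add: mult.assoc[symmetric] sph_inner_commute[of _ x0 y])
    qed simp
    also have "\<dots> = (\<integral>u. (\<integral>y. ?f u y \<partial>?\<sigma>) \<partial>?\<sigma>)"
      by (rule sph_pair.Fubini_integral[OF int])
    also have "\<dots> = (\<integral>u. poly U (?ip u x0) * poly q (?ip u x0) \<partial>?\<sigma>)"
    proof (rule Bochner_Integration.integral_cong)
      fix u assume "u \<in> space ?\<sigma>"
      then have "u \<in> ?S" by simp
      show "(\<integral>y. ?f u y \<partial>?\<sigma>) = poly U (?ip u x0) * poly q (?ip u x0)"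
        using q(2)[OF \<open>u \<in> ?S\<close> x0] by (simp add: sph_inner_commute[of _ u])
    qed simp
    also have "\<dots> = sph_moment d 0 * zonal d (\<lambda>t. poly U t * poly q t)"
      using sph_integral_poly[OF x0, of "U * q"] unfolding poly_mult_fun by simp
    also have "\<dots> = 0"
      using zonal_ultra_lower_degree[of q n d] q(1) dp U(2) by simp
    finally show ?thesis using sph_moment_pos[of d 0] by simp
  qed
  obtain b where b: "\<And>t. poly B t = (\<Sum>j\<le>n. b j * ultra d j t)"
    using polynomial_in_span_ultra[OF B(1)] by blast
  have "b j = 0" if "j < n" for j
  proof -
    obtain V where V: "degree V = j" "ultra d j = poly V"
      using ultra_is_polynomial by blast
    have "0 = zonal d (\<lambda>t. \<Sum>i\<le>n. b i * (ultra d i t * ultra d j t))"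
      using ortho[of V] V that by (simp add: b sum_distrib_left sum_distrib_right mult_ac)
    also have "\<dots> = (\<Sum>i\<le>n. b i * zonal d (\<lambda>t. ultra d i t * ultra d j t))"
      by (subst zonal_sum) (auto intro!: continuous_intros simp: zonal_cmult)
    also have "\<dots> = (\<Sum>i\<le>n. if i = j then b j * zonal d (\<lambda>t. ultra d j t * ultra d j t) else 0)"
      by (intro sum.cong) (auto simp: zonal_ultra_orthogonal)
    finally show ?thesis
      using zonal_ultra_sq_pos[of d j] that by simp
  qed
  then have B': "poly B t = b n * ultra d n t" for t
    by (cases n) (simp_all add: b lessThan_Suc_atMost[symmetric])
  have fh: "(\<integral>u. ultra d n (?ip u x) * ultra d n (?ip u y) \<partial>?\<sigma>) = b n * ultra d n (?ip x y)"
    if "x \<in> ?S" "y \<in> ?S" for x y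
    using B(2)[OF that] B' by (simp add: U(2))
  \<comment> \<open>Taking x = y identifies the constant as the integral of a square.\<close>
  have "b n = (\<integral>u. ultra d n (?ip u x0) * ultra d n (?ip u x0) \<partial>?\<sigma>)"
    using fh[OF x0 x0] by (simp add: sph_inner_self[OF x0])
  also have "\<dots> = sph_moment d 0 * zonal d (\<lambda>t. ultra d n t * ultra d n t)"
    by (rule sph_integral_zonal[OF _ x0]) (intro continuous_intros)
  also have "\<dots> > 0"
    using sph_moment_pos zonal_ultra_sq_pos by simp
  finally show ?thesis using fh that by blast
qed

section \<open>Positive definite kernels\<close>

declare sph_measure.simps [simp del] sph_moment.simps [simp del]

definition qform :: "nat \<Rightarrow> (real \<Rightarrow> real) \<Rightarrow> (nat \<Rightarrow> real) set \<Rightarrow> ((nat \<Rightarrow> real) \<Rightarrow> real) \<Rightarrow> real" where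
  "qform k h X c = (\<Sum>x\<in>X. \<Sum>y\<in>X. c x * c y * h (sph_inner k x y))"

definition pos_def_kernel :: "nat \<Rightarrow> (real \<Rightarrow> real) \<Rightarrow> bool" where
  "pos_def_kernel k h \<longleftrightarrow> (\<forall>X c. finite X \<and> X \<subseteq> sphere_pts k \<longrightarrow> 0 \<le> qform k h X c)"

lemma qform_geo_dist:
  assumes "X \<subseteq> sphere_pts k"
  shows "(\<Sum>x\<in>X. \<Sum>y\<in>X. c x * c y * f (cos (geo_dist k x y))) = qform k f X c"
  unfolding qform_def geo_dist_def
proof (intro sum.cong refl)
  fix x y assume "x \<in> X" "y \<in> X"
  then have "sph_inner k x y \<in> {-1..1}" using assms by (intro sph_inner_bounds) auto
  then show "c x * c y * f (cos (arccos (sph_inner k x y))) = c x * c y * f (sph_inner k x y)"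
    by (simp add: cos_arccos)
qed

lemma continuous_on_cos_comp:
  "continuous_on {-1..1} f \<Longrightarrow> continuous_on {0..pi} (\<lambda>t. f (cos t))"
  by (rule continuous_on_compose2[of "{-1..1}" f]) (auto intro!: continuous_intros)

lemma Lambda_iff: "f \<in> Lambda k \<longleftrightarrow> continuous_on {-1..1} f \<and> pos_def_kernel k f"
  unfolding Lambda_def pos_def_sphere_def pos_def_kernel_def
  by (auto simp: qform_geo_dist continuous_on_cos_comp)

lemma Lambda_plus_iff:
  "f \<in> Lambda_plus k \<longleftrightarrow> f \<in> Lambda k \<and>
    (\<forall>X c. finite X \<and> X \<subseteq> sphere_pts k \<and> (\<exists>x\<in>X. c x \<noteq> 0) \<longrightarrow> qform k f X c > 0)"
  unfolding Lambda_plus_def strict_pos_def_sphere_def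
  by (auto simp: qform_geo_dist continuous_on_cos_comp Lambda_iff)

lemma qform_add: "qform k (\<lambda>t. f t + g t) X c = qform k f X c + qform k g X c"
  by (simp add: qform_def algebra_simps sum.distrib)

lemma qform_cmult: "qform k (\<lambda>t. a * f t) X c = a * qform k f X c"
  by (simp add: qform_def sum_distrib_left mult_ac)

lemma qform_sum: "qform k (\<lambda>t. \<Sum>i\<in>I. f i t) X c = (\<Sum>i\<in>I. qform k (f i) X c)"
proof -
  have "qform k (\<lambda>t. \<Sum>i\<in>I. f i t) X c = (\<Sum>x\<in>X. \<Sum>y\<in>X. \<Sum>i\<in>I. c x * c y * f i (sph_inner k x y))"
    by (simp add: qform_def sum_distrib_left)
  also have "\<dots> = (\<Sum>x\<in>X. \<Sum>i\<in>I. \<Sum>y\<in>X. c x * c y * f i (sph_inner k x y))"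
    by (intro sum.cong refl sum.swap)
  also have "\<dots> = (\<Sum>i\<in>I. qform k (f i) X c)"
    unfolding qform_def by (rule sum.swap)
  finally show ?thesis .
qed

lemma pos_def_kernel_add: "pos_def_kernel k f \<Longrightarrow> pos_def_kernel k g \<Longrightarrow> pos_def_kernel k (\<lambda>t. f t + g t)"
  by (simp add: pos_def_kernel_def qform_add)

lemma pos_def_kernel_cmult: "0 \<le> a \<Longrightarrow> pos_def_kernel k f \<Longrightarrow> pos_def_kernel k (\<lambda>t. a * f t)"
  by (simp add: pos_def_kernel_def qform_cmult)

lemma pos_def_kernel_1: "pos_def_kernel k (\<lambda>t. 1)"
proof -
  have "qform k (\<lambda>t. 1) X c = (\<Sum>x\<in>X. c x)^2" for X c
    by (simp add: qform_def power2_eq_square sum_product)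
  then show ?thesis by (simp add: pos_def_kernel_def)
qed

text \<open>Funk--Hecke writes \<open>ultra d n (x \<bullet> y)\<close> as an integral of products, so multiplying a kernel by it
  averages the rescaled forms with coefficients \<open>c x * ultra d n (u \<bullet> x)\<close>.\<close>
lemma pos_def_kernel_mult_ultra:
  assumes "pos_def_kernel (Suc d) f"
  shows "pos_def_kernel (Suc d) (\<lambda>t. f t * ultra d n t)"
  unfolding pos_def_kernel_def
proof (intro allI impI)
  fix X :: "(nat \<Rightarrow> real) set" and c
  let ?S = "sphere_pts (Suc d)" and ?\<sigma> = "sph_measure (Suc d)" and ?ip = "sph_inner (Suc d)"
  assume X: "finite X \<and> X \<subseteq> ?S"
  obtain \<kappa> where \<kappa>: "\<kappa> > 0" and fh: "\<And>x y. x \<in> ?S \<Longrightarrow> y \<in> ?S \<Longrightarrow>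
    (\<integral>u. ultra d n (?ip u x) * ultra d n (?ip u y) \<partial>?\<sigma>) = \<kappa> * ultra d n (?ip x y)"
    using Funk_Hecke_ultra[of d n] by blast
  have int: "integrable ?\<sigma> (\<lambda>u. ultra d n (?ip u x) * ultra d n (?ip u y))" if "x \<in> ?S" "y \<in> ?S" for x y
  proof -
    have c: "continuous_on {-1..1} (ultra d n)" by (intro continuous_intros)
    then obtain B where B: "\<And>t. t \<in> {-1..1} \<Longrightarrow> \<bar>ultra d n t\<bar> \<le> B"
      using continuous_on_Icc_bounded by blast
    have "\<bar>ultra d n (?ip u x) * ultra d n (?ip u y)\<bar> \<le> B * B" if "u \<in> ?S" for u
      using B[OF sph_inner_bounds[OF that \<open>x \<in> ?S\<close>]] B[OF sph_inner_bounds[OF that \<open>y \<in> ?S\<close>]]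
      unfolding abs_mult by (rule mult_mono) (use B[of 0] in auto)
    then show ?thesis
      using sph_zonal_measurable[OF c \<open>x \<in> ?S\<close>] sph_zonal_measurable[OF c \<open>y \<in> ?S\<close>]
      by (intro sph_integrable_bounded borel_measurable_times) auto
  qed
  have "\<kappa> * qform (Suc d) (\<lambda>t. f t * ultra d n t) X c =
      (\<Sum>x\<in>X. \<Sum>y\<in>X. c x * c y * f (?ip x y) * (\<integral>u. ultra d n (?ip u x) * ultra d n (?ip u y) \<partial>?\<sigma>))"
    unfolding qform_def sum_distrib_left using X
    by (intro sum.cong refl) (subst fh, auto)
  also have "\<dots> = (\<integral>u. (\<Sum>x\<in>X. \<Sum>y\<in>X. c x * c y * f (?ip x y) * (ultra d n (?ip u x) * ultra d n (?ip u y))) \<partial>?\<sigma>)"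
  proof -
    have "integrable ?\<sigma> (\<lambda>u. c x * c y * f (?ip x y) * (ultra d n (?ip u x) * ultra d n (?ip u y)))"
      if "x \<in> X" "y \<in> X" for x y
      using int[of x y] that X by auto
    note I = this
    show ?thesis
      by (subst Bochner_Integration.integral_sum, rule Bochner_Integration.integrable_sum, erule (1) I,
          intro sum.cong refl, subst Bochner_Integration.integral_sum, erule (1) I, simp)
  qed
  also have "\<dots> = (\<integral>u. qform (Suc d) f X (\<lambda>x. c x * ultra d n (?ip u x)) \<partial>?\<sigma>)"
    by (simp add: qform_def mult_ac)
  also have "\<dots> \<ge> 0"
    using assms X by (intro Bochner_Integration.integral_nonneg) (auto simp: pos_def_kernel_def)
  finally show "0 \<le> qform (Suc d) (\<lambda>t. f t * ultra d n t) X c"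
    using \<kappa> by (simp add: zero_le_mult_iff)
qed

lemma pos_def_kernel_ultra: "pos_def_kernel (Suc d) (ultra d n)"
  using pos_def_kernel_mult_ultra[OF pos_def_kernel_1, of d n] by simp

text \<open>As t is \<open>ultra d 1 t\<close>, multiplication by (1 + t) / 2 preserves positive
  definiteness.\<close>

lemma pos_def_kernel_peak: "pos_def_kernel (Suc d) (peak N)"
proof (induction N)
  case 0
  then show ?case using pos_def_kernel_1[of "Suc d"] by (simp add: peak_def[abs_def])
next
  case (Suc N)
  have "pos_def_kernel (Suc d) (\<lambda>t. 1/2 * (peak N t + peak N t * ultra d 1 t))"
    by (intro pos_def_kernel_cmult pos_def_kernel_add pos_def_kernel_mult_ultra Suc) auto
  moreover have "(\<lambda>t. 1/2 * (peak N t + peak N t * ultra d 1 t)) = peak (Suc N)"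
    by (simp add: peak_def fun_eq_iff field_simps)
  ultimately show ?case by simp
qed

section \<open>A positive definite kernel has nonnegative mean\<close>

lemma qform_extend:
  assumes "finite Y" "X \<subseteq> Y" "\<And>y. y \<in> Y - X \<Longrightarrow> e y = 0"
  shows "qform k F Y e = qform k F X e"
proof -
  have "qform k F Y e = (\<Sum>x\<in>X. \<Sum>y\<in>Y. e x * e y * F (sph_inner k x y))"
    unfolding qform_def using assms by (intro sum.mono_neutral_right) auto
  also have "\<dots> = qform k F X e"
    unfolding qform_def using assms by (intro sum.cong refl sum.mono_neutral_right) auto
  finally show ?thesis .
qed

lemma qform_add_point:
  assumes "finite Y" "x \<in> Y"
  shows "qform k F Y (\<lambda>z. e z + (if z = x then 1 else 0)) =
    qform k F Y e + 2 * (\<Sum>y\<in>Y. e y * F (sph_inner k y x)) + F (sph_inner k x x)"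
proof -
  let ?\<delta> = "\<lambda>z. if z = x then 1 else 0 :: real"
  have "qform k F Y (\<lambda>z. e z + ?\<delta> z) =
    (\<Sum>y\<in>Y. \<Sum>z\<in>Y. e y * e z * F (sph_inner k y z) + ((if z = x then e y * F (sph_inner k y z) else 0) +
       (if y = x then e z * F (sph_inner k y z) + (if z = x then F (sph_inner k y z) else 0) else 0)))"
    unfolding qform_def by (intro sum.cong refl) (auto simp: algebra_simps)
  also have "\<dots> = qform k F Y e + ((\<Sum>y\<in>Y. \<Sum>z\<in>Y. if z = x then e y * F (sph_inner k y z) else 0) +
      (\<Sum>y\<in>Y. \<Sum>z\<in>Y. if y = x then e z * F (sph_inner k y z) + (if z = x then F (sph_inner k y z) else 0) else 0))"
    by (simp only: sum.distrib qform_def)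
  also have "(\<Sum>y\<in>Y. \<Sum>z\<in>Y. if z = x then e y * F (sph_inner k y z) else 0) = (\<Sum>y\<in>Y. e y * F (sph_inner k y x))"
    using assms by simp
  also have "(\<Sum>y\<in>Y. \<Sum>z\<in>Y. if y = x then e z * F (sph_inner k y z) + (if z = x then F (sph_inner k y z) else 0) else 0)
     = (\<Sum>y\<in>Y. if y = x then (\<Sum>z\<in>Y. e z * F (sph_inner k y z) + (if z = x then F (sph_inner k y z) else 0)) else 0)"
    by (intro sum.cong refl) auto
  also have "\<dots> = (\<Sum>z\<in>Y. e z * F (sph_inner k x z)) + F (sph_inner k x x)"
    using assms by (simp add: sum.distrib)
  also have "(\<Sum>z\<in>Y. e z * F (sph_inner k x z)) = (\<Sum>z\<in>Y. e z * F (sph_inner k z x))"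
    by (subst sph_inner_commute) (rule refl)
  finally show ?thesis by simp
qed

text \<open>Adding points one at a time, each chosen where the potential of the previous ones is at most its
  mean, keeps the form below \<open>N * F 1 + N * (N - 1) * J\<close> with \<open>J\<close> the mean of \<open>F\<close>;
  a negative \<open>J\<close> would make this negative.\<close>
lemma pos_def_kernel_zonal_nonneg:
  assumes F: "continuous_on {-1..1} F" and pd: "pos_def_kernel (Suc d) F"
  shows "0 \<le> zonal d F"
proof -
  let ?S = "sphere_pts (Suc d)" and ?\<sigma> = "sph_measure (Suc d)" and ?ip = "sph_inner (Suc d)"
  define M where "M = sph_moment (Suc d) 0"
  have M: "M > 0" by (simp add: M_def sph_moment_pos)
  define J where "J = sph_moment d 0 * zonal d F / M"
  have mean: "(\<integral>u. F (?ip u x) \<partial>?\<sigma>) = M * J" if "x \<in> ?S" for x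
    using sph_integral_zonal[OF F that] M by (simp add: J_def)
  have greedy: "\<exists>X c. finite X \<and> X \<subseteq> ?S \<and> (\<Sum>x\<in>X. c x) = real N \<and>
      qform (Suc d) F X c \<le> real N * F 1 + real N * (real N - 1) * J" for N
  proof (induction N)
    case 0
    show ?case by (intro exI[of _ "{}"]) (simp add: qform_def)
  next
    case (Suc N)
    then obtain X c where X: "finite X" "X \<subseteq> ?S" "(\<Sum>x\<in>X. c x) = real N"
      and q: "qform (Suc d) F X c \<le> real N * F 1 + real N * (real N - 1) * J" by blast
    have int: "integrable ?\<sigma> (\<lambda>u. \<Sum>y\<in>X. c y * F (?ip u y))"
      using X F by (intro Bochner_Integration.integrable_sum integrable_mult_right sph_zonal_integrable) auto
    have tot: "(\<integral>u. (\<Sum>y\<in>X. c y * F (?ip u y)) \<partial>?\<sigma>) = real N * M * J"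
    proof -
      have "(\<integral>u. (\<Sum>y\<in>X. c y * F (?ip u y)) \<partial>?\<sigma>) = (\<Sum>y\<in>X. c y * (\<integral>u. F (?ip u y) \<partial>?\<sigma>))"
        using X F
        by (subst Bochner_Integration.integral_sum)
          (auto intro!: integrable_mult_right sph_zonal_integrable)
      also have "\<dots> = (\<Sum>y\<in>X. c y * (M * J))"
        using X mean by (intro sum.cong refl) auto
      finally show ?thesis using X(3) by (simp add: sum_distrib_right[symmetric])
    qed
    \<comment> \<open>The potential has integral N * M * J over a sphere of mass M, so it cannot
      exceed N * J everywhere.\<close>
    obtain x where x: "x \<in> ?S" "(\<Sum>y\<in>X. c y * F (?ip x y)) \<le> real N * J"
    proof (rule ccontr)
      assume "\<not> thesis"
      then have "\<And>x. x \<in> ?S \<Longrightarrow> real N * J < (\<Sum>y\<in>X. c y * F (?ip x y))"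
        using that by force
      then have "(\<integral>u. real N * J \<partial>?\<sigma>) < (\<integral>u. (\<Sum>y\<in>X. c y * F (?ip u y)) \<partial>?\<sigma>)"
        using M by (intro sph.integral_less_AE_space int AE_I2)
          (auto simp: sph.emeasure_eq_measure sph_mass M_def)
      then show False unfolding tot by (simp add: sph_mass M_def)
    qed
    \<comment> \<open>The new point may already lie in \<open>X\<close>. Extending \<open>c\<close>
      by 0 and then adding 1 at x treats both cases alike, with coefficients acting as
      multiplicities; hence only their sum, not the number of points, is controlled.\<close>
    define e where "e z = (if z \<in> X then c z else 0)" for z
    define c' where "c' z = e z + (if z = x then 1 else 0)" for z
    let ?Y = "insert x X"
    have eX: "qform (Suc d) F ?Y e = qform (Suc d) F X c"
    proof -
      have "qform (Suc d) F ?Y e = qform (Suc d) F X e"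
        using X by (intro qform_extend) (auto simp: e_def)
      then show ?thesis by (simp add: qform_def e_def)
    qed
    have eS: "(\<Sum>y\<in>?Y. e y * h y) = (\<Sum>y\<in>X. c y * h y)" for h
    proof -
      have "(\<Sum>y\<in>?Y. e y * h y) = (\<Sum>y\<in>X. e y * h y)"
        using X by (intro sum.mono_neutral_right) (auto simp: e_def)
      then show ?thesis by (simp add: e_def)
    qed
    have "(\<Sum>y\<in>?Y. c' y) = real (Suc N)"
      using eS[of "\<lambda>_. 1"] X by (simp add: c'_def sum.distrib del: sum.insert)
    moreover have "qform (Suc d) F ?Y c' \<le> real (Suc N) * F 1 + real (Suc N) * (real (Suc N) - 1) * J"
    proof -
      have "qform (Suc d) F ?Y c' = qform (Suc d) F X c + 2 * (\<Sum>y\<in>X. c y * F (?ip y x)) + F 1"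
        unfolding c'_def using X x
        by (subst qform_add_point) (auto simp: eX eS sph_inner_self simp del: sum.insert)
      also have "\<dots> \<le> real N * F 1 + real N * (real N - 1) * J + 2 * (real N * J) + F 1"
        using q x(2) by (simp add: sph_inner_commute[of _ x])
      finally show ?thesis by (simp add: algebra_simps)
    qed
    ultimately show ?case
      using X x(1) by (intro exI[of _ ?Y] exI[of _ c']) auto
  qed
  have "J \<ge> 0"
  proof (rule ccontr)
    assume "\<not> J \<ge> 0"
    then obtain n where n: "real n * (- J) > F 1"
      using reals_Archimedean3[of "- J"] by auto
    obtain X c where "finite X" "X \<subseteq> ?S"
      "qform (Suc d) F X c \<le> real (Suc n) * F 1 + real (Suc n) * (real (Suc n) - 1) * J"
      using greedy[of "Suc n"] by blast
    moreover have "0 \<le> qform (Suc d) F X c"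
      using pd \<open>finite X\<close> \<open>X \<subseteq> ?S\<close> by (simp add: pos_def_kernel_def)
    ultimately have "0 \<le> real (Suc n) * (F 1 + real n * J)"
      by (simp add: algebra_simps)
    then show False using n by (simp add: zero_le_mult_iff)
  qed
  then show ?thesis
    using M sph_moment_pos[of d 0] by (simp add: J_def zero_le_divide_iff zero_le_mult_iff)
qed

text \<open>Constant in \<open>n\<close> for the Chebyshev polynomials (\<open>d = 0\<close>); for \<open>d \<ge> 1\<close> and \<open>\<bar>t\<bar> < 1\<close> its decrements
  force it, and with it \<open>ultra d n t\<close>, to 0.\<close>
definition turan :: "nat \<Rightarrow> nat \<Rightarrow> real \<Rightarrow> real" where
  "turan d n t = (ultra d (Suc n) t)^2 - 2 * t * ultra d (Suc n) t * ultra d n t + (ultra d n t)^2"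

lemma turan_ge: "(1 - t^2) * (ultra d (Suc n) t)^2 \<le> turan d n t"
proof -
  have "turan d n t = (t * ultra d (Suc n) t - ultra d n t)^2 + (1 - t^2) * (ultra d (Suc n) t)^2"
    by (simp add: turan_def power2_eq_square algebra_simps)
  then show ?thesis by simp
qed

text \<open>The recurrence says u_(n+2) - t u_(n+1) = \<rho> (t u_(n+1) - u_n) with \<rho> = (n + 1)
  / (n + 1 + d). Completing squares around u_(n+1) gives both forms the same summand (1 - t^2)
  u_(n+1)^2, so only these differences remain.\<close>

lemma turan_Suc:
  "turan d n t - turan d (Suc n) t =
    (1 - ((real n + 1) / (real n + 1 + real d))^2) * (t * ultra d (Suc n) t - ultra d n t)^2"
proof -
  define \<rho> where "\<rho> = (real n + 1) / (real n + 1 + real d)"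
  have nz: "real n + 1 + real d \<noteq> 0" by linarith
  have "(real n + 1 + real d) * (ultra d (n + 2) t - t * ultra d (n + 1) t) =
      (real n + 1) * (t * ultra d (Suc n) t - ultra d n t)"
    using ultra_rec[of n d t] by (simp add: algebra_simps)
  then have r: "ultra d (Suc (Suc n)) t - t * ultra d (Suc n) t = \<rho> * (t * ultra d (Suc n) t - ultra d n t)"
    using nz by (simp add: \<rho>_def field_simps)
  have "turan d (Suc n) t = (ultra d (Suc (Suc n)) t - t * ultra d (Suc n) t)^2 + (1 - t^2) * (ultra d (Suc n) t)^2"
    by (simp add: turan_def power2_eq_square algebra_simps)
  moreover have "turan d n t = (t * ultra d (Suc n) t - ultra d n t)^2 + (1 - t^2) * (ultra d (Suc n) t)^2"
    by (simp add: turan_def power2_eq_square algebra_simps)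
  ultimately show ?thesis
    unfolding r \<rho>_def[symmetric] power_mult_distrib by (simp add: left_diff_distrib)
qed

lemma turan_antimono: "turan d (Suc n) t \<le> turan d n t"
proof -
  have "((real n + 1) / (real n + 1 + real d))^2 \<le> 1"
    by (intro power_le_one) (auto simp: field_simps)
  then have "0 \<le> turan d n t - turan d (Suc n) t"
    unfolding turan_Suc by (intro mult_nonneg_nonneg) auto
  then show ?thesis by simp
qed

lemma turan_le: "turan d n t \<le> 1 - t^2"
proof (induction n)
  case 0
  show ?case by (simp add: turan_def power2_eq_square)
next
  case (Suc n)
  then show ?case using turan_antimono[of d n t] by linarith
qed

text \<open>The form starts at 1 - t^2, decreases, and dominates (1 - t^2) u^2; dividing by 1 - t^2
  leaves the endpoints, which are evaluated directly.\<close>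

lemma abs_ultra_le_1:
  assumes "t \<in> {-1..1}"
  shows "\<bar>ultra d n t\<bar> \<le> 1"
proof (cases "t = 1 \<or> t = -1")
  case True
  then show ?thesis by (auto simp: ultra_minus abs_mult)
next
  case False
  then have t: "1 - t^2 > 0" using assms by (simp add: abs_square_less_1 abs_less_iff)
  show ?thesis
  proof (cases n)
    case (Suc k)
    have "(1 - t^2) * (ultra d n t)^2 \<le> (1 - t^2) * 1"
      unfolding Suc using order_trans[OF turan_ge turan_le] by simp
    then have "(ultra d n t)^2 \<le> 1" using t by simp
    then show ?thesis by (simp add: abs_square_le_1)
  qed simp
qed

section \<open>Schoenberg expansions\<close>

text \<open>Summability of \<open>a\<close> is convergence at t = 1, and since the polynomials are
  bounded by 1 on [-1, 1] it gives uniform convergence there.\<close>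

definition ultra_expansion :: "nat \<Rightarrow> (nat \<Rightarrow> real) \<Rightarrow> (real \<Rightarrow> real) \<Rightarrow> bool" where
  "ultra_expansion d a f \<longleftrightarrow> (\<forall>n. 0 \<le> a n) \<and> summable a \<and>
     (\<forall>t\<in>{-1..1}. (\<lambda>n. a n * ultra d n t) sums f t)"

lemma ultra_series_summable:
  assumes "\<And>n. 0 \<le> a n" "summable a" "t \<in> {-1..1}"
  shows "summable (\<lambda>n. a n * ultra d n t)"
  using assms abs_ultra_le_1[OF assms(3), of d]
  by (intro summable_comparison_test'[OF assms(2), of 0]) (auto simp: abs_mult mult_left_le)

lemma ultra_expansion_suminf:
  assumes "\<And>n. 0 \<le> a n" "summable a"
  shows "ultra_expansion d a (\<lambda>t. \<Sum>n. a n * ultra d n t)"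
  using assms ultra_series_summable[of a _ d] by (auto simp: ultra_expansion_def intro: summable_sums)

lemma ultra_expansion_tail:
  assumes "ultra_expansion d a f" "t \<in> {-1..1}"
  shows "\<bar>f t - (\<Sum>n<N. a n * ultra d n t)\<bar> \<le> (\<Sum>n. a (n + N))"
proof -
  have a: "\<And>n. 0 \<le> a n" "summable a" and s: "(\<lambda>n. a n * ultra d n t) sums f t"
    using assms by (auto simp: ultra_expansion_def)
  have sa: "summable (\<lambda>n. a (n + N))" using a by (simp add: summable_iff_shift)
  have le: "\<bar>a (n + N) * ultra d (n + N) t\<bar> \<le> a (n + N)" for n
    using a(1) abs_ultra_le_1[OF assms(2)] by (simp add: abs_mult mult_left_le)
  have "f t - (\<Sum>n<N. a n * ultra d n t) = (\<Sum>n. a (n + N) * ultra d (n + N) t)"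
    using suminf_minus_initial_segment[OF sums_summable[OF s], of N] sums_unique[OF s] by simp
  also have "\<bar>\<dots>\<bar> \<le> (\<Sum>n. \<bar>a (n + N) * ultra d (n + N) t\<bar>)"
    by (rule summable_rabs) (rule summable_comparison_test'[OF sa, of 0], use le in auto)
  also have "\<dots> \<le> (\<Sum>n. a (n + N))"
    by (intro suminf_le le sa summable_comparison_test'[OF sa, of 0]) (use le in auto)
  finally show ?thesis .
qed

lemma suminf_tail_tendsto_0:
  fixes a :: "nat \<Rightarrow> real"
  assumes "summable a"
  shows "(\<lambda>N. \<Sum>n. a (n + N)) \<longlonglongrightarrow> 0"
proof -
  have "(\<lambda>N. suminf a - (\<Sum>n<N. a n)) \<longlonglongrightarrow> suminf a - suminf a"
    by (intro tendsto_intros summable_LIMSEQ assms)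
  then show ?thesis by (simp add: suminf_minus_initial_segment[OF assms])
qed

lemma ultra_expansion_continuous:
  assumes "ultra_expansion d a f"
  shows "continuous_on {-1..1} f"
proof -
  have a: "summable a" using assms by (simp add: ultra_expansion_def)
  have "uniform_limit {-1..1} (\<lambda>N t. \<Sum>n<N. a n * ultra d n t) f sequentially"
  proof (rule uniform_limitI)
    fix e :: real assume "e > 0"
    then have "\<forall>\<^sub>F N in sequentially. (\<Sum>n. a (n + N)) < e"
      using order_tendstoD(2)[OF suminf_tail_tendsto_0[OF a]] by simp
    then show "\<forall>\<^sub>F N in sequentially. \<forall>t\<in>{-1..1}. dist (\<Sum>n<N. a n * ultra d n t) (f t) < e"
    proof eventually_elim
      case (elim N)
      then show ?case
        using ultra_expansion_tail[OF assms, of _ N]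
        by (auto simp: dist_real_def abs_minus_commute intro: le_less_trans simp del: atLeastAtMost_iff)
    qed
  qed
  then show ?thesis
    by (rule uniform_limit_theorem[rotated]) (auto intro!: always_eventually continuous_intros)
qed

text \<open>Termwise integration by the uniform tail bound: the discrepancy is at most the tail
  beyond N times the total weight, for every N > n. Thus the sum of an expansion determines its
  coefficients.\<close>

lemma ultra_expansion_zonal:
  assumes "ultra_expansion d a f"
  shows "zonal d (\<lambda>t. f t * ultra d n t) = a n * zonal d (\<lambda>t. ultra d n t * ultra d n t)"
proof -
  have f: "continuous_on {-1..1} f" by (rule ultra_expansion_continuous[OF assms])
  have a: "\<And>n. 0 \<le> a n" "summable a" using assms by (auto simp: ultra_expansion_def)
  let ?D = "zonal d (\<lambda>t. f t * ultra d n t) - a n * zonal d (\<lambda>t. ultra d n t * ultra d n t)"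
  have bound: "\<bar>?D\<bar> \<le> (\<Sum>j. a (j + N)) * zonal d (\<lambda>t. 1)" if "N > n" for N
  proof -
    define S where "S t = (\<Sum>j<N. a j * ultra d j t)" for t
    have S: "continuous_on {-1..1} S" unfolding S_def by (intro continuous_intros)
    define T where "T = (\<Sum>j. a (j + N))"
    have "zonal d (\<lambda>t. S t * ultra d n t) = (\<Sum>j<N. a j * zonal d (\<lambda>t. ultra d j t * ultra d n t))"
      unfolding S_def sum_distrib_right mult.assoc
      by (subst zonal_sum) (auto intro!: continuous_intros simp: zonal_cmult)
    also have "\<dots> = (\<Sum>j<N. if j = n then a n * zonal d (\<lambda>t. ultra d n t * ultra d n t) else 0)"
      by (intro sum.cong) (auto simp: zonal_ultra_orthogonal)
    finally have D: "?D = zonal d (\<lambda>t. f t * ultra d n t - S t * ultra d n t)"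
      using that f S by (subst zonal_diff) (auto intro!: continuous_intros)
    have ptw: "\<bar>f t * ultra d n t - S t * ultra d n t\<bar> \<le> T" if "t \<in> {-1..1}" for t
    proof -
      have "\<bar>f t * ultra d n t - S t * ultra d n t\<bar> = \<bar>f t - S t\<bar> * \<bar>ultra d n t\<bar>"
        by (simp add: abs_mult[symmetric] left_diff_distrib)
      also have "\<dots> \<le> \<bar>f t - S t\<bar> * 1"
        by (intro mult_left_mono abs_ultra_le_1 that) auto
      finally show ?thesis
        using ultra_expansion_tail[OF assms that, of N] by (simp add: S_def T_def)
    qed
    have c: "continuous_on {-1..1} (\<lambda>t. f t * ultra d n t - S t * ultra d n t)"
      using f S by (auto intro!: continuous_intros)
    have "zonal d (\<lambda>t. f t * ultra d n t - S t * ultra d n t) \<le> zonal d (\<lambda>t. T * 1)"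
      using ptw by (intro zonal_mono c) (auto simp: abs_le_iff)
    moreover have "zonal d (\<lambda>t. - T * 1) \<le> zonal d (\<lambda>t. f t * ultra d n t - S t * ultra d n t)"
      by (rule zonal_mono[OF _ c]) (use ptw in \<open>fastforce simp: abs_le_iff\<close>)+
    ultimately show ?thesis unfolding D T_def[symmetric] zonal_cmult by simp
  qed
  have "(\<lambda>N. (\<Sum>j. a (j + N)) * zonal d (\<lambda>t. 1)) \<longlonglongrightarrow> 0 * zonal d (\<lambda>t. 1)"
    by (intro tendsto_intros suminf_tail_tendsto_0 a)
  then have "\<bar>?D\<bar> \<le> 0"
    using bound by (intro LIMSEQ_le_const[of _ 0]) (auto intro!: exI[of _ "Suc n"])
  then show ?thesis by simp
qed

lemma ultra_expansion_qform:
  assumes "ultra_expansion d a f" "X \<subseteq> sphere_pts k"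
  shows "(\<lambda>n. a n * qform k (ultra d n) X c) sums qform k f X c"
proof -
  have s: "(\<lambda>n. a n * ultra d n (sph_inner k x y)) sums f (sph_inner k x y)" if "x \<in> X" "y \<in> X" for x y
  proof -
    have "sph_inner k x y \<in> {-1..1}" using that assms(2) by (intro sph_inner_bounds) auto
    then show ?thesis using assms(1) unfolding ultra_expansion_def by blast
  qed
  have "(\<lambda>n. \<Sum>x\<in>X. \<Sum>y\<in>X. c x * c y * (a n * ultra d n (sph_inner k x y))) sums qform k f X c"
    unfolding qform_def by (intro sums_sum sums_mult s)
  then show ?thesis by (simp add: qform_def sum_distrib_left mult_ac)
qed

lemma qform_ultra_nonneg:
  "finite X \<Longrightarrow> X \<subseteq> sphere_pts (Suc d) \<Longrightarrow> 0 \<le> qform (Suc d) (ultra d n) X c"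
  using pos_def_kernel_ultra[of d n] by (simp add: pos_def_kernel_def)

lemma ultra_expansion_Lambda:
  assumes "ultra_expansion d a f"
  shows "f \<in> Lambda (Suc d)"
  unfolding Lambda_iff pos_def_kernel_def
proof (intro conjI allI impI)
  show "continuous_on {-1..1} f" by (rule ultra_expansion_continuous[OF assms])
  fix X :: "(nat \<Rightarrow> real) set" and c
  assume X: "finite X \<and> X \<subseteq> sphere_pts (Suc d)"
  show "0 \<le> qform (Suc d) f X c"
    using assms X
    by (intro sums_le[OF _ sums_zero ultra_expansion_qform[OF assms]] mult_nonneg_nonneg qform_ultra_nonneg)
      (auto simp: ultra_expansion_def)
qed

section \<open>Recovering the expansion by means of the peaks\<close>

text \<open>The polynomial 1 - \<open>ultra d n\<close> vanishes at 1, so it has the factor t - 1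
  with a cofactor bounded on [-1, 1].\<close>

lemma ultra_lipschitz_at_1:
  obtains L where "\<And>t. t \<in> {-1..1} \<Longrightarrow> \<bar>1 - ultra d n t\<bar> \<le> L * (1 - t)"
proof -
  obtain p where p: "ultra d n = poly p" using ultra_is_polynomial by blast
  have "poly (1 - p) 1 = 0" by (simp add: p[symmetric])
  then obtain r where r: "1 - p = [:- 1, 1:] * r"
    by (metis poly_eq_0_iff_dvd dvdE)
  obtain L where L: "\<And>t. t \<in> {-1..1} \<Longrightarrow> \<bar>poly r t\<bar> \<le> L"
    by (rule continuous_on_Icc_bounded[of "poly r"]) (auto intro: continuous_intros)
  have "\<bar>1 - ultra d n t\<bar> \<le> L * (1 - t)" if "t \<in> {-1..1}" for t
  proof -
    have "1 - ultra d n t = (t - 1) * poly r t"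
      using arg_cong[OF r, of "\<lambda>q. poly q t"] by (simp add: p algebra_simps)
    then have "\<bar>1 - ultra d n t\<bar> = (1 - t) * \<bar>poly r t\<bar>"
      using that by (simp add: abs_mult)
    also have "\<dots> \<le> (1 - t) * L"
      using that L by (intro mult_left_mono) auto
    finally show ?thesis by (simp add: mult.commute)
  qed
  then show ?thesis using that by blast
qed

text \<open>By the Lipschitz bound at 1 the distance to 1 is at most L times the mean of 1 - t under
  the normalised peak, hence at most L (d + 1) / N.\<close>

lemma peak_coefficient_tendsto_1:
  "(\<lambda>N. zonal d (\<lambda>t. peak N t * ultra d n t) / zonal d (peak N)) \<longlonglongrightarrow> 1"
proof -
  obtain L where L: "\<And>t. t \<in> {-1..1} \<Longrightarrow> \<bar>1 - ultra d n t\<bar> \<le> L * (1 - t)"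
    using ultra_lipschitz_at_1 by blast
  have L0: "L \<ge> 0" using L[of 0] by auto
  let ?r = "\<lambda>N. zonal d (\<lambda>t. peak N t * ultra d n t) / zonal d (peak N)"
  have bound: "\<bar>?r N - 1\<bar> \<le> L * (real d + 1) * inverse (real N)" if "N > 0" for N
  proof -
    define P where "P = zonal d (peak N)"
    have P: "P > 0" by (simp add: P_def zonal_peak_pos)
    have c: "continuous_on {-1..1} (\<lambda>t. peak N t * ultra d n t)" "continuous_on {-1..1} (peak N)"
      by (auto intro!: continuous_intros)
    have pk: "0 \<le> peak N t" if "t \<in> {-1..1}" for t using that by (simp add: peak_def)
    have "P - zonal d (\<lambda>t. peak N t * ultra d n t) = zonal d (\<lambda>t. peak N t - peak N t * ultra d n t)"
      unfolding P_def by (rule zonal_diff[symmetric]) (fact c)+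
    also have "\<dots> \<le> zonal d (\<lambda>t. L * (peak N t * (1 - t)))"
    proof (rule zonal_mono)
      fix t :: real assume t: "t \<in> {-1..1}"
      have "1 - ultra d n t \<le> L * (1 - t)" using L[OF t] by (simp add: abs_le_iff)
      then have "peak N t * (1 - ultra d n t) \<le> peak N t * (L * (1 - t))"
        using pk[OF t] by (rule mult_left_mono)
      then show "peak N t - peak N t * ultra d n t \<le> L * (peak N t * (1 - t))"
        by (simp add: algebra_simps)
    qed (auto intro!: continuous_intros)
    finally have "real N * (P - zonal d (\<lambda>t. peak N t * ultra d n t)) \<le>
        L * (real N * zonal d (\<lambda>t. peak N t * (1 - t)))"
      using that by (simp add: zonal_cmult mult_left_mono)
    also have "\<dots> \<le> L * ((real d + 1) * P)"
      unfolding P_def by (intro mult_left_mono zonal_peak_concentration L0)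
    finally have u: "P - zonal d (\<lambda>t. peak N t * ultra d n t) \<le> L * (real d + 1) * inverse (real N) * P"
      using that by (simp add: field_simps)
    have "zonal d (\<lambda>t. peak N t * ultra d n t) \<le> P"
      unfolding P_def using pk abs_ultra_le_1[of _ d n]
      by (intro zonal_mono c mult_left_le) (auto simp: abs_le_iff)
    then have "0 \<le> (P - zonal d (\<lambda>t. peak N t * ultra d n t)) / P"
      using P by simp
    moreover have "(P - zonal d (\<lambda>t. peak N t * ultra d n t)) / P \<le> L * (real d + 1) * inverse (real N)"
      using u P by (simp add: pos_divide_le_eq)
    moreover have "?r N - 1 = - ((P - zonal d (\<lambda>t. peak N t * ultra d n t)) / P)"
      using P by (simp add: P_def[symmetric] diff_divide_distrib)
    ultimately show ?thesis by simp
  qed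
  have "(\<lambda>N. L * (real d + 1) * inverse (real N)) \<longlonglongrightarrow> L * (real d + 1) * 0"
    by (intro tendsto_intros lim_inverse_n)
  then have lim: "(\<lambda>N. L * (real d + 1) * inverse (real N)) \<longlonglongrightarrow> 0"
    by (simp only: mult_zero_right)
  have "(\<lambda>N. ?r N - 1) \<longlonglongrightarrow> 0"
  proof (rule Lim_null_comparison[OF _ lim])
    show "\<forall>\<^sub>F N in sequentially. norm (?r N - 1) \<le> L * (real d + 1) * inverse (real N)"
    proof (rule eventually_sequentiallyI[of 1])
      fix N :: nat assume "1 \<le> N"
      then show "norm (?r N - 1) \<le> L * (real d + 1) * inverse (real N)"
        unfolding real_norm_def by (intro bound) simp
    qed
  qed
  then show ?thesis by (simp add: LIM_zero_iff)
qed

text \<open>A finite Parseval identity: \<open>peak N\<close> is a polynomial of degree N, and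
  orthogonality identifies its coefficients \<open>b n\<close>.\<close>

lemma peak_expansion:
  assumes f: "continuous_on {-1..1} f"
  shows "zonal d (\<lambda>t. f t * peak N t) = (\<Sum>n\<le>N. zonal d (\<lambda>t. peak N t * ultra d n t) *
     (zonal d (\<lambda>t. f t * ultra d n t) / zonal d (\<lambda>t. ultra d n t * ultra d n t)))"
proof -
  have "poly ([:1/2, 1/2:] ^ N) t = peak N t" for t
    by (simp add: peak_def poly_power add_divide_distrib)
  moreover have "degree ([:1/2, 1/2:] ^ N :: real poly) \<le> N"
    using degree_power_le[of "[:1/2, 1/2:] :: real poly" N] by simp
  ultimately obtain b where b: "\<And>t. peak N t = (\<Sum>n\<le>N. b n * ultra d n t)"
    using polynomial_in_span_ultra[of "[:1/2, 1/2:] ^ N" N d] by auto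
  have bn: "b n = zonal d (\<lambda>t. peak N t * ultra d n t) / zonal d (\<lambda>t. ultra d n t * ultra d n t)" if "n \<le> N" for n
  proof -
    have "zonal d (\<lambda>t. peak N t * ultra d n t) = (\<Sum>j\<le>N. b j * zonal d (\<lambda>t. ultra d j t * ultra d n t))"
      unfolding b sum_distrib_right mult.assoc
      by (subst zonal_sum) (auto intro!: continuous_intros simp: zonal_cmult)
    also have "\<dots> = (\<Sum>j\<le>N. if j = n then b n * zonal d (\<lambda>t. ultra d n t * ultra d n t) else 0)"
      by (intro sum.cong) (auto simp: zonal_ultra_orthogonal)
    finally show ?thesis using that zonal_ultra_sq_pos[of d n] by simp
  qed
  have "zonal d (\<lambda>t. f t * peak N t) = (\<Sum>n\<le>N. zonal d (\<lambda>t. b n * (f t * ultra d n t)))"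
    unfolding b sum_distrib_left using f
    by (subst zonal_sum[symmetric]) (auto intro!: continuous_intros simp: mult_ac)
  also have "\<dots> = (\<Sum>n\<le>N. b n * zonal d (\<lambda>t. f t * ultra d n t))"
    by (simp add: zonal_cmult)
  finally show ?thesis by (simp add: bn)
qed

text \<open>Testing \<open>f\<close> against the peaks, which are nonnegative with nonnegative coefficients, bounds the
  partial sums of the coefficients by a bound for \<open>f\<close>.\<close>
theorem Lambda_ultra_expansion:
  assumes "f \<in> Lambda (Suc d)"
  shows "ultra_expansion d
    (\<lambda>n. zonal d (\<lambda>t. f t * ultra d n t) / zonal d (\<lambda>t. ultra d n t * ultra d n t)) f"
    (is "ultra_expansion d ?a f")
proof -
  have f: "continuous_on {-1..1} f" and pd: "pos_def_kernel (Suc d) f"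
    using assms by (auto simp: Lambda_iff)
  have fu: "continuous_on {-1..1} (\<lambda>t. f t * ultra d n t)" for n
    using f by (intro continuous_intros)
  have a: "0 \<le> ?a n" for n
    using pos_def_kernel_zonal_nonneg[OF fu pos_def_kernel_mult_ultra[OF pd]] zonal_ultra_sq_pos[of d n]
    by simp
  obtain B where B: "\<And>t. t \<in> {-1..1} \<Longrightarrow> \<bar>f t\<bar> \<le> B"
    using continuous_on_Icc_bounded[OF f] by blast
  have pk: "0 \<le> zonal d (\<lambda>t. peak N t * ultra d n t)" for N n
    by (intro pos_def_kernel_zonal_nonneg pos_def_kernel_mult_ultra pos_def_kernel_peak continuous_intros)
  have "(\<Sum>n<m. ?a n) \<le> B" for m
  proof (rule LIMSEQ_le_const2)
    let ?r = "\<lambda>N n. zonal d (\<lambda>t. peak N t * ultra d n t) / zonal d (peak N)"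
    show "(\<lambda>N. \<Sum>n<m. ?r N n * ?a n) \<longlonglongrightarrow> (\<Sum>n<m. ?a n)"
    proof -
      have "(\<lambda>N. \<Sum>n<m. ?r N n * ?a n) \<longlonglongrightarrow> (\<Sum>n<m. 1 * ?a n)"
        by (intro tendsto_sum tendsto_mult peak_coefficient_tendsto_1 tendsto_const)
      then show ?thesis by (simp only: mult_1_left)
    qed
    have "(\<Sum>n<m. ?r N n * ?a n) \<le> B" if "N \<ge> m" for N
    proof -
      have "(\<Sum>n<m. ?r N n * ?a n) \<le> (\<Sum>n\<le>N. ?r N n * ?a n)"
      proof (rule sum_mono2)
        show "0 \<le> ?r N n * ?a n" for n
          by (rule mult_nonneg_nonneg[OF divide_nonneg_pos[OF pk zonal_peak_pos] a])
      qed (use that in auto)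
      also have "\<dots> = zonal d (\<lambda>t. f t * peak N t) / zonal d (peak N)"
        unfolding peak_expansion[OF f] by (simp add: sum_divide_distrib mult_ac)
      also have "\<dots> \<le> B"
      proof -
        have "zonal d (\<lambda>t. f t * peak N t) \<le> zonal d (\<lambda>t. B * peak N t)"
          using f B by (intro zonal_mono mult_right_mono continuous_intros) (auto simp: abs_le_iff peak_def)
        then show ?thesis
          using zonal_peak_pos[of d N] by (simp add: zonal_cmult divide_le_eq)
      qed
      finally show ?thesis .
    qed
    then show "\<exists>N0. \<forall>N\<ge>N0. (\<Sum>n<m. ?r N n * ?a n) \<le> B" by blast
  qed
  then have sa: "summable ?a" by (rule summableI_nonneg_bounded[OF a])
  let ?g = "\<lambda>t. \<Sum>n. ?a n * ultra d n t"
  have g: "ultra_expansion d ?a ?g" by (rule ultra_expansion_suminf[OF a sa])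
  have gc: "continuous_on {-1..1} ?g" by (rule ultra_expansion_continuous[OF g])
  \<comment> \<open>The sum of the series has the same coefficients as \<open>f\<close>, so
    completeness identifies the two.\<close>
  have "f t - ?g t = 0" if "t \<in> {-1..1}" for t
  proof (rule zonal_complete[of "\<lambda>t. f t - ?g t" d])
    show "continuous_on {-1..1} (\<lambda>t. f t - ?g t)" using f gc by (rule continuous_on_diff)
    fix n
    have "zonal d (\<lambda>t. (f t - ?g t) * ultra d n t) = zonal d (\<lambda>t. f t * ultra d n t) - zonal d (\<lambda>t. ?g t * ultra d n t)"
      unfolding left_diff_distrib
      by (rule zonal_diff[OF fu]) (intro continuous_on_mult gc continuous_intros)
    also have "\<dots> = 0"
      unfolding ultra_expansion_zonal[OF g] using zonal_ultra_sq_pos[of d n] by simp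
    finally show "zonal d (\<lambda>t. (f t - ?g t) * ultra d n t) = 0" .
  qed (fact that)
  then have eq: "?g t = f t" if "t \<in> {-1..1}" for t
    using that by force
  show ?thesis
    unfolding ultra_expansion_def
  proof (intro conjI ballI allI a sa)
    fix t :: real assume t: "t \<in> {-1..1}"
    have "(\<lambda>n. ?a n * ultra d n t) sums ?g t"
      using g t unfolding ultra_expansion_def by blast
    then show "(\<lambda>n. ?a n * ultra d n t) sums f t" unfolding eq[OF t] .
  qed
qed

section \<open>Strict positive definiteness\<close>

lemma qform_eq_0_imp:
  assumes exp: "ultra_expansion d a f" and X: "finite X" "X \<subseteq> sphere_pts (Suc d)"
    and 0: "qform (Suc d) f X c = 0" and n: "a n > 0"
  shows "qform (Suc d) (ultra d n) X c = 0"
proof -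
  have nn: "0 \<le> a n * qform (Suc d) (ultra d n) X c" for n
    using exp X by (intro mult_nonneg_nonneg qform_ultra_nonneg) (auto simp: ultra_expansion_def)
  have s: "(\<lambda>n. a n * qform (Suc d) (ultra d n) X c) sums 0"
    using ultra_expansion_qform[OF exp X(2), of c] 0 by simp
  have "a n * qform (Suc d) (ultra d n) X c = 0"
    using suminf_eq_zero_iff[OF sums_summable[OF s] nn] sums_unique[OF s] by simp
  then show ?thesis using n by simp
qed

text \<open>A form that vanishes is a vanishing sum of nonnegative terms, so strictness means that
  no nonzero \<open>c\<close> is annihilated by all \<open>ultra d n\<close> with a n > 0. The
  conclusion is a sum of squares because limits of forms deliver exactly that value through
  \<open>qform_diagonal\<close>.\<close>

lemma Lambda_plus_expansionI:
  assumes exp: "ultra_expansion d a f"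
    and "\<And>X c. finite X \<Longrightarrow> X \<subseteq> sphere_pts (Suc d) \<Longrightarrow>
      (\<And>n. a n > 0 \<Longrightarrow> qform (Suc d) (ultra d n) X c = 0) \<Longrightarrow> (\<Sum>x\<in>X. (c x)^2) = 0"
  shows "f \<in> Lambda_plus (Suc d)"
  unfolding Lambda_plus_iff
proof (intro conjI allI impI)
  show f: "f \<in> Lambda (Suc d)" by (rule ultra_expansion_Lambda[OF exp])
  fix X :: "(nat \<Rightarrow> real) set" and c :: "(nat \<Rightarrow> real) \<Rightarrow> real"
  assume X: "finite X \<and> X \<subseteq> sphere_pts (Suc d) \<and> (\<exists>x\<in>X. c x \<noteq> 0)"
  have "qform (Suc d) f X c \<noteq> 0"
  proof
    assume "qform (Suc d) f X c = 0"
    then have "(\<Sum>x\<in>X. (c x)^2) = 0"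
      using X by (intro assms(2) qform_eq_0_imp[OF exp]) auto
    then show False using X by (simp add: sum_nonneg_eq_0_iff)
  qed
  moreover have "0 \<le> qform (Suc d) f X c"
    using f X by (simp add: Lambda_iff pos_def_kernel_def)
  ultimately show "0 < qform (Suc d) f X c" by simp
qed

text \<open>Distinct unit vectors have inner product different from 1. This discontinuous kernel
  arises as a pointwise limit of polynomial kernels.\<close>

lemma qform_diagonal:
  assumes "finite X" "X \<subseteq> sphere_pts k"
  shows "qform k (\<lambda>t. if t = 1 then 1 else 0) X c = (\<Sum>x\<in>X. (c x)^2)"
proof -
  have "qform k (\<lambda>t. if t = 1 then 1 else 0) X c = (\<Sum>x\<in>X. \<Sum>y\<in>X. if y = x then c x * c y else 0)"
    unfolding qform_def
  proof (intro sum.cong refl)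
    fix x y assume "x \<in> X" "y \<in> X"
    then have "x \<in> sphere_pts k" "y \<in> sphere_pts k" using assms(2) by auto
    then have "sph_inner k x y = 1 \<longleftrightarrow> y = x"
      using sph_inner_eq_1_imp[of x k y] sph_inner_self[of x k] by auto
    then show "c x * c y * (if sph_inner k x y = 1 then 1 else 0) = (if y = x then c x * c y else 0)"
      by simp
  qed
  then show ?thesis using assms by (simp add: power2_eq_square)
qed

lemma qform_tendsto:
  assumes "\<And>t. t \<in> {-1..1} \<Longrightarrow> (\<lambda>n. h n t) \<longlonglongrightarrow> g t" "X \<subseteq> sphere_pts k"
  shows "(\<lambda>n. qform k (h n) X c) \<longlonglongrightarrow> qform k g X c"
  unfolding qform_def
proof (intro tendsto_sum tendsto_mult tendsto_const assms(1))
  fix x y assume "x \<in> X" "y \<in> X"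
  then show "sph_inner k x y \<in> {-1..1}" using assms(2) by (intro sph_inner_bounds) auto
qed

text \<open>If the forms of all \<open>ultra d n\<close> vanish, so do those of all polynomials, in
  particular of the peaks, which tend to the diagonal kernel. No decay of \<open>ultra d n\<close>
  enters, so the circle is covered.\<close>

lemma Lambda_plus_all_positive:
  assumes exp: "ultra_expansion d a f" and pos: "\<And>n. a n > 0"
  shows "f \<in> Lambda_plus (Suc d)"
proof (rule Lambda_plus_expansionI[OF exp])
  fix X :: "(nat \<Rightarrow> real) set" and c
  assume X: "finite X" "X \<subseteq> sphere_pts (Suc d)"
    and 0: "\<And>n. a n > 0 \<Longrightarrow> qform (Suc d) (ultra d n) X c = 0"
  have "qform (Suc d) (peak N) X c = 0" for N
  proof -
    obtain b where "\<And>t. poly ([:1/2, 1/2:] ^ N) t = (\<Sum>n\<le>degree ([:1/2, 1/2:] ^ N :: real poly). b n * ultra d n t)"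
      using polynomial_in_span_ultra[of "[:1/2, 1/2:] ^ N" _ d] by blast
    moreover have "poly ([:1/2, 1/2:] ^ N) t = peak N t" for t
      by (simp add: peak_def poly_power add_divide_distrib)
    ultimately have "peak N = (\<lambda>t. \<Sum>n\<le>degree ([:1/2, 1/2:] ^ N :: real poly). b n * ultra d n t)"
      by auto
    then show ?thesis by (simp add: qform_sum qform_cmult 0 pos)
  qed
  moreover have "(\<lambda>N. qform (Suc d) (peak N) X c) \<longlonglongrightarrow> qform (Suc d) (\<lambda>t. if t = 1 then 1 else 0) X c"
  proof (rule qform_tendsto[OF _ X(2)])
    fix t :: real assume t: "t \<in> {-1..1}"
    show "(\<lambda>N. peak N t) \<longlonglongrightarrow> (if t = 1 then 1 else 0)"
      using t by (auto simp: peak_def intro!: LIMSEQ_realpow_zero)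
  qed
  ultimately show "(\<Sum>x\<in>X. (c x)^2) = 0"
    using qform_diagonal[OF X] by (simp add: LIMSEQ_const_iff)
qed

section \<open>Decay of the polynomials inside the interval\<close>

text \<open>Each decrement is at least (e n)^2 / (n + 2), while the form itself is at most a
  multiple of (e n)^2 + (e (n+1))^2. A positive limit would therefore bound 1 / (n + 3) by a
  multiple of telescoping differences, and the harmonic series would converge.\<close>

lemma turan_tendsto_0:
  assumes d: "d \<ge> 1" and t: "\<bar>t\<bar> < 1"
  shows "(\<lambda>n. turan d n t) \<longlonglongrightarrow> 0"
proof -
  let ?E = "\<lambda>n. turan d n t"
  define s where "s = 1 - t^2"
  have s: "0 < s" "s \<le> 1" using t by (auto simp: s_def abs_square_less_1)
  define e where "e n = t * ultra d (Suc n) t - ultra d n t" for n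
  have E0: "0 \<le> ?E n" for n
    using turan_ge[of t d n] s by (intro order_trans[OF _ turan_ge[of t d n]]) (simp add: s_def)
  have E: "?E n = (e n)^2 + s * (ultra d (Suc n) t)^2" for n
    by (simp add: turan_def e_def s_def power2_eq_square algebra_simps)
  \<comment> \<open>Here d \<ge> 1 enters: 1 - \<rho>^2 \<ge> 1 - \<rho> = d / (n + 1 + d) \<ge> 1 /
    (n + 2).\<close>
  have gap: "(e n)^2 / (real n + 2) \<le> ?E n - ?E (Suc n)" for n
  proof -
    define \<rho> where "\<rho> = (real n + 1) / (real n + 1 + real d)"
    have \<rho>: "0 \<le> \<rho>" "\<rho> \<le> 1" by (auto simp: \<rho>_def)
    have "1 * (1 + real n) \<le> real d * (1 + real n)"
      using d by (intro mult_right_mono) auto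
    then have "1 / (real n + 2) \<le> 1 - \<rho>"
      by (simp add: \<rho>_def field_simps)
    also have "\<rho>^2 \<le> \<rho>" using \<rho> by (simp add: power2_eq_square mult_left_le)
    then have "1 - \<rho> \<le> 1 - \<rho>^2" by simp
    finally have "1 / (real n + 2) * (e n)^2 \<le> (1 - \<rho>^2) * (e n)^2"
      by (rule mult_right_mono) simp
    then show ?thesis unfolding turan_Suc \<rho>_def e_def by simp
  qed
  \<comment> \<open>A single \<open>e n\<close> may vanish while the form does not. The recurrence
    expresses s * u_(n+1) through two consecutive ones; of the factor 3, the share 2 bounds s *
    u_(n+1)^2 and the share 1 bounds (e n)^2.\<close>
  have Ebound: "?E n \<le> 3 / s * ((e n)^2 + (e (Suc n))^2)" for n
  proof -
    define \<rho> where "\<rho> = (real n + 1) / (real n + 1 + real d)"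
    have \<rho>: "0 \<le> \<rho>" "\<rho> \<le> 1" by (auto simp: \<rho>_def)
    have "(real n + 1 + real d) * (ultra d (n + 2) t - t * ultra d (n + 1) t) = (real n + 1) * e n"
      using ultra_rec[of n d t] by (simp add: e_def algebra_simps)
    moreover have "real n + 1 + real d \<noteq> 0" by linarith
    ultimately have r: "ultra d (Suc (Suc n)) t - t * ultra d (Suc n) t = \<rho> * e n"
      by (simp add: \<rho>_def field_simps)
    have "s * ultra d (Suc n) t = t * (ultra d (Suc (Suc n)) t - t * ultra d (Suc n) t) - e (Suc n)"
      by (simp add: s_def e_def power2_eq_square algebra_simps)
    then have u: "s * ultra d (Suc n) t = t * \<rho> * e n - e (Suc n)" unfolding r by simp
    have "\<bar>t * \<rho>\<bar> \<le> 1" using t \<rho> by (simp add: abs_mult mult_le_one)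
    then have tr: "(t * \<rho>)^2 \<le> 1" by (simp add: abs_square_le_1)
    have "(s * ultra d (Suc n) t)^2 \<le> 2 * ((t * \<rho> * e n)^2 + (e (Suc n))^2)"
      unfolding u using sum_squares_bound[of "t * \<rho> * e n" "- e (Suc n)"]
      by (simp add: power2_eq_square algebra_simps)
    also have "(t * \<rho> * e n)^2 \<le> 1 * (e n)^2"
      unfolding power_mult_distrib[of "t * \<rho>"] by (intro mult_right_mono tr) auto
    finally have "s * (s * (ultra d (Suc n) t)^2) \<le> 2 * ((e n)^2 + (e (Suc n))^2)"
      by (simp add: power2_eq_square mult_ac)
    then have "s * (ultra d (Suc n) t)^2 \<le> 2 / s * ((e n)^2 + (e (Suc n))^2)"
      using s by (simp add: pos_le_divide_eq mult_ac)
    moreover have "(e n)^2 \<le> 1 / s * ((e n)^2 + (e (Suc n))^2)"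
      using s mult_mono[of 1 "1 / s" "(e n)^2" "(e n)^2 + (e (Suc n))^2"] by simp
    moreover have "1 / s * ((e n)^2 + (e (Suc n))^2) + 2 / s * ((e n)^2 + (e (Suc n))^2)
        = 3 / s * ((e n)^2 + (e (Suc n))^2)"
      by (simp add: add_divide_distrib[symmetric] distrib_right[symmetric])
    ultimately show ?thesis unfolding E[of n] by linarith
  qed
  have dec: "decseq ?E" by (intro decseq_SucI turan_antimono)
  obtain L where L: "?E \<longlonglongrightarrow> L" "\<And>n. L \<le> ?E n"
    using decseq_convergent[OF dec, of 0] E0 by blast
  have L0: "0 \<le> L" using LIMSEQ_le_const[OF L(1)] E0 by blast
  have "L = 0"
  proof (rule ccontr)
    assume "L \<noteq> 0"
    then have Lp: "L > 0" using L0 by simp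
    have step: "1 / (real n + 3) \<le> 3 / s / L * (?E n - ?E (Suc (Suc n)))" for n
    proof -
      have "L / (real n + 3) \<le> ?E n / (real n + 3)"
        using L(2)[of n] by (intro divide_right_mono) auto
      also have "\<dots> \<le> 3 / s * ((e n)^2 + (e (Suc n))^2) / (real n + 3)"
        using Ebound[of n] by (intro divide_right_mono) auto
      also have "\<dots> = 3 / s * ((e n)^2 / (real n + 3) + (e (Suc n))^2 / (real n + 3))"
        by (simp add: add_divide_distrib algebra_simps)
      also have "\<dots> \<le> 3 / s * ((e n)^2 / (real n + 2) + (e (Suc n))^2 / (real (Suc n) + 2))"
      proof -
        have "(e n)^2 / (real n + 3) \<le> (e n)^2 / (real n + 2)"
          by (intro divide_left_mono mult_pos_pos) auto
        moreover have "real (Suc n) + 2 = real n + 3" by simp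
        ultimately show ?thesis
          using s by (intro mult_left_mono) (simp_all only: add_right_mono, simp)
      qed
      also have "\<dots> \<le> 3 / s * ((?E n - ?E (Suc n)) + (?E (Suc n) - ?E (Suc (Suc n))))"
        using s gap[of n] gap[of "Suc n"] by (intro mult_left_mono add_mono) auto
      finally have "L / (real n + 3) \<le> 3 / s * (?E n - ?E (Suc (Suc n)))" by simp
      then have "L / (real n + 3) / L \<le> 3 / s * (?E n - ?E (Suc (Suc n))) / L"
        using Lp by (intro divide_right_mono) auto
      then show ?thesis using Lp by simp
    qed
    have tele: "(\<Sum>n<N. ?E n - ?E (Suc (Suc n))) = ?E 0 + ?E 1 - ?E N - ?E (Suc N)" for N
      by (induction N) auto
    have "summable (\<lambda>n. 1 / (real n + 3))"
    proof (rule summableI_nonneg_bounded)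
      fix N
      have "(\<Sum>n<N. 1 / (real n + 3)) \<le> (\<Sum>n<N. 3 / s / L * (?E n - ?E (Suc (Suc n))))"
        by (intro sum_mono step)
      also have "\<dots> = 3 / s / L * (?E 0 + ?E 1 - ?E N - ?E (Suc N))"
        unfolding sum_distrib_left[symmetric] tele ..
      also have "\<dots> \<le> 3 / s / L * (?E 0 + ?E 1)"
        using s Lp E0[of N] E0[of "Suc N"] by (intro mult_left_mono) auto
      finally show "(\<Sum>n<N. 1 / (real n + 3)) \<le> 3 / s / L * (?E 0 + ?E 1)" .
    qed simp
    then have "summable (\<lambda>n. inverse (real (n + 3)))" by (simp add: inverse_eq_divide)
    then have "summable (\<lambda>n. inverse (real n))" by (subst (asm) summable_iff_shift)
    then show False using not_summable_harmonic[where 'a = real] by simp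
  qed
  then show ?thesis using L(1) by simp
qed

lemma ultra_tendsto_0:
  assumes "d \<ge> 1" "\<bar>t\<bar> < 1"
  shows "(\<lambda>n. ultra d n t) \<longlonglongrightarrow> 0"
proof -
  have s: "1 - t^2 > 0" using assms(2) by (simp add: abs_square_less_1)
  have "(\<lambda>n. (ultra d (Suc n) t)^2) \<longlonglongrightarrow> 0"
  proof (rule tendsto_sandwich[OF _ _ tendsto_const])
    show "(\<lambda>n. turan d n t / (1 - t^2)) \<longlonglongrightarrow> 0"
      using tendsto_divide[OF turan_tendsto_0[OF assms] tendsto_const, of "1 - t^2"] s by simp
    show "\<forall>\<^sub>F n in sequentially. (ultra d (Suc n) t)^2 \<le> turan d n t / (1 - t^2)"
      using turan_ge[of t d] s by (simp add: pos_le_divide_eq mult.commute)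
  qed simp
  then have "(\<lambda>n. ultra d (Suc n) t) \<longlonglongrightarrow> 0"
    using tendsto_real_sqrt[of "\<lambda>n. (ultra d (Suc n) t)^2" 0 sequentially] tendsto_rabs_zero_iff by simp
  then show ?thesis by (rule LIMSEQ_imp_Suc)
qed

lemma tendsto_const_infinitely_often:
  fixes E :: "nat \<Rightarrow> real"
  assumes "E \<longlonglongrightarrow> 0" "infinite I" "\<And>n. n \<in> I \<Longrightarrow> E n = r"
  shows "r = 0"
proof (rule ccontr)
  assume "r \<noteq> 0"
  then have "\<forall>\<^sub>F n in sequentially. \<bar>E n\<bar> < \<bar>r\<bar>"
    using tendstoD[OF assms(1), of "\<bar>r\<bar>"] by (simp add: dist_real_def)
  then obtain N where N: "\<And>n. n \<ge> N \<Longrightarrow> \<bar>E n\<bar> < \<bar>r\<bar>"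
    by (auto simp: eventually_sequentially)
  obtain n where "n \<in> I" "n \<ge> N"
    using assms(2) by (meson infinite_nat_iff_unbounded_le)
  then show False using N[of n] assms(3)[of n] by simp
qed

text \<open>Off the diagonal and the antidiagonal the forms of \<open>ultra d n\<close> tend to 0, so their limits along
  even and odd \<open>n\<close> are \<open>A + B\<close> and \<open>A - B\<close> with \<open>A\<close> the sum of the squares.\<close>
lemma Lambda_plus_infinitely_many:
  assumes d: "d \<ge> 1" and exp: "ultra_expansion d a f"
    and ev: "infinite {n. even n \<and> a n > 0}" and od: "infinite {n. odd n \<and> a n > 0}"
  shows "f \<in> Lambda_plus (Suc d)"
proof (rule Lambda_plus_expansionI[OF exp])
  fix X :: "(nat \<Rightarrow> real) set" and c
  assume X: "finite X" "X \<subseteq> sphere_pts (Suc d)"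
    and 0: "\<And>n. a n > 0 \<Longrightarrow> qform (Suc d) (ultra d n) X c = 0"
  let ?Q = "\<lambda>h. qform (Suc d) h X c"
  define A where "A = ?Q (\<lambda>t. if t = 1 then 1 else 0)"
  define B where "B = ?Q (\<lambda>t. if t = -1 then 1 else 0)"
  \<comment> \<open>Removing the values 1 and (-1)^n at t = 1 and t = -1 leaves kernels that tend to
    0 at every point of [-1, 1].\<close>
  define r where "r n t = ultra d n t + ((-1) * (if t = 1 then 1 else 0)
      + (- ((-1) ^ n)) * (if t = -1 then 1 else 0))" for n t
  have r: "?Q (r n) = ?Q (ultra d n) + ((-1) * A + (- ((-1) ^ n)) * B)" for n
    unfolding r_def[abs_def] qform_add qform_cmult A_def B_def ..
  have lim: "(\<lambda>n. ?Q (r n)) \<longlonglongrightarrow> ?Q (\<lambda>t. 0)"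
  proof (rule qform_tendsto[OF _ X(2)])
    fix t :: real assume t: "t \<in> {-1..1}"
    have m: "ultra d n (-1) = (-1) ^ n" for n using ultra_minus[of d n 1] by simp
    show "(\<lambda>n. r n t) \<longlonglongrightarrow> 0"
    proof (cases "t = 1 \<or> t = -1")
      case True
      then show ?thesis by (auto simp: r_def m)
    next
      case False
      then have "\<bar>t\<bar> < 1" using t by auto
      then show ?thesis using ultra_tendsto_0[OF d] False by (simp add: r_def)
    qed
  qed
  then have lim0: "(\<lambda>n. ?Q (r n)) \<longlonglongrightarrow> 0" by (simp add: qform_def)
  have "- A - B = 0"
    by (rule tendsto_const_infinitely_often[OF lim0 ev]) (auto simp: r 0)
  moreover have "- A + B = 0"
    by (rule tendsto_const_infinitely_often[OF lim0 od]) (auto simp: r 0)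
  ultimately have "A = 0" by simp
  then show "(\<Sum>x\<in>X. (c x)^2) = 0" using qform_diagonal[OF X] by (simp add: A_def)
qed

section \<open>Necessity of the parity condition: alternating weights on regular polygons\<close>

lemma ultra_0_cos: "ultra 0 n (cos y) = cos (real n * y)"
proof (induction n rule: induct_nat_012)
  case (ge2 n)
  have "(real n + 1) * ultra 0 (n + 2) (cos y) =
      (real n + 1) * (2 * cos y * ultra 0 (n + 1) (cos y) - ultra 0 n (cos y))"
    using ultra_rec[of n 0 "cos y"] by (simp add: algebra_simps)
  moreover have "real n + 1 \<noteq> 0" by linarith
  ultimately have "ultra 0 (n + 2) (cos y) = 2 * cos y * ultra 0 (n + 1) (cos y) - ultra 0 n (cos y)"
    using mult_left_cancel by blast
  also have "\<dots> = 2 * cos y * cos (real (n + 1) * y) - cos (real n * y)"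
    using ge2 by simp
  also have "\<dots> = cos (real (n + 2) * y)"
    using cos_times_cos[of y "real (n + 1) * y"] cos_minus[of "real n * y"]
    by (simp add: algebra_simps)
  finally show ?case by simp
qed simp_all

text \<open>A geometric sum: the alternating sign and the rotation combine to w = - exp (- i q pi /
  M), a root of unity of order dividing 2 M, and q < M rules out w = 1.\<close>

lemma sum_alternating_cos:
  assumes q: "q < M"
  shows "(\<Sum>j<2 * M. (-1) ^ j * cos (real q * (y - pi * real j / real M))) = 0"
proof -
  define w where "w = - cis (- (real q * pi / real M))"
  have M: "M > 0" using q by simp
  have wM: "w ^ (2 * M) = 1"
  proof -
    have "w ^ (2 * M) = cis (- (real q * pi / real M)) ^ (2 * M)"
      by (simp add: w_def power_mult)
    also have "\<dots> = cis (real (2 * M) * (- (real q * pi / real M)))"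
      by (rule Complex.DeMoivre)
    also have "real (2 * M) * (- (real q * pi / real M)) = 2 * pi * of_int (- int q)"
      using M by (simp add: field_simps)
    also have "cis \<dots> = 1" by (rule cis_multiple_2pi) simp
    finally show ?thesis .
  qed
  have "w \<noteq> 1"
  proof
    assume "w = 1"
    then have "cis (- (real q * pi / real M)) = -1" by (simp add: w_def minus_equation_iff)
    then have "cos (real q * pi / real M) = -1" by (metis cis.simps(1) cos_minus one_complex.simps(1) uminus_complex.simps(1))
    moreover have "real q * pi / real M < pi"
      using q M by (simp add: divide_less_eq)
    moreover have "0 \<le> real q * pi / real M" by simp
    ultimately have "cos pi < cos (real q * pi / real M)"
      by (intro cos_monotone_0_pi) auto
    then show False using \<open>cos (real q * pi / real M) = -1\<close> by simp
  qed
  have "(\<Sum>j<2 * M. (-1) ^ j * cos (real q * (y - pi * real j / real M))) =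
      Re (cis (real q * y) * (\<Sum>j<2 * M. w ^ j))"
  proof -
    have "(-1) ^ j * cos (real q * (y - pi * real j / real M)) = Re (cis (real q * y) * w ^ j)" for j
    proof -
      have "w ^ j = (-1) ^ j * cis (real j * (- (real q * pi / real M)))"
        unfolding w_def by (subst power_minus) (simp add: Complex.DeMoivre)
      then have "cis (real q * y) * w ^ j = complex_of_real ((-1) ^ j) * (cis (real q * y) * cis (real j * (- (real q * pi / real M))))"
        by simp
      also note cis_mult
      also have "real q * y + real j * (- (real q * pi / real M)) = real q * (y - pi * real j / real M)"
        by (simp add: algebra_simps)
      finally show ?thesis by (simp only: times_complex.simps Re_complex_of_real Im_complex_of_real cis.simps)
    qed
    then show ?thesis by (simp only: sum_distrib_left Re_sum)
  qed
  also have "(\<Sum>j<2 * M. w ^ j) = 0"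
    using wM \<open>w \<noteq> 1\<close> by (simp add: geometric_sum)
  finally show ?thesis by simp
qed

text \<open>Below degree M, expand in Chebyshev polynomials, which only involves frequencies below
  M. For the wrong parity, the vertices j and j + M are antipodal and their terms cancel.\<close>

lemma sum_alternating_ultra:
  assumes M: "M > 0" and n: "n < M \<or> (even n \<noteq> even M)"
  shows "(\<Sum>j<2 * M. (-1) ^ j * ultra d n (cos (y - pi * real j / real M))) = 0"
  using n
proof
  assume "n < M"
  obtain p where p: "degree p = n" "ultra d n = poly p" using ultra_is_polynomial by blast
  obtain b where b: "\<And>t. poly p t = (\<Sum>i\<le>n. b i * ultra 0 i t)"
    using polynomial_in_span_ultra[of p n 0] p(1) by auto
  have "(\<Sum>j<2 * M. (-1) ^ j * ultra d n (cos (y - pi * real j / real M))) =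
      (\<Sum>j<2 * M. \<Sum>i\<le>n. b i * ((-1) ^ j * cos (real i * (y - pi * real j / real M))))"
    by (simp add: p(2) b ultra_0_cos sum_distrib_left mult_ac)
  also have "\<dots> = (\<Sum>i\<le>n. b i * (\<Sum>j<2 * M. (-1) ^ j * cos (real i * (y - pi * real j / real M))))"
    by (subst sum.swap) (simp add: sum_distrib_left)
  also have "\<dots> = 0"
    using \<open>n < M\<close> by (intro sum.neutral) (auto simp: sum_alternating_cos)
  finally show ?thesis .
next
  assume par: "even n \<noteq> even M"
  let ?g = "\<lambda>j. (-1) ^ j * ultra d n (cos (y - pi * real j / real M))"
  have "(\<Sum>j<2 * M. ?g j) = (\<Sum>j<M. ?g j) + (\<Sum>j<M. ?g (j + M))"
  proof -
    have "(\<Sum>j<M + M. ?g j) = (\<Sum>j<M. ?g j) + (\<Sum>j=M..<M + M. ?g j)"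
      by (simp add: lessThan_atLeast0 sum.atLeastLessThan_concat)
    also have "(\<Sum>j=M..<M + M. ?g j) = (\<Sum>j=0..<M. ?g (j + M))"
      using sum.shift_bounds_nat_ivl[of ?g 0 M M] by simp
    finally show ?thesis by (simp add: lessThan_atLeast0 mult_2)
  qed
  moreover have "?g (j + M) = - ?g j" for j
  proof -
    have "y - pi * real (j + M) / real M = (y - pi * real j / real M) - pi"
      using M by (simp add: field_simps)
    moreover have "cos (z - pi) = - cos z" for z :: real by (simp add: cos_diff)
    ultimately have "cos (y - pi * real (j + M) / real M) = - cos (y - pi * real j / real M)"
      by (simp only:)
    moreover have "(-1::real) ^ M * (-1) ^ n = -1"
      using par by (cases "even n") (auto simp: power_add[symmetric])
    moreover have "(-1::real) ^ (j + M) * ((-1) ^ n * u) = (-1) ^ M * (-1) ^ n * ((-1) ^ j * u)" for u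
      by (simp only: power_add mult_ac)
    ultimately show ?thesis by (simp only: ultra_minus)
  qed
  ultimately show ?thesis by (simp only: sum_negf add.right_inverse)
qed

text \<open>If the coefficients of one parity vanish from some index on, the alternating weights on a
  regular \<open>2 * M\<close>-gon of that parity annihilate every term of the expansion.\<close>
lemma Lambda_plus_imp_infinite:
  assumes f: "f \<in> Lambda_plus (Suc d)" and exp: "ultra_expansion d a f"
  shows "infinite {n. even n = p \<and> a n > 0}"
proof
  assume "finite {n. even n = p \<and> a n > 0}"
  then obtain K where K: "\<And>n. even n = p \<Longrightarrow> a n > 0 \<Longrightarrow> n < K"
    using finite_nat_set_iff_bounded[of "{n. even n = p \<and> a n > 0}"] by auto
  \<comment> \<open>With M above K and of the critical parity, every index n is below M, or of the
    other parity, or has a n = 0.\<close>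
  define M where "M = (if even (Suc K) = p then Suc K else Suc (Suc K))"
  have M: "M > K" "M > 0" "even M = p" by (auto simp: M_def)
  define x where "x j = (\<lambda>i::nat. if i = 0 then cos (pi * real j / real M)
      else if i = Suc 0 then sin (pi * real j / real M) else 0)" for j
  define J where "J = {..<2 * M}"
  have sum2: "(\<Sum>i\<le>Suc d. g i) = g 0 + g (Suc 0)" if "\<And>i. i > Suc 0 \<Longrightarrow> g i = 0" for g :: "nat \<Rightarrow> real"
  proof -
    have "(\<Sum>i\<le>Suc d. g i) = (\<Sum>i\<in>{0, Suc 0}. g i)"
      using that by (intro sum.mono_neutral_right) auto
    then show ?thesis by simp
  qed
  have xS: "x j \<in> sphere_pts (Suc d)" for j
    unfolding sphere_pts_def by (auto simp: x_def sum2 simp del: sum.atMost_Suc)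
  have ip: "sph_inner (Suc d) (x i) (x j) = cos (pi * real i / real M - pi * real j / real M)" for i j
    unfolding sph_inner_def by (subst sum2) (auto simp: x_def cos_diff)
  have inj: "inj_on x J"
  proof (rule inj_onI)
    fix i j assume ij: "i \<in> J" "j \<in> J" "x i = x j"
    have "cos (pi * real i / real M) = cos (pi * real j / real M)"
      "sin (pi * real i / real M) = sin (pi * real j / real M)"
      using fun_cong[OF ij(3), of 0] fun_cong[OF ij(3), of "Suc 0"] by (auto simp: x_def)
    then obtain n where n: "pi * real i / real M = pi * real j / real M + 2 * pi * of_int n"
      using sin_cos_eq_iff by blast
    then have "pi * (real i / real M) = pi * (real j / real M + 2 * of_int n)"
      by (simp only: times_divide_eq_right distrib_left)
    then have "real i / real M = real j / real M + 2 * of_int n" by (rule mult_left_cancel[OF pi_neq_zero, THEN iffD1])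
    then have "real i = real j + 2 * of_int n * real M"
      using M by (simp add: field_simps)
    then have "real_of_int (int i) = real_of_int (int j + 2 * n * int M)" by simp
    then have e: "int i = int j + 2 * n * int M" by (simp only: of_int_eq_iff)
    have "n = 0"
    proof (rule ccontr)
      assume "n \<noteq> 0"
      then have "\<bar>2 * n * int M\<bar> \<ge> 2 * int M" using M by (simp add: abs_mult)
      moreover have "int i < 2 * int M" "int j < 2 * int M" using ij by (auto simp: J_def)
      ultimately show False using e by linarith
    qed
    then show "i = j" using e by simp
  qed
  define c where "c z = (-1::real) ^ (inv_into J x z)" for z
  have cx: "c (x j) = (-1) ^ j" if "j \<in> J" for j
    using that inj by (simp add: c_def)
  have Q: "qform (Suc d) h (x ` J) c =
      (\<Sum>i\<in>J. (-1) ^ i * (\<Sum>j\<in>J. (-1) ^ j * h (cos (pi * real i / real M - pi * real j / real M))))" for h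
    unfolding qform_def
    by (simp add: sum.reindex[OF inj] cx ip sum_distrib_left mult_ac)
  have "a n * qform (Suc d) (ultra d n) (x ` J) c = 0" for n
  proof (cases "n < M \<or> (even n \<noteq> even M)")
    case True
    show ?thesis
      unfolding Q unfolding J_def by (simp add: sum_alternating_ultra[OF M(2) True])
  next
    case False
    then have "\<not> a n > 0" using K[of n] M by auto
    then show ?thesis using exp by (auto simp: ultra_expansion_def order.antisym)
  qed
  moreover have "x ` J \<subseteq> sphere_pts (Suc d)" using xS by blast
  ultimately have "(\<lambda>n. 0) sums qform (Suc d) f (x ` J) c"
    using ultra_expansion_qform[OF exp, of "x ` J" "Suc d" c] by (simp only:)
  then have "qform (Suc d) f (x ` J) c = 0" using sums_unique2[OF sums_zero] by metis
  moreover have "\<exists>z\<in>x ` J. c z \<noteq> 0"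
    using M by (intro bexI[of _ "x 0"]) (simp_all add: J_def c_def)
  moreover have "finite (x ` J)" by (simp add: J_def)
  ultimately show False
    using f \<open>x ` J \<subseteq> _\<close> unfolding Lambda_plus_iff by (metis less_irrefl)
qed

section \<open>The integral operators\<close>

lemma Beta_add_nat:
  assumes "a > 0" "b > (0::real)"
  shows "Beta a (b + real j) = Beta a b * pochhammer b j / pochhammer (a + b) j"
proof (induction j)
  case (Suc j)
  have p: "pochhammer (a + b) j > 0" "a + b + real j > 0" using assms by (auto intro: pochhammer_pos)
  have "b + real j \<notin> \<int>\<^sub>\<le>\<^sub>0" using assms by (auto elim!: nonpos_Ints_cases)
  then have "(a + b + real j) * Beta a (b + real (Suc j)) = (b + real j) * Beta a (b + real j)"
    using Beta_plus1_right[of "b + real j" a] by (simp add: algebra_simps)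
  then have "Beta a (b + real (Suc j)) = (b + real j) * Beta a (b + real j) / (a + b + real j)"
    using p by (simp add: eq_divide_eq mult.commute)
  then show ?case
    unfolding Suc pochhammer_Suc by (simp add: mult_ac)
qed simp

text \<open>Kernel of \<open>I_minus\<close> without the outer power. The operator at the other
  endpoint is reduced to this one by \<open>I_plus_reflect\<close>.\<close>

definition half_weight :: "real \<Rightarrow> real \<Rightarrow> real \<Rightarrow> real" where
  "half_weight lam x \<tau> = (\<tau> - x) powr (-1/2) * (1 - \<tau>) powr lam"

lemma half_weight_measurable [measurable]: "half_weight lam x \<in> borel_measurable borel"
  unfolding half_weight_def by measurable

lemma half_weight_nonneg [simp]: "0 \<le> half_weight lam x \<tau>"
  by (simp add: half_weight_def)

text \<open>The substitution \<tau> = x + (1 - x) s turns the integrand into that of Beta (1/2, lam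
  + 1 + j), which yields both integrability and the value.\<close>

lemma half_weight_power:
  assumes x: "x < 1" and lam: "lam \<ge> 0"
  shows "set_integrable lborel {x..1} (\<lambda>\<tau>. half_weight lam x \<tau> * ((1 - \<tau>) / 2) ^ j)"
    and "(LINT \<tau>:{x..1}|lborel. half_weight lam x \<tau> * ((1 - \<tau>) / 2) ^ j) =
      (1 - x) powr (lam + real j + 1/2) / 2 ^ j * Beta (1/2) (lam + 1 + real j)"
proof -
  let ?c = "1 - x"
  let ?F = "\<lambda>\<tau>. indicator {x..1} \<tau> *\<^sub>R (half_weight lam x \<tau> * ((1 - \<tau>) / 2) ^ j)"
  let ?G = "\<lambda>s. indicator {0..1} s *\<^sub>R (s powr (1/2 - 1) * (1 - s) powr ((lam + 1 + real j) - 1))"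
  define C where "C = ?c powr (lam + real j - 1/2) / 2 ^ j"
  have sub: "?F (x + ?c * s) = C * ?G s" for s
  proof (cases "s \<in> {0..1}")
    case True
    have "0 \<le> ?c * s" "?c * s \<le> ?c * 1"
      using True x by (intro mult_nonneg_nonneg mult_left_mono; simp)+
    then have i1: "indicator {x..1} (x + ?c * s) = (1::real)"
      by (simp add: indicator_def)
    have e: "x + ?c * s - x = ?c * s" "1 - (x + ?c * s) = ?c * (1 - s)" by (simp_all add: algebra_simps)
    have p: "(1 - s) powr (lam + real j) = (1 - s) powr lam * (1 - s) ^ j"
      using True by (cases "s = 1") (auto simp: powr_add powr_realpow)
    have q: "?c powr (lam + real j - 1/2) = ?c powr (-1/2) * ?c powr lam * ?c ^ j"
    proof -
      have "lam + real j - 1/2 = - 1/2 + lam + real j" by simp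
      then show ?thesis using x by (simp only: powr_add) (simp add: powr_realpow)
    qed
    show ?thesis
      unfolding i1 half_weight_def e using True x
      by (simp add: C_def p q powr_mult power_mult_distrib power_divide)
  next
    case False
    then consider "s < 0" | "s > 1" by fastforce
    then have "?c * s < 0 \<or> ?c * 1 < ?c * s"
      by cases (use x in \<open>simp_all add: mult_pos_neg\<close>)
    then have "x + ?c * s \<notin> {x..1}"
      by auto
    then show ?thesis using False by simp
  qed
  have intG: "integrable lborel ?G"
    using integrable_Beta[of "1/2" "lam + 1 + real j"] lam by (simp add: set_integrable_def)
  have valG: "(\<integral>s. ?G s \<partial>lborel) = Beta (1/2) (lam + 1 + real j)"
    using set_borel_integral_eq_integral(2)[OF integrable_Beta[of "1/2" "lam + 1 + real j"]]
      has_integral_Beta_real[of "1/2" "lam + 1 + real j"] lam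
    by (simp add: set_lebesgue_integral_def integral_unique)
  have "integrable lborel (\<lambda>s. ?F (x + ?c * s))"
    unfolding sub using intG by (intro integrable_mult_right)
  then show "set_integrable lborel {x..1} (\<lambda>\<tau>. half_weight lam x \<tau> * ((1 - \<tau>) / 2) ^ j)"
    unfolding set_integrable_def using lborel_integrable_real_affine_iff[of ?c ?F x] x by simp
  have "(\<integral>\<tau>. ?F \<tau> \<partial>lborel) = \<bar>?c\<bar> *\<^sub>R (\<integral>s. ?F (x + ?c * s) \<partial>lborel)"
    by (rule lborel_integral_real_affine) (use x in simp)
  also have "\<dots> = ?c * C * Beta (1/2) (lam + 1 + real j)"
    unfolding sub using x valG by simp
  also have "?c * C = ?c powr (lam + real j + 1/2) / 2 ^ j"
  proof -
    have "?c * ?c powr (lam + real j - 1/2) = ?c powr 1 * ?c powr (lam + real j - 1/2)" using x by simp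
    also have "\<dots> = ?c powr (lam + real j + 1/2)" by (simp only: powr_add[symmetric]) (simp add: add_ac)
    finally show ?thesis by (simp add: C_def)
  qed
  finally show "(LINT \<tau>:{x..1}|lborel. half_weight lam x \<tau> * ((1 - \<tau>) / 2) ^ j) =
      (1 - x) powr (lam + real j + 1/2) / 2 ^ j * Beta (1/2) (lam + 1 + real j)"
    by (simp add: set_lebesgue_integral_def)
qed

lemma half_weight_integrable:
  assumes x: "-1 \<le> x" "x < 1" and lam: "lam \<ge> 0" and g: "continuous_on {-1..1} g"
  shows "set_integrable lborel {x..1} (\<lambda>\<tau>. half_weight lam x \<tau> * g \<tau>)"
proof -
  obtain B where B: "\<And>t. t \<in> {-1..1} \<Longrightarrow> \<bar>g t\<bar> \<le> B"
    using continuous_on_Icc_bounded[OF g] by blast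
  have w: "integrable lborel (\<lambda>\<tau>. indicator {x..1} \<tau> *\<^sub>R half_weight lam x \<tau>)"
    using half_weight_power(1)[OF x(2) lam, of 0] by (simp add: set_integrable_def)
  have gm [measurable]: "(\<lambda>t. indicator {-1..1} t *\<^sub>R g t) \<in> borel_measurable borel"
    by (rule borel_measurable_continuous_on_indicator) (use g in auto)
  have eq: "indicator {x..1} \<tau> *\<^sub>R (half_weight lam x \<tau> * g \<tau>) =
      indicator {x..1} \<tau> *\<^sub>R (half_weight lam x \<tau> * (indicator {-1..1} \<tau> *\<^sub>R g \<tau>))" for \<tau>
    using x by (auto simp: indicator_def)
  have "integrable lborel (\<lambda>\<tau>. indicator {x..1} \<tau> *\<^sub>R (half_weight lam x \<tau> * g \<tau>))"
  proof (rule Bochner_Integration.integrable_bound)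
    show "integrable lborel (\<lambda>\<tau>. B * (indicator {x..1} \<tau> *\<^sub>R half_weight lam x \<tau>))"
      using w by (intro integrable_mult_right)
    show "(\<lambda>\<tau>. indicator {x..1} \<tau> *\<^sub>R (half_weight lam x \<tau> * g \<tau>)) \<in> borel_measurable lborel"
      unfolding eq by measurable
    show "AE \<tau> in lborel. norm (indicator {x..1} \<tau> *\<^sub>R (half_weight lam x \<tau> * g \<tau>))
        \<le> norm (B * (indicator {x..1} \<tau> *\<^sub>R half_weight lam x \<tau>))"
    proof (rule AE_I2)
      fix \<tau> :: real
      show "norm (indicator {x..1} \<tau> *\<^sub>R (half_weight lam x \<tau> * g \<tau>))
        \<le> norm (B * (indicator {x..1} \<tau> *\<^sub>R half_weight lam x \<tau>))"
      proof (cases "\<tau> \<in> {x..1}")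
        case True
        then have "\<bar>g \<tau>\<bar> \<le> \<bar>B\<bar>" using B[of \<tau>] x by auto
        then have "half_weight lam x \<tau> * \<bar>g \<tau>\<bar> \<le> half_weight lam x \<tau> * \<bar>B\<bar>"
          by (intro mult_left_mono) auto
        then show ?thesis using True by (simp add: abs_mult mult.commute)
      qed simp
    qed
  qed
  then show ?thesis by (simp add: set_integrable_def)
qed

lemma I_minus_half_weight:
  "I_minus lam f x = (1 - x) powr (- lam + 1/2) * (LINT \<tau>:{x..1}|lborel. half_weight lam x \<tau> * f \<tau>)"
  by (simp add: I_minus_def half_weight_def)

text \<open>For lam > 1/2 the outer power is singular at 1 and takes the default value
  \<open>0 powr _ = 0\<close>. For bounded f this agrees with the limit, the expression being of
  order 1 - x.\<close>

lemma I_minus_at_1: "I_minus lam f 1 = 0"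
  by (simp add: I_minus_def)

lemma I_minus_sum:
  assumes x: "x \<in> {-1..1}" and lam: "lam \<ge> 0" and I: "finite I" "\<And>i. i \<in> I \<Longrightarrow> continuous_on {-1..1} (g i)"
  shows "I_minus lam (\<lambda>t. \<Sum>i\<in>I. a i * g i t) x = (\<Sum>i\<in>I. a i * I_minus lam (g i) x)"
proof (cases "x = 1")
  case True
  then show ?thesis by (simp add: I_minus_at_1)
next
  case False
  then have x': "-1 \<le> x" "x < 1" using x by auto
  have int: "set_integrable lborel {x..1} (\<lambda>\<tau>. a i * (half_weight lam x \<tau> * g i \<tau>))" if "i \<in> I" for i
    using half_weight_integrable[OF x' lam I(2)[OF that]] by (intro set_integrable_mult_right)
  have "(LINT \<tau>:{x..1}|lborel. half_weight lam x \<tau> * (\<Sum>i\<in>I. a i * g i \<tau>)) =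
      (LINT \<tau>:{x..1}|lborel. (\<Sum>i\<in>I. a i * (half_weight lam x \<tau> * g i \<tau>)))"
    by (simp add: sum_distrib_left mult_ac)
  also have "\<dots> = (\<Sum>i\<in>I. a i * (LINT \<tau>:{x..1}|lborel. half_weight lam x \<tau> * g i \<tau>))"
    unfolding set_lebesgue_integral_def scaleR_sum_right
    by (subst Bochner_Integration.integral_sum)
      (use int in \<open>auto simp: set_integrable_def mult.left_commute simp del: integral_mult_right_zero
        intro!: sum.cong simp flip: integral_mult_right_zero\<close>)
  finally show ?thesis
    by (simp add: I_minus_half_weight sum_distrib_left mult_ac)
qed

section \<open>Action of the operators on ultraspherical polynomials and expansions\<close>

text \<open>The \<alpha>_n of the overview. Its value is forced by the coefficient of z in
  \<open>I_minus_ultra\<close>, where \<open>ucoeff d n 1 - ucoeff d (Suc n) 1\<close> equals 2 (2 n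
  + d + 1) / (d + 1).\<close>

definition I_factor :: "nat \<Rightarrow> nat \<Rightarrow> real" where
  "I_factor d n = Beta (1/2) (real d / 2 + 1) * (real d + 1) / (2 * real n + real d + 1)"

lemma I_factor_pos: "I_factor d n > 0"
proof -
  have "Beta (1/2) (real d / 2 + 1) > 0"
    unfolding Beta_def by (intro divide_pos_pos mult_pos_pos Gamma_real_pos) (auto simp: add_nonneg_pos)
  then show ?thesis unfolding I_factor_def by (intro divide_pos_pos mult_pos_pos) auto
qed

lemma I_factor_le: "I_factor d n \<le> I_factor d 0"
proof -
  have "Beta (1/2) (real d / 2 + 1) * (real d + 1) > 0"
    using I_factor_pos[of d 0] by (simp add: I_factor_def zero_less_divide_iff)
  then show ?thesis unfolding I_factor_def by (intro divide_left_mono mult_pos_pos) auto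
qed

text \<open>Comparison of the coefficients of z^(j+1) in \<open>I_minus_ultra\<close>; the constant
  terms there are both 1 and cancel.\<close>

lemma I_factor_ucoeff:
  "2 * Beta (1/2) (real d / 2 + 1 + real j) * ucoeff (Suc d) n j =
     I_factor d n * (ucoeff d n (Suc j) - ucoeff d (Suc n) (Suc j))"
proof -
  define N D r B where "N = real n" and "D = real d" and "r = real j" and "B = Beta (1/2) (D / 2 + 1)"
  define A where "A = pochhammer (- N) j"
  define P where "P = pochhammer (N + D + 1) j"
  define Q where "Q = pochhammer ((D + 3) / 2) j"
  define R where "R = pochhammer ((D + 2) / 2) j"
  have pos: "Q > 0" "R > 0" "D \<ge> 0" "N \<ge> 0" "r \<ge> 0"
    by (auto simp: Q_def R_def D_def N_def r_def intro!: pochhammer_pos)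
  have "Beta (1/2) (D / 2 + 1 + r) = B * R / Q"
    using Beta_add_nat[of "1/2" "D / 2 + 1" j] pos
    by (simp add: B_def R_def Q_def r_def add_divide_distrib add_ac)
  then have lhs: "2 * Beta (1/2) (D / 2 + 1 + r) * ucoeff (Suc d) n j = 2 * B * A * P / (Q * fact j)"
    using pos by (simp add: ucoeff_def A_def P_def N_def D_def R_def add_ac)
  have n1: "pochhammer (- N) (Suc j) = A * (r - N)"
    by (simp add: pochhammer_Suc A_def r_def algebra_simps)
  have n2: "pochhammer (- (N + 1)) (Suc j) = - (N + 1) * A"
    by (simp add: pochhammer_rec A_def)
  have p1: "pochhammer (N + D) (Suc j) = (N + D) * P"
    by (simp add: pochhammer_rec P_def)
  have p2: "pochhammer (N + 1 + D) (Suc j) = P * (N + D + 1 + r)"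
    by (simp add: pochhammer_Suc P_def r_def algebra_simps)
  have q: "pochhammer ((D + 1) / 2) (Suc j) = (D + 1) / 2 * Q"
    unfolding pochhammer_rec Q_def by (simp add: add_divide_distrib add_ac)
  have f: "(fact (Suc j) :: real) = (r + 1) * fact j" by (simp add: r_def)
  have "ucoeff d n (Suc j) - ucoeff d (Suc n) (Suc j) =
    (A * (r - N) * ((N + D) * P) - (- (N + 1) * A) * (P * (N + D + 1 + r))) / ((D + 1) / 2 * Q * ((r + 1) * fact j))"
    unfolding ucoeff_def diff_divide_distrib[symmetric] D_def[symmetric] of_nat_Suc[of n] N_def[symmetric]
      add.commute[of 1 N] n1 n2 p1 p2 q f ..
  also have "A * (r - N) * ((N + D) * P) - (- (N + 1) * A) * (P * (N + D + 1 + r)) = A * P * (2 * N + D + 1) * (r + 1)"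
    by (simp add: algebra_simps)
  also have "A * P * (2 * N + D + 1) * (r + 1) / ((D + 1) / 2 * Q * ((r + 1) * fact j)) =
      (A * P * (2 * N + D + 1)) * (r + 1) / (((D + 1) / 2 * Q * fact j) * (r + 1))"
    by (simp only: mult_ac)
  also have "\<dots> = A * P * (2 * N + D + 1) / ((D + 1) / 2 * Q * fact j)"
    by (rule nonzero_mult_divide_mult_cancel_right) (use pos in simp)
  finally have rhs: "ucoeff d n (Suc j) - ucoeff d (Suc n) (Suc j) = A * P * (2 * N + D + 1) / ((D + 1) / 2 * Q * fact j)" .
  have "2 * N + D + 1 > 0" "D + 1 > 0" using pos by linarith+
  then have "I_factor d n * (A * P * (2 * N + D + 1) / ((D + 1) / 2 * Q * fact j)) = 2 * B * A * P / (Q * fact j)"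
    unfolding I_factor_def D_def[symmetric] N_def[symmetric] B_def[symmetric] by simp
  then show ?thesis using lhs rhs by (simp add: D_def r_def)
qed

lemma ultra_sum: "n \<le> N \<Longrightarrow> ultra d n x = (\<Sum>j\<le>N. ucoeff d n j * ((1 - x) / 2) ^ j)"
  unfolding ultra_def poly_altdef degree_upoly coeff_upoly
  by (rule sum.mono_neutral_left) (auto simp: ucoeff_eq_0)

text \<open>The exponents -\<lambda> + 1/2 and \<lambda> + j + 1/2 add up to j + 1, so z^j goes to a
  multiple of z^(j+1) with z = (1 - x) / 2, and the coefficient identity finishes the proof.\<close>

lemma I_minus_ultra:
  assumes x: "x \<in> {-1..1}"
  shows "I_minus (real d / 2) (ultra (Suc d) n) x = I_factor d n * (ultra d n x - ultra d (Suc n) x)"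
proof -
  let ?lam = "real d / 2" and ?z = "(1 - x) / 2"
  have pw: "I_minus ?lam (\<lambda>t. ((1 - t) / 2) ^ j) x = 2 * Beta (1/2) (?lam + 1 + real j) * ?z ^ Suc j" for j
  proof (cases "x = 1")
    case True
    then show ?thesis by (simp add: I_minus_at_1)
  next
    case False
    then have x1: "x < 1" using x by auto
    have "(1 - x) powr (- ?lam + 1/2) * (1 - x) powr (?lam + real j + 1/2) = (1 - x) ^ Suc j"
      using x1 by (simp only: powr_add[symmetric]) (simp add: powr_realpow[symmetric] algebra_simps powr_add)
    then show ?thesis
      unfolding I_minus_half_weight half_weight_power(2)[OF x1, of ?lam j, simplified]
      by (simp add: power_divide)
  qed
  have u: "ultra (Suc d) n = (\<lambda>t. \<Sum>j\<le>n. ucoeff (Suc d) n j * ((1 - t) / 2) ^ j)"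
    by (rule ext) (rule ultra_sum, simp)
  have "I_minus ?lam (ultra (Suc d) n) x = (\<Sum>j\<le>n. ucoeff (Suc d) n j * I_minus ?lam (\<lambda>t. ((1 - t) / 2) ^ j) x)"
    unfolding u using x by (intro I_minus_sum) (auto intro!: continuous_intros)
  also have "\<dots> = (\<Sum>j\<le>n. (2 * Beta (1/2) (?lam + 1 + real j) * ucoeff (Suc d) n j) * ?z ^ Suc j)"
    unfolding pw by (simp only: mult_ac)
  also have "\<dots> = (\<Sum>j\<le>n. I_factor d n * ((ucoeff d n (Suc j) - ucoeff d (Suc n) (Suc j)) * ?z ^ Suc j))"
    unfolding I_factor_ucoeff by (simp only: mult_ac)
  also have "\<dots> = I_factor d n * (\<Sum>j\<le>Suc n. (ucoeff d n j - ucoeff d (Suc n) j) * ?z ^ j)"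
    unfolding sum.atMost_Suc_shift sum_distrib_left[symmetric] by simp
  also have "(\<Sum>j\<le>Suc n. (ucoeff d n j - ucoeff d (Suc n) j) * ?z ^ j) = ultra d n x - ultra d (Suc n) x"
    by (simp only: ultra_sum[of n "Suc n"] ultra_sum[of "Suc n" "Suc n"] left_diff_distrib sum_subtractf order_refl le_SucI)
  finally show ?thesis .
qed

lemma I_plus_reflect: "I_plus lam f x = I_minus lam (\<lambda>t. f (- t)) (- x)"
proof -
  let ?F = "\<lambda>\<tau>. indicator {-1..x} \<tau> *\<^sub>R ((x - \<tau>) powr (-1/2) * (1 + \<tau>) powr lam * f \<tau>)"
  have "(\<integral>\<tau>. ?F \<tau> \<partial>lborel) = \<bar>-1\<bar> *\<^sub>R (\<integral>s. ?F (0 + (-1) * s) \<partial>lborel)"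
    by (rule lborel_integral_real_affine) simp
  also have "\<dots> = (LINT s:{-x..1}|lborel. (s - (- x)) powr (-1/2) * (1 - s) powr lam * f (- s))"
    unfolding set_lebesgue_integral_def
    by (auto intro!: Bochner_Integration.integral_cong simp: indicator_def add.commute)
  finally show ?thesis
    by (simp add: I_plus_def I_minus_def set_lebesgue_integral_def)
qed

text \<open>Dominated convergence with majorant A times \<open>half_weight\<close>. Absolute
  summability replaces nonnegativity because the reflection used for \<open>I_plus\<close> gives the
  coefficients alternating signs.\<close>

lemma I_minus_expansion:
  assumes f: "continuous_on {-1..1} f" and a: "summable (\<lambda>n. \<bar>a n\<bar>)"
    and s: "\<And>t. t \<in> {-1..1} \<Longrightarrow> (\<lambda>n. a n * ultra (Suc d) n t) sums f t"
    and x: "x \<in> {-1..1}"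
  shows "(\<lambda>n. a n * (I_factor d n * (ultra d n x - ultra d (Suc n) x))) sums I_minus (real d / 2) f x"
proof (cases "x = 1")
  case True
  then show ?thesis by (simp add: I_minus_at_1)
next
  case False
  then have x': "-1 \<le> x" "x < 1" using x by auto
  let ?lam = "real d / 2"
  define A where "A = (\<Sum>n. \<bar>a n\<bar>)"
  define S where "S N t = (\<Sum>n<N. a n * ultra (Suc d) n t)" for N t
  have Sc: "continuous_on {-1..1} (S N)" for N unfolding S_def by (intro continuous_intros)
  let ?J = "\<lambda>g. LINT \<tau>:{x..1}|lborel. half_weight ?lam x \<tau> * g \<tau>"
  have "(\<lambda>N. ?J (S N)) \<longlonglongrightarrow> ?J f"
    unfolding set_lebesgue_integral_def
  proof (rule integral_dominated_convergence[where w = "\<lambda>\<tau>. A * (indicator {x..1} \<tau> *\<^sub>R half_weight ?lam x \<tau>)"])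
    show "(\<lambda>\<tau>. indicator {x..1} \<tau> *\<^sub>R (half_weight ?lam x \<tau> * f \<tau>)) \<in> borel_measurable lborel"
      using half_weight_integrable[OF x' _ f, of ?lam] by (auto simp: set_integrable_def)
    show "(\<lambda>\<tau>. indicator {x..1} \<tau> *\<^sub>R (half_weight ?lam x \<tau> * S N \<tau>)) \<in> borel_measurable lborel" for N
      using half_weight_integrable[OF x' _ Sc, of ?lam N] by (auto simp: set_integrable_def)
    have "integrable lborel (\<lambda>\<tau>. indicator {x..1} \<tau> *\<^sub>R half_weight ?lam x \<tau>)"
      using half_weight_power(1)[OF x'(2), of ?lam 0] by (simp add: set_integrable_def)
    then show "integrable lborel (\<lambda>\<tau>. A * (indicator {x..1} \<tau> *\<^sub>R half_weight ?lam x \<tau>))"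
      by (intro integrable_mult_right)
    show "AE \<tau> in lborel. (\<lambda>N. indicator {x..1} \<tau> *\<^sub>R (half_weight ?lam x \<tau> * S N \<tau>))
        \<longlonglongrightarrow> indicator {x..1} \<tau> *\<^sub>R (half_weight ?lam x \<tau> * f \<tau>)"
    proof (rule AE_I2)
      fix \<tau> :: real
      show "(\<lambda>N. indicator {x..1} \<tau> *\<^sub>R (half_weight ?lam x \<tau> * S N \<tau>))
        \<longlonglongrightarrow> indicator {x..1} \<tau> *\<^sub>R (half_weight ?lam x \<tau> * f \<tau>)"
      proof (cases "\<tau> \<in> {x..1}")
        case True
        then have "(\<lambda>N. S N \<tau>) \<longlonglongrightarrow> f \<tau>"
          using s[of \<tau>] x' unfolding sums_def S_def by auto
        then show ?thesis by (intro tendsto_intros)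
      qed simp
    qed
    fix N
    show "AE \<tau> in lborel. norm (indicator {x..1} \<tau> *\<^sub>R (half_weight ?lam x \<tau> * S N \<tau>))
        \<le> A * (indicator {x..1} \<tau> *\<^sub>R half_weight ?lam x \<tau>)"
    proof (rule AE_I2)
      fix \<tau> :: real
      show "norm (indicator {x..1} \<tau> *\<^sub>R (half_weight ?lam x \<tau> * S N \<tau>))
        \<le> A * (indicator {x..1} \<tau> *\<^sub>R half_weight ?lam x \<tau>)"
      proof (cases "\<tau> \<in> {x..1}")
        case True
        then have t: "\<tau> \<in> {-1..1}" using x' by auto
        have "\<bar>S N \<tau>\<bar> \<le> (\<Sum>n<N. \<bar>a n * ultra (Suc d) n \<tau>\<bar>)" unfolding S_def by (rule sum_abs)
        also have "\<dots> \<le> (\<Sum>n<N. \<bar>a n\<bar>)"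
          using abs_ultra_le_1[OF t] by (intro sum_mono) (auto simp: abs_mult mult_left_le)
        also have "\<dots> \<le> A" unfolding A_def using a by (intro sum_le_suminf) auto
        finally have "half_weight ?lam x \<tau> * \<bar>S N \<tau>\<bar> \<le> half_weight ?lam x \<tau> * A"
          by (intro mult_left_mono) auto
        then show ?thesis using True by (simp add: abs_mult mult.commute)
      qed simp
    qed
  qed
  then have "(\<lambda>N. (1 - x) powr (- ?lam + 1/2) * ?J (S N)) \<longlonglongrightarrow> (1 - x) powr (- ?lam + 1/2) * ?J f"
    by (intro tendsto_intros)
  then have "(\<lambda>N. I_minus ?lam (S N) x) \<longlonglongrightarrow> I_minus ?lam f x"
    by (simp only: I_minus_half_weight)
  moreover have "I_minus ?lam (S N) x = (\<Sum>n<N. a n * (I_factor d n * (ultra d n x - ultra d (Suc n) x)))" for N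
    unfolding S_def[abs_def] using x
    by (subst I_minus_sum) (auto intro!: continuous_intros simp: I_minus_ultra)
  ultimately show ?thesis by (simp add: sums_def)
qed

lemma I_expansions:
  assumes exp: "ultra_expansion (Suc d) a f" and x: "x \<in> {-1..1}"
  shows "(\<lambda>n. a n * (I_factor d n * (ultra d n x - ultra d (Suc n) x))) sums I_minus (real d / 2) f x"
    and "(\<lambda>n. a n * (I_factor d n * (ultra d n x + ultra d (Suc n) x))) sums I_plus (real d / 2) f x"
proof -
  have f: "continuous_on {-1..1} f" by (rule ultra_expansion_continuous[OF exp])
  have a: "summable (\<lambda>n. \<bar>a n\<bar>)" and s: "\<And>t. t \<in> {-1..1} \<Longrightarrow> (\<lambda>n. a n * ultra (Suc d) n t) sums f t"
    using exp by (auto simp: ultra_expansion_def)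
  show "(\<lambda>n. a n * (I_factor d n * (ultra d n x - ultra d (Suc n) x))) sums I_minus (real d / 2) f x"
    by (rule I_minus_expansion[OF f a s x])
  have f': "continuous_on {-1..1} (\<lambda>t. f (- t))"
    by (rule continuous_on_compose2[OF f]) (auto intro!: continuous_intros)
  have a': "summable (\<lambda>n. \<bar>(-1) ^ n * a n\<bar>)" using a by (simp add: abs_mult)
  have s': "(\<lambda>n. (-1) ^ n * a n * ultra (Suc d) n t) sums f (- t)" if "t \<in> {-1..1}" for t
    using s[of "- t"] that by (simp add: ultra_minus mult_ac)
  have "(\<lambda>n. (-1) ^ n * a n * (I_factor d n * (ultra d n (- x) - ultra d (Suc n) (- x)))) sums I_plus (real d / 2) f x"
    unfolding I_plus_reflect using x by (intro I_minus_expansion f' a' s') auto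
  moreover have "(-1) ^ n * a n * (I_factor d n * (ultra d n (- x) - ultra d (Suc n) (- x))) =
      ((-1) ^ n * (-1) ^ n) * (a n * (I_factor d n * (ultra d n x + ultra d (Suc n) x)))" for n
    by (simp add: ultra_minus algebra_simps)
  ultimately show "(\<lambda>n. a n * (I_factor d n * (ultra d n x + ultra d (Suc n) x))) sums I_plus (real d / 2) f x"
    by (simp add: power_mult_distrib[symmetric])
qed

lemma cI_plus_expansion:
  assumes exp: "ultra_expansion (Suc d) a f"
  shows "ultra_expansion d (\<lambda>n. 2 * I_factor d n * a n) (cI_plus (real d / 2) f)"
proof -
  have a: "\<And>n. 0 \<le> a n" "summable a" using exp by (auto simp: ultra_expansion_def)
  have "summable (\<lambda>n. 2 * I_factor d n * a n)"
  proof (rule summable_comparison_test'[where N = 0])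
    show "summable (\<lambda>n. 2 * I_factor d 0 * a n)" using a by (intro summable_mult)
    show "norm (2 * I_factor d n * a n) \<le> 2 * I_factor d 0 * a n" for n
      using a I_factor_le[of d n] I_factor_pos[of d n] by (simp add: abs_mult mult_right_mono)
  qed
  moreover have "(\<lambda>n. 2 * I_factor d n * a n * ultra d n x) sums cI_plus (real d / 2) f x" if "x \<in> {-1..1}" for x
    using sums_add[OF I_expansions(2,1)[OF exp that]] by (simp add: cI_plus_def algebra_simps)
  moreover have "0 \<le> 2 * I_factor d n * a n" for n
    using a I_factor_pos[of d n] by simp
  ultimately show ?thesis by (simp add: ultra_expansion_def)
qed

text \<open>In the difference only \<open>ultra d (Suc n)\<close> survives, so the coefficients move
  up one place and the parities are exchanged. The 0 in front explains why part (b) claims positive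
  coefficients for the sum only.\<close>

lemma cI_minus_expansion:
  assumes exp: "ultra_expansion (Suc d) a f"
  shows "ultra_expansion d (case_nat 0 (\<lambda>n. 2 * I_factor d n * a n)) (cI_minus (real d / 2) f)"
proof -
  have b: "summable (\<lambda>n. 2 * I_factor d n * a n)" "\<And>n. 0 \<le> 2 * I_factor d n * a n"
    using cI_plus_expansion[OF exp] by (auto simp: ultra_expansion_def)
  let ?b = "case_nat 0 (\<lambda>n. 2 * I_factor d n * a n)"
  have "summable ?b" using b(1) by (subst summable_Suc_iff[symmetric]) simp
  moreover have "0 \<le> ?b n" for n using b(2) by (simp split: nat.split)
  moreover have "(\<lambda>n. ?b n * ultra d n x) sums cI_minus (real d / 2) f x" if "x \<in> {-1..1}" for x
  proof -
    have "(\<lambda>n. ?b (Suc n) * ultra d (Suc n) x) sums cI_minus (real d / 2) f x"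
      using sums_diff[OF I_expansions(2,1)[OF exp that]] by (simp add: cI_minus_def algebra_simps)
    then show ?thesis using sums_Suc[of "\<lambda>n. ?b n * ultra d n x"] by simp
  qed
  ultimately show ?thesis by (simp add: ultra_expansion_def)
qed

section \<open>Gegenbauer coefficients as zonal integrals\<close>

text \<open>Negative angles are used because cos increases on [-pi, 0], as the substitution rule for
  Lebesgue integrals requires.\<close>

lemma gegen_weight_cos:
  assumes "\<phi> \<in> {-pi<..<0}"
  shows "gegen_weight (real d / 2) (cos \<phi>) * (- sin \<phi>) = (- sin \<phi>) ^ d"
proof -
  define s where "s = - sin \<phi>"
  have s: "s > 0" using assms sin_gt_zero[of "- \<phi>"] by (simp add: s_def)
  have "1 - (cos \<phi>)^2 = s powr 2" using s by (simp add: s_def sin_squared_eq)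
  then have "gegen_weight (real d / 2) (cos \<phi>) * s = (s powr 2) powr ((real d - 1) / 2) * s powr 1"
    using s by (simp add: gegen_weight_def diff_divide_distrib)
  also have "\<dots> = s powr (2 * ((real d - 1) / 2) + 1)" by (simp only: powr_powr powr_add)
  also have "2 * ((real d - 1) / 2) + 1 = real d" by (simp add: field_simps)
  finally show ?thesis using s by (simp add: s_def powr_realpow)
qed

text \<open>For d = 0 the weight is unbounded near both endpoints; t = 2 s - 1 turns it into a Beta
  integrand.\<close>

lemma gegen_weight_integrable: "set_integrable lborel {-1..1} (gegen_weight (real d / 2))"
proof -
  define p where "p = (real d + 1) / 2 - 1"
  have p: "p + 1 > 0" unfolding p_def by (simp only: diff_add_cancel) simp
  have e: "real d / 2 - 1 / 2 = p" by (simp add: p_def field_simps)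
  let ?F = "\<lambda>t. indicator {-1..1} t *\<^sub>R gegen_weight (real d / 2) t"
  let ?G = "\<lambda>s. indicator {0..1} s *\<^sub>R (s powr p * (1 - s) powr p)"
  have sub: "?F (-1 + 2 * s) = 4 powr p * ?G s" for s
  proof (cases "s \<in> {0..1}")
    case True
    have "1 - (-1 + 2 * s)^2 = 4 * (s * (1 - s))" by (simp add: power2_eq_square algebra_simps)
    then show ?thesis using True unfolding gegen_weight_def e by (simp add: powr_mult)
  qed (auto simp: indicator_def)
  have "integrable lborel ?G"
    using integrable_Beta[of "p + 1" "p + 1"] p by (simp add: set_integrable_def)
  then have "integrable lborel (\<lambda>s. ?F (-1 + 2 * s))"
    unfolding sub by (intro integrable_mult_right)
  then show ?thesis
    unfolding set_integrable_def using lborel_integrable_real_affine_iff[of 2 ?F "-1"] by simp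
qed

lemma gegen_weight_integral:
  assumes h: "continuous_on {-1..1} h"
  shows "(LINT t:{-1..1}|lborel. h t * gegen_weight (real d / 2) t) = zonal d h"
proof -
  let ?w = "gegen_weight (real d / 2)"
  obtain B where B: "\<And>t. t \<in> {-1..1} \<Longrightarrow> \<bar>h t\<bar> \<le> B"
    using continuous_on_Icc_bounded[OF h] by blast
  have [measurable]: "?w \<in> borel_measurable borel" unfolding gegen_weight_def[abs_def] by measurable
  have hm [measurable]: "(\<lambda>t. indicator {-1..1} t *\<^sub>R h t) \<in> borel_measurable borel"
    by (rule borel_measurable_continuous_on_indicator) (use h in auto)
  have int: "set_integrable lborel {cos (-pi)..cos 0} (\<lambda>t. h t * ?w t)"
    unfolding set_integrable_def
  proof (rule Bochner_Integration.integrable_bound)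
    show "integrable lborel (\<lambda>t. B * (indicator {-1..1} t *\<^sub>R ?w t))"
      using gegen_weight_integrable[of d] unfolding set_integrable_def by (intro integrable_mult_right)
    have "(\<lambda>t. indicator {cos (-pi)..cos 0} t *\<^sub>R (h t * ?w t)) = (\<lambda>t. (indicator {-1..1} t *\<^sub>R h t) * ?w t)"
      by (auto simp: indicator_def)
    moreover have "(\<lambda>t. (indicator {-1..1} t *\<^sub>R h t) * ?w t) \<in> borel_measurable lborel"
      by measurable
    ultimately show "(\<lambda>t. indicator {cos (-pi)..cos 0} t *\<^sub>R (h t * ?w t)) \<in> borel_measurable lborel"
      by (simp only:)
    show "AE t in lborel. norm (indicator {cos (-pi)..cos 0} t *\<^sub>R (h t * ?w t))
        \<le> norm (B * (indicator {-1..1} t *\<^sub>R ?w t))"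
    proof (rule AE_I2)
      fix t :: real
      show "norm (indicator {cos (-pi)..cos 0} t *\<^sub>R (h t * ?w t)) \<le> norm (B * (indicator {-1..1} t *\<^sub>R ?w t))"
      proof (cases "t \<in> {-1..1}")
        case True
        then have "\<bar>h t\<bar> \<le> \<bar>B\<bar>" using B[OF True] by linarith
        then show ?thesis using True by (simp add: abs_mult mult_right_mono)
      qed (auto simp: indicator_def)
    qed
  qed
  have deriv: "(cos has_real_derivative - sin \<phi>) (at \<phi>)" for \<phi> :: real
    by (rule DERIV_cos)
  have nn: "0 \<le> - sin \<phi>" if "\<phi> \<in> {-pi..0}" for \<phi> :: real
    using that sin_ge_zero[of "- \<phi>"] by simp
  have cont: "continuous_on {-pi..0} (\<lambda>\<phi>. - sin \<phi> :: real)" by (intro continuous_intros)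
  note subst = integral_substitution[OF int deriv cont nn]
  have "(LINT t:{-1..1}|lborel. h t * ?w t) = (\<integral>t. (h t * ?w t) * indicator {cos (-pi)..cos 0} t \<partial>lborel)"
    by (simp add: set_lebesgue_integral_def mult_ac)
  also have "\<dots> = (\<integral>\<phi>. (h (cos \<phi>) * ?w (cos \<phi>)) * (- sin \<phi>) * indicator {-pi..0} \<phi> \<partial>lborel)"
    by (rule subst(2)) auto
  also have "\<dots> = (LINT \<phi>:{-pi..0}|lborel. (h (cos \<phi>) * ?w (cos \<phi>)) * (- sin \<phi>))"
    by (simp add: set_lebesgue_integral_def mult_ac)
  also have "\<dots> = integral {-pi..0} (\<lambda>\<phi>. (h (cos \<phi>) * ?w (cos \<phi>)) * (- sin \<phi>))"
    by (rule set_borel_integral_eq_integral(2)) (rule subst(1), auto)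
  \<comment> \<open>For d = 0 the integrands differ at -pi and 0, where one is 0 and the other is h
    (cos \<phi>); these two angles are discarded as a null set.\<close>
  also have "\<dots> = integral {-pi..0} (\<lambda>\<phi>. sin (- \<phi>) ^ d * h (cos (- \<phi>)))"
  proof (rule integral_spike[of "{-pi, 0}"])
    fix \<phi> :: real assume "\<phi> \<in> {-pi..0} - {-pi, 0}"
    then have "\<phi> \<in> {-pi<..<0}" by auto
    from gegen_weight_cos[OF this, of d]
    show "sin (- \<phi>) ^ d * h (cos (- \<phi>)) = (h (cos \<phi>) * ?w (cos \<phi>)) * (- sin \<phi>)"
      by (simp only: sin_minus cos_minus mult.assoc) (simp only: mult.commute)
  qed simp
  also have "\<dots> = zonal d h"
    unfolding zonal_def using Henstock_Kurzweil_Integration.integral_reflect_real[of pi 0 "\<lambda>\<phi>. sin \<phi> ^ d * h (cos \<phi>)"] by simp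
  finally show ?thesis .
qed

lemma gegen_coeff_pos_iff:
  assumes f: "continuous_on {-1..1} f"
  shows "gegen_coeff (real d / 2) f n > 0 \<longleftrightarrow> zonal d (\<lambda>t. f t * ultra d n t) > 0"
proof -
  obtain c where c: "c > 0" "gegen_sys (real d / 2) n = (\<lambda>x. c * ultra d n x)"
    using gegen_sys_eq_ultra by blast
  have "(LINT t:{-1..1}|lborel. f t * gegen_sys (real d / 2) n t * gegen_weight (real d / 2) t) =
      zonal d (\<lambda>t. c * (f t * ultra d n t))"
    unfolding c(2) using f
    by (subst gegen_weight_integral[symmetric]) (auto intro!: continuous_intros simp: mult_ac)
  moreover have "(LINT t:{-1..1}|lborel. (gegen_sys (real d / 2) n t)^2 * gegen_weight (real d / 2) t) =
      zonal d (\<lambda>t. c^2 * (ultra d n t * ultra d n t))"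
    unfolding c(2)
    by (subst gegen_weight_integral[symmetric]) (auto intro!: continuous_intros simp: power2_eq_square mult_ac)
  moreover have "c^2 * zonal d (\<lambda>t. ultra d n t * ultra d n t) > 0"
    using c(1) zonal_ultra_sq_pos[of d n] by simp
  ultimately show ?thesis
    using c(1) by (simp only: gegen_coeff_def zonal_cmult pos_less_divide_eq mult_zero_left
      zero_less_mult_iff) auto
qed

lemma cI_plus_nonneg:
  assumes "\<And>t. t \<in> {-1..1} \<Longrightarrow> 0 \<le> f t" "x \<in> {-1..1}"
  shows "0 \<le> cI_plus lam f x"
  unfolding cI_plus_def I_plus_def I_minus_def set_lebesgue_integral_def using assms
  by (intro add_nonneg_nonneg mult_nonneg_nonneg Bochner_Integration.integral_nonneg)
    (auto simp: indicator_def)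

theorem theorem2p3:
  fixes m :: nat and lam :: real
  assumes m: "m \<ge> 1" and lam: "lam = (real m - 1) / 2"
  shows
    "(\<forall>f \<in> Lambda (m + 1).
        cI_plus lam f \<in> Lambda m \<and> cI_minus lam f \<in> Lambda m)
   \<and> (m \<ge> 2 \<longrightarrow> (\<forall>f \<in> Lambda_plus (m + 1).
        cI_plus lam f \<in> Lambda_plus m \<and> cI_minus lam f \<in> Lambda_plus m))
   \<and> (\<forall>f \<in> Lambda_plus (m + 1).
        (\<forall>t\<in>{-1..1}. f t \<ge> 0) \<and> (\<forall>n. gegen_coeff (lam + 1/2) f n > 0) \<longrightarrow>
          (\<forall>x\<in>{-1..1}. cI_plus lam f x \<ge> 0) \<and> cI_plus lam f \<in> Lambda_plus m \<and>
          (\<forall>n. gegen_coeff lam (cI_plus lam f) n > 0))"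
proof -
  \<comment> \<open>S^m goes with the index d = m - 1: then lam = d / 2, functions on S^(m+1) expand
    in \<open>ultra (Suc d)\<close> and their images in \<open>ultra d\<close>.\<close>
  obtain d where d: "m = Suc d" using m by (cases m) auto
  have lam': "lam = real d / 2" by (simp add: lam d)
  have lam'': "real d / 2 + 1 / 2 = real (Suc d) / 2" by (simp add: field_simps)
  have exp: "\<exists>a. ultra_expansion (Suc d) a f" if "f \<in> Lambda (Suc (Suc d))" for f
    using Lambda_ultra_expansion[OF that] by blast
  have plus: "Lambda_plus k \<subseteq> Lambda k" for k by (auto simp: Lambda_plus_def)
  have "cI_plus lam f \<in> Lambda m" "cI_minus lam f \<in> Lambda m" if f: "f \<in> Lambda (m + 1)" for f
  proof -
    obtain a where a: "ultra_expansion (Suc d) a f" using exp[of f] f by (auto simp: d)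
    show "cI_plus lam f \<in> Lambda m" "cI_minus lam f \<in> Lambda m"
      unfolding d lam'
      using ultra_expansion_Lambda[OF cI_plus_expansion[OF a]] ultra_expansion_Lambda[OF cI_minus_expansion[OF a]]
      by auto
  qed
  moreover have "cI_plus lam f \<in> Lambda_plus m" "cI_minus lam f \<in> Lambda_plus m"
    if f: "f \<in> Lambda_plus (m + 1)" and m2: "m \<ge> 2" for f
  proof -
    have f': "f \<in> Lambda_plus (Suc (Suc d))" using f by (simp add: d)
    obtain a where a: "ultra_expansion (Suc d) a f" using exp[of f] f' plus by blast
    have d1: "d \<ge> 1" using m2 d by simp
    have inf: "infinite {n. even n = p \<and> a n > 0}" for p
      by (rule Lambda_plus_imp_infinite[OF f' a])
    have pos: "2 * I_factor d n * a n > 0 \<longleftrightarrow> a n > 0" for n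
      using I_factor_pos[of d n] by (simp add: zero_less_mult_iff)
    show "cI_plus lam f \<in> Lambda_plus m"
      unfolding d lam'
      by (rule Lambda_plus_infinitely_many[OF d1 cI_plus_expansion[OF a]])
        (use inf[of True] inf[of False] in \<open>simp_all add: pos\<close>)
    let ?b = "case_nat 0 (\<lambda>n. 2 * I_factor d n * a n)"
    \<comment> \<open>Raising every index by one exchanges the parities, which is harmless because
      both classes are infinite.\<close>
    have shift: "infinite {n. even n = p \<and> ?b n > 0}" for p
    proof
      assume "finite {n. even n = p \<and> ?b n > 0}"
      moreover have "Suc ` {n. even n = (\<not> p) \<and> a n > 0} \<subseteq> {n. even n = p \<and> ?b n > 0}"
        by (auto simp: pos)
      ultimately have "finite (Suc ` {n. even n = (\<not> p) \<and> a n > 0})" by (rule rev_finite_subset)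
      then show False using inf[of "\<not> p"] by (simp add: finite_image_iff)
    qed
    show "cI_minus lam f \<in> Lambda_plus m"
      unfolding d lam'
      by (rule Lambda_plus_infinitely_many[OF d1 cI_minus_expansion[OF a]])
        (use shift[of True] shift[of False] in simp_all)
  qed
  moreover have "(\<forall>x\<in>{-1..1}. cI_plus lam f x \<ge> 0) \<and> cI_plus lam f \<in> Lambda_plus m \<and>
          (\<forall>n. gegen_coeff lam (cI_plus lam f) n > 0)"
    if f: "f \<in> Lambda_plus (m + 1)" and nn: "\<forall>t\<in>{-1..1}. f t \<ge> 0"
      and co: "\<forall>n. gegen_coeff (lam + 1/2) f n > 0" for f
  proof -
    have f': "f \<in> Lambda (Suc (Suc d))" using f plus by (auto simp: d)
    then have fc: "continuous_on {-1..1} f" by (simp add: Lambda_iff)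
    obtain a where a: "ultra_expansion (Suc d) a f" using exp[OF f'] by blast
    have apos: "a n > 0" for n
    proof -
      have "zonal (Suc d) (\<lambda>t. f t * ultra (Suc d) n t) > 0"
        using co gegen_coeff_pos_iff[OF fc, of "Suc d" n] unfolding lam' lam'' by blast
      then show ?thesis
        unfolding ultra_expansion_zonal[OF a] using zonal_ultra_sq_pos[of "Suc d" n]
        by (simp add: zero_less_mult_iff)
    qed
    note g = cI_plus_expansion[OF a]
    have bpos: "2 * I_factor d n * a n > 0" for n
      using apos I_factor_pos by simp
    have "gegen_coeff lam (cI_plus lam f) n > 0" for n
      unfolding lam' gegen_coeff_pos_iff[OF ultra_expansion_continuous[OF g]] ultra_expansion_zonal[OF g]
      using bpos zonal_ultra_sq_pos by (rule mult_pos_pos)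
    moreover have "cI_plus lam f \<in> Lambda_plus m"
      unfolding d lam' by (rule Lambda_plus_all_positive[OF g bpos])
    ultimately show ?thesis using cI_plus_nonneg nn by blast
  qed
  ultimately show ?thesis by blast
qed

end
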